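(* Let $t\in\mathbb R\setminus\{0\}$ and let $J\in\mathbb H_t^{n\times n}$ be a signature matrix, i.e. $J=J^{\circledast}=J^{-1}$. Let $R$ be an $\mathbb H_t^{n\times n}$-valued rational function regular at the origin, and let $R(x)=D+xC(I_{\mathbb H_t^N}-xA)^{-1}B$ be a minimal realization of $R$. Then $R$ satisfies $$R(x)JR(-x)^{\circledast}=J$$ at the real points $x$ where both $R(x)$ and $R(-x)$ are defined, if and only if the following conditions hold: (1) $DJD^{\circledast}=J$; (2) there exists an invertible matrix $H\in\mathbb H_t^{N\times N}$ with $H=H^{\circledast}$ such that $$A^{\circledast}H+HA=-C^{\circledast}JC,\qquad B=-H^{-1}C^{\circledast}JD.$$ Furthermore, $H$ is uniquely determined by the given minimal realization, and $$\frac{J-R(x)JR(y)^{\circledast}}{x+y}=C(I_{\mathbb H_t^N}-xA)^{-1}H^{-1}(I_{\mathbb H_t^N}-yA^{\circledast})^{-1}C^{\circledast}$$ for real $x,y$ for which both sides are defined.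
   Context: For real $t\neq 0$, $\mathbb H_t$ is the real associative algebra of elements $q=a+bj_t$ with $a,b\in\mathbb C$, where $\mathbb C\subset\mathbb H_t$, $j_t^2=t$ and $j_t a=\overline a\, j_t$ for $a\in\mathbb C$. For $q=a+bj_t$ set $q^{\circledast}=\overline a-bj_t$; for a matrix $M=(m_{jk})$ over $\mathbb H_t$, $M^{\circledast}$ is the matrix whose $(j,k)$ entry is $m_{kj}^{\circledast}$. $I_{\mathbb H_t^N}$ is the identity matrix in $\mathbb H_t^{N\times N}$. The variable $x$ is real. An $\mathbb H_t^{n\times n}$-valued function $R$ of the real variable $x$, defined at $x=0$ (regular at the origin), is rational if it can be written as $R(x)=D+xC(I_{\mathbb H_t^N}-xA)^{-1}B$ with $D=R(0)$ and $(C,A,B)\in\mathbb H_t^{n\times N}\times\mathbb H_t^{N\times N}\times\mathbb H_t^{N\times n}$ (a realization). The pair $(C,A)$ is observable if for $h\in\mathbb H_t^N$: $C(I_{\mathbb H_t^N}-xA)^{-1}h=0$ for all $x$ in some interval $(-\varepsilon,\varepsilon)$ if and only if $h=0$. The pair $(A,B)$ is controllable if for $h\in\mathbb H_t^{1\times N}$: $hA^kB=0$ for all $k=0,1,2,\ldots$ if and only if $h=0$. The realization is minimal if $(C,A)$ is observable and $(A,B)$ is controllable. *)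

theory Defs
  imports "Jordan_Normal_Form.Matrix" "HOL-Analysis.Product_Vector"
begin

text \<open>The element \<open>a + b j\<^sub>t\<close> of the algebra is the pair \<open>(a, b)\<close>. Its real vector space structure
  and its topology, neither of which involves \<open>t\<close>, are those of the product type; the
  multiplication, the unit and everything built from them are defined below with \<open>t\<close> as an
  explicit argument.\<close>

type_synonym ht = "complex \<times> complex"

text \<open>\<open>(a + b j)(c + d j) = ac + ad j + b (j c) + b (j d) j = (ac + t b cnj d) + (ad + b cnj c) j\<close>\<close>

definition ht_mult :: "real \<Rightarrow> ht \<Rightarrow> ht \<Rightarrow> ht" where
  "ht_mult t p q = (fst p * fst q + of_real t * snd p * cnj (snd q),
                    fst p * snd q + snd p * cnj (fst q))"

definition ht_one :: ht where
  "ht_one = (1, 0)"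

definition ht_conj :: "ht \<Rightarrow> ht" where
  "ht_conj q = (cnj (fst q), - snd q)"

lemma ht_mult_complex: "ht_mult t (a, 0) (b, 0) = (a * b, 0)"
  by (simp add: ht_mult_def)

lemma ht_mult_complex_j: "ht_mult t (b, 0) (0, 1) = (0, b)"
  by (simp add: ht_mult_def)

lemma ht_j_square: "ht_mult t (0, 1) (0, 1) = t *\<^sub>R ht_one"
  by (simp add: ht_mult_def ht_one_def scaleR_conv_of_real)

lemma ht_j_commute: "ht_mult t (0, 1) (a, 0) = ht_mult t (cnj a, 0) (0, 1)"
  by (simp add: ht_mult_def)

lemma ht_mult_assoc: "ht_mult t (ht_mult t p q) r = ht_mult t p (ht_mult t q r)"
  by (simp add: ht_mult_def algebra_simps)

lemma ht_mult_distrib: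
  "ht_mult t (p + q) r = ht_mult t p r + ht_mult t q r"
  "ht_mult t p (q + r) = ht_mult t p q + ht_mult t p r"
  by (simp_all add: ht_mult_def algebra_simps)

lemma ht_mult_scaleR:
  "ht_mult t (c *\<^sub>R p) q = c *\<^sub>R ht_mult t p q"
  "ht_mult t p (c *\<^sub>R q) = c *\<^sub>R ht_mult t p q"
  by (simp_all add: ht_mult_def scaleR_conv_of_real algebra_simps)

lemma ht_mult_one: "ht_mult t ht_one q = q" "ht_mult t q ht_one = q"
  by (simp_all add: ht_mult_def ht_one_def)

lemma ht_conj_mult: "ht_conj (ht_mult t p q) = ht_mult t (ht_conj q) (ht_conj p)"
  by (simp add: ht_mult_def ht_conj_def algebra_simps)

text \<open>The library product of matrices would need a \<open>times\<close> instance on the entries, which cannot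
  depend on the real number \<open>t\<close>; sums, differences and zero matrices are the library ones.\<close>

definition hm_mult :: "real \<Rightarrow> ht mat \<Rightarrow> ht mat \<Rightarrow> ht mat" where
  "hm_mult t A B = mat (dim_row A) (dim_col B)
     (\<lambda>(i, j). \<Sum>k<dim_col A. ht_mult t (A $$ (i, k)) (B $$ (k, j)))"

abbreviation hm_mult_infix :: "ht mat \<Rightarrow> real \<Rightarrow> ht mat \<Rightarrow> ht mat"
  (\<open>(_ \<odot>\<^bsub>_\<^esub> _)\<close> [70, 0, 71] 70) where
  "A \<odot>\<^bsub>t\<^esub> B \<equiv> hm_mult t A B"

definition hm_one :: "nat \<Rightarrow> ht mat" where
  "hm_one N = mat N N (\<lambda>(i, j). if i = j then ht_one else 0)"

definition hm_adj :: "ht mat \<Rightarrow> ht mat"  (\<open>(_\<^sup>\<circledast>)\<close> [1000] 999) where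
  "A\<^sup>\<circledast> = mat (dim_col A) (dim_row A) (\<lambda>(j, k). ht_conj (A $$ (k, j)))"

definition hm_scaleR :: "real \<Rightarrow> ht mat \<Rightarrow> ht mat"  (infixr \<open>*\<^sub>H\<close> 75) where
  "c *\<^sub>H A = map_mat (\<lambda>q. c *\<^sub>R q) A"

primrec hm_pow :: "real \<Rightarrow> ht mat \<Rightarrow> nat \<Rightarrow> ht mat" where
  "hm_pow t A 0 = hm_one (dim_row A)"
| "hm_pow t A (Suc k) = hm_pow t A k \<odot>\<^bsub>t\<^esub> A"

definition hm_inverts :: "real \<Rightarrow> nat \<Rightarrow> ht mat \<Rightarrow> ht mat \<Rightarrow> bool" where
  "hm_inverts t N A B \<longleftrightarrow> A \<in> carrier_mat N N \<and> B \<in> carrier_mat N N \<and>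
     A \<odot>\<^bsub>t\<^esub> B = hm_one N \<and> B \<odot>\<^bsub>t\<^esub> A = hm_one N"

definition hm_invertible :: "real \<Rightarrow> ht mat \<Rightarrow> bool" where
  "hm_invertible t A \<longleftrightarrow> (\<exists>B. hm_inverts t (dim_row A) A B)"

text \<open>Meaningful for invertible matrices only.\<close>

definition hm_inv :: "real \<Rightarrow> ht mat \<Rightarrow> ht mat" where
  "hm_inv t A = (THE B. hm_inverts t (dim_row A) A B)"

definition signature_matrix :: "real \<Rightarrow> nat \<Rightarrow> ht mat \<Rightarrow> bool" where
  "signature_matrix t n J \<longleftrightarrow>
     J \<in> carrier_mat n n \<and> J = J\<^sup>\<circledast> \<and> hm_invertible t J \<and> J = hm_inv t J"

definition pencil :: "nat \<Rightarrow> ht mat \<Rightarrow> real \<Rightarrow> ht mat" where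
  "pencil N A x = hm_one N - x *\<^sub>H A"

definition realization_value ::
    "real \<Rightarrow> nat \<Rightarrow> ht mat \<Rightarrow> ht mat \<Rightarrow> ht mat \<Rightarrow> ht mat \<Rightarrow> real \<Rightarrow> ht mat" where
  "realization_value t N D C A B x =
     D + x *\<^sub>H (C \<odot>\<^bsub>t\<^esub> hm_inv t (pencil N A x) \<odot>\<^bsub>t\<^esub> B)"

text \<open>A rational function is a partial function of \<open>x\<close>, \<open>R x = None\<close> meaning that it is not defined
  at \<open>x\<close>. Where \<open>I - xA\<close> is invertible it is given by the formula. At the remaining points (finitely
  many) a realization that is not minimal can have a removable singularity; there \<open>R\<close> may be left
  undefined or be defined, but then only by its limit.\<close>

definition is_realization ::
    "real \<Rightarrow> nat \<Rightarrow> nat \<Rightarrow> (real \<rightharpoonup> ht mat) \<Rightarrow> ht mat \<Rightarrow> ht mat \<Rightarrow> ht mat \<Rightarrow> ht mat \<Rightarrow> bool" where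
  "is_realization t n N R D C A B \<longleftrightarrow>
     D \<in> carrier_mat n n \<and> C \<in> carrier_mat n N \<and> A \<in> carrier_mat N N \<and> B \<in> carrier_mat N n \<and>
     R 0 = Some D \<and>
     (\<forall>x. hm_invertible t (pencil N A x) \<longrightarrow> R x = Some (realization_value t N D C A B x)) \<and>
     (\<forall>x M. \<not> hm_invertible t (pencil N A x) \<longrightarrow> R x = Some M \<longrightarrow>
        M \<in> carrier_mat n n \<and>
        (\<forall>i<n. \<forall>j<n. ((\<lambda>y. realization_value t N D C A B y $$ (i, j)) \<longlongrightarrow> M $$ (i, j))
           (at x within {y. hm_invertible t (pencil N A y)})))"

definition rational_at_origin :: "real \<Rightarrow> nat \<Rightarrow> (real \<rightharpoonup> ht mat) \<Rightarrow> bool" where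
  "rational_at_origin t n R \<longleftrightarrow> (\<exists>N D C A B. is_realization t n N R D C A B)"

definition observable :: "real \<Rightarrow> nat \<Rightarrow> nat \<Rightarrow> ht mat \<Rightarrow> ht mat \<Rightarrow> bool" where
  "observable t n N C A \<longleftrightarrow>
     (\<forall>h \<in> carrier_mat N 1.
        (\<exists>\<epsilon>>0. \<forall>x \<in> {-\<epsilon><..<\<epsilon>}. hm_invertible t (pencil N A x) \<and>
           C \<odot>\<^bsub>t\<^esub> hm_inv t (pencil N A x) \<odot>\<^bsub>t\<^esub> h = 0\<^sub>m n 1)
        \<longleftrightarrow> h = 0\<^sub>m N 1)"

definition controllable :: "real \<Rightarrow> nat \<Rightarrow> nat \<Rightarrow> ht mat \<Rightarrow> ht mat \<Rightarrow> bool" where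
  "controllable t n N A B \<longleftrightarrow>
     (\<forall>h \<in> carrier_mat 1 N.
        (\<forall>k. h \<odot>\<^bsub>t\<^esub> hm_pow t A k \<odot>\<^bsub>t\<^esub> B = 0\<^sub>m 1 n) \<longleftrightarrow> h = 0\<^sub>m 1 N)"

definition minimal_realization ::
    "real \<Rightarrow> nat \<Rightarrow> nat \<Rightarrow> (real \<rightharpoonup> ht mat) \<Rightarrow> ht mat \<Rightarrow> ht mat \<Rightarrow> ht mat \<Rightarrow> ht mat \<Rightarrow> bool" where
  "minimal_realization t n N R D C A B \<longleftrightarrow>
     is_realization t n N R D C A B \<and> observable t n N C A \<and> controllable t n N A B"

definition J_unitary :: "real \<Rightarrow> ht mat \<Rightarrow> (real \<rightharpoonup> ht mat) \<Rightarrow> bool" where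
  "J_unitary t J R \<longleftrightarrow>
     (\<forall>x P Q. R x = Some P \<longrightarrow> R (- x) = Some Q \<longrightarrow> P \<odot>\<^bsub>t\<^esub> J \<odot>\<^bsub>t\<^esub> Q\<^sup>\<circledast> = J)"

definition associated_hermitian ::
    "real \<Rightarrow> nat \<Rightarrow> ht mat \<Rightarrow> ht mat \<Rightarrow> ht mat \<Rightarrow> ht mat \<Rightarrow> ht mat \<Rightarrow> ht mat \<Rightarrow> bool" where
  "associated_hermitian t N J D C A B H \<longleftrightarrow>
     H \<in> carrier_mat N N \<and> hm_invertible t H \<and> H = H\<^sup>\<circledast> \<and>
     A\<^sup>\<circledast> \<odot>\<^bsub>t\<^esub> H + H \<odot>\<^bsub>t\<^esub> A = - (C\<^sup>\<circledast> \<odot>\<^bsub>t\<^esub> J \<odot>\<^bsub>t\<^esub> C) \<and>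
     B = - (hm_inv t H \<odot>\<^bsub>t\<^esub> C\<^sup>\<circledast> \<odot>\<^bsub>t\<^esub> J \<odot>\<^bsub>t\<^esub> D)"

end

theory Submission
  imports Defs "HOL-Analysis.Linear_Algebra" "Jordan_Normal_Form.Determinant"
begin

text \<open>Write \<open>r(x) = (I - xA)\<^sup>-\<^sup>1\<close> and let \<open>E = J D\<^sup>\<circledast> J\<close>, which is the inverse of \<open>D\<close> as soon as
  \<open>D J D\<^sup>\<circledast> = J\<close>.

  For necessity, \<open>R(x) J R(-x)\<^sup>\<circledast> = J\<close> says that \<open>J R(-x)\<^sup>\<circledast> J\<close> is the inverse of \<open>R(x)\<close>. That inverse
  also has the realization with state matrix \<open>A - B E C\<close>, input matrix \<open>B E\<close> and output matrix \<open>-E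
  C\<close> (lemma \<open>inverse_realization\<close>), whereas reading off \<open>J R(-x)\<^sup>\<circledast> J\<close> directly gives the state
  matrix \<open>- A\<^sup>\<circledast>\<close>, input matrix \<open>C\<^sup>\<circledast> J\<close> and output matrix \<open>- J B\<^sup>\<circledast>\<close>. Comparing the expansions at the
  origin, the two triples have the same Markov parameters, and minimality turns this into a
  similarity \<open>S\<close> between them (lemma \<open>intertwiner\<close>). Spelled out, the intertwining relations
  contain the two equations of the theorem for \<open>H = - S\<close>. Both \<open>S\<close> and \<open>S\<^sup>\<circledast>\<close> solve the same
  Lyapunov equation and agree after multiplication by \<open>B\<close>, so they coincide by controllability
  (lemma \<open>lyapunov_zero\<close>); the same lemma gives uniqueness of \<open>H\<close>.

  For sufficiency, with \<open>G = H\<^sup>-\<^sup>1\<close> and \<open>D J D\<^sup>\<circledast> = J\<close> the two equations give \<open>A G + G A\<^sup>\<circledast> = - B J B\<^sup>\<circledast>\<close>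
  and \<open>B J D\<^sup>\<circledast> = - G C\<^sup>\<circledast>\<close>, and expanding \<open>R(x) J R(y)\<^sup>\<circledast>\<close> with these gives the kernel formula (lemma
  \<open>kernel_formula\<close>). Setting \<open>y = - x\<close> yields unitarity wherever both resolvents exist, that is
  off a finite set, and continuity extends it to the removable singularities.

  The algebra is noncommutative and for \<open>t > 0\<close> has zero divisors, so linear algebra over a field
  does not apply. Two facts replace it. The square matrices form a finite-dimensional real
  algebra, so the powers of a matrix are linearly dependent over the reals (lemma
  \<open>hm_powers_dependent\<close>); hence an injective matrix is invertible, one-sided inverses are
  two-sided, and the resolvent is a matrix polynomial in \<open>x\<close> divided by a real polynomial with
  nonzero value at the origin (lemma \<open>resolvent_polynomial\<close>). Secondly, although \<open>\<circledast>\<close> is not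
  positive in general, the involution \<open>a + b j \<mapsto> cnj a + sgn(t) b j\<close> is, so that a controllability
  Gramian built with it is invertible and provides matrices \<open>M\<^sub>k\<close> with \<open>\<Sum>\<^sub>k A\<^sup>k B M\<^sub>k = I\<close> (lemma
  \<open>controllable_right_inverse\<close>).\<close>

section \<open>Matrix algebra with an explicit parameter\<close>

lemma bounded_bilinear_ht_mult: "bounded_bilinear (ht_mult t)"
proof -
  have "bilinear (ht_mult t)"
    unfolding bilinear_def
    by (intro conjI allI linearI) (simp_all only: ht_mult_distrib ht_mult_scaleR)
  then show ?thesis
    by (simp add: bilinear_conv_bounded_bilinear)
qed

lemmas ht_mult_bilinear [simp] =
  bounded_bilinear.zero_left [OF bounded_bilinear_ht_mult]
  bounded_bilinear.zero_right [OF bounded_bilinear_ht_mult]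
  bounded_bilinear.minus_left [OF bounded_bilinear_ht_mult]
  bounded_bilinear.minus_right [OF bounded_bilinear_ht_mult]

lemmas ht_mult_sum_left = bounded_bilinear.sum_left [OF bounded_bilinear_ht_mult]
lemmas ht_mult_sum_right = bounded_bilinear.sum_right [OF bounded_bilinear_ht_mult]

lemma linear_ht_conj: "linear ht_conj"
  by (auto intro!: linearI simp: ht_conj_def)

lemma ht_conj_conj [simp]: "ht_conj (ht_conj q) = q"
  by (simp add: ht_conj_def)

lemma ht_conj_one [simp]: "ht_conj ht_one = ht_one"
  by (simp add: ht_conj_def ht_one_def)

lemmas ht_conj_linear = linear_0 [OF linear_ht_conj] linear_add [OF linear_ht_conj]
  linear_diff [OF linear_ht_conj] linear_neg [OF linear_ht_conj] linear_scale [OF linear_ht_conj]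

lemma hm_mult_dim [simp]:
  "dim_row (A \<odot>\<^bsub>t\<^esub> B) = dim_row A" "dim_col (A \<odot>\<^bsub>t\<^esub> B) = dim_col B"
  by (simp_all add: hm_mult_def)

lemma hm_mult_carrier:
  "A \<in> carrier_mat r m \<Longrightarrow> B \<in> carrier_mat m' c \<Longrightarrow> A \<odot>\<^bsub>t\<^esub> B \<in> carrier_mat r c"
  by (intro carrier_matI) auto

lemma hm_mult_index:
  "i < dim_row A \<Longrightarrow> j < dim_col B \<Longrightarrow>
    (A \<odot>\<^bsub>t\<^esub> B) $$ (i, j) = (\<Sum>k<dim_col A. ht_mult t (A $$ (i, k)) (B $$ (k, j)))"
  by (simp add: hm_mult_def)

lemma hm_one_dim [simp]: "dim_row (hm_one N) = N" "dim_col (hm_one N) = N"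
  by (simp_all add: hm_one_def)

lemma hm_one_carrier: "hm_one N \<in> carrier_mat N N"
  by (simp add: hm_one_def)

lemma hm_adj_dim [simp]: "dim_row (A\<^sup>\<circledast>) = dim_col A" "dim_col (A\<^sup>\<circledast>) = dim_row A"
  by (simp_all add: hm_adj_def)

lemma hm_adj_carrier: "A \<in> carrier_mat r c \<Longrightarrow> A\<^sup>\<circledast> \<in> carrier_mat c r"
  by (simp add: hm_adj_def)

lemma hm_adj_index: "i < dim_col A \<Longrightarrow> j < dim_row A \<Longrightarrow> A\<^sup>\<circledast> $$ (i, j) = ht_conj (A $$ (j, i))"
  by (simp add: hm_adj_def)

lemma hm_scaleR_dim [simp]: "dim_row (c *\<^sub>H A) = dim_row A" "dim_col (c *\<^sub>H A) = dim_col A"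
  by (simp_all add: hm_scaleR_def)

lemma hm_scaleR_carrier: "A \<in> carrier_mat r m \<Longrightarrow> c *\<^sub>H A \<in> carrier_mat r m"
  by (simp add: hm_scaleR_def)

lemma hm_scaleR_index:
  "i < dim_row A \<Longrightarrow> j < dim_col A \<Longrightarrow> (c *\<^sub>H A) $$ (i, j) = c *\<^sub>R A $$ (i, j)"
  by (simp add: hm_scaleR_def)

lemma hm_pow_dim [simp]:
  "dim_row (hm_pow t A k) = dim_row A"
  "dim_col A = dim_row A \<Longrightarrow> dim_col (hm_pow t A k) = dim_row A"
  by (induction k) auto

lemma hm_pow_carrier: "A \<in> carrier_mat N N \<Longrightarrow> hm_pow t A k \<in> carrier_mat N N"
  by (intro carrier_matI) auto

lemma pencil_dim [simp]: "dim_row (pencil N A x) = dim_row A" "dim_col (pencil N A x) = dim_col A"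
  by (simp_all add: pencil_def)

lemma pencil_carrier: "A \<in> carrier_mat N N \<Longrightarrow> pencil N A x \<in> carrier_mat N N"
  by (intro carrier_matI) auto

text \<open>The ring laws carry equations between dimensions as side conditions rather than
  membership in carrier sets: the simplifier can decide them for nested products, whereas the
  carrier set of an intermediate factor would have to be guessed.\<close>

lemma hm_mult_assoc:
  assumes "dim_col A = dim_row B"
  shows "(A \<odot>\<^bsub>t\<^esub> B) \<odot>\<^bsub>t\<^esub> C = A \<odot>\<^bsub>t\<^esub> (B \<odot>\<^bsub>t\<^esub> C)"
proof (rule eq_matI)
  fix i j assume ij: "i < dim_row (A \<odot>\<^bsub>t\<^esub> (B \<odot>\<^bsub>t\<^esub> C))" "j < dim_col (A \<odot>\<^bsub>t\<^esub> (B \<odot>\<^bsub>t\<^esub> C))"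
  have "((A \<odot>\<^bsub>t\<^esub> B) \<odot>\<^bsub>t\<^esub> C) $$ (i, j) = (\<Sum>l<dim_col B. \<Sum>k<dim_col A.
      ht_mult t (A $$ (i, k)) (ht_mult t (B $$ (k, l)) (C $$ (l, j))))"
    using ij by (simp add: hm_mult_index ht_mult_sum_left ht_mult_assoc)
  also have "\<dots> = (A \<odot>\<^bsub>t\<^esub> (B \<odot>\<^bsub>t\<^esub> C)) $$ (i, j)"
    using ij assms by (subst sum.swap) (simp add: hm_mult_index ht_mult_sum_right)
  finally show "((A \<odot>\<^bsub>t\<^esub> B) \<odot>\<^bsub>t\<^esub> C) $$ (i, j) = (A \<odot>\<^bsub>t\<^esub> (B \<odot>\<^bsub>t\<^esub> C)) $$ (i, j)" .
qed simp_all

lemma hm_mult_one_left: 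
  assumes "dim_row A = N" shows "hm_one N \<odot>\<^bsub>t\<^esub> A = A"
proof (rule eq_matI)
  fix i j assume ij: "i < dim_row A" "j < dim_col A"
  have "(hm_one N \<odot>\<^bsub>t\<^esub> A) $$ (i, j) = (\<Sum>k<N. ht_mult t (if i = k then ht_one else 0) (A $$ (k, j)))"
    using ij assms by (simp add: hm_mult_index hm_one_def)
  also have "\<dots> = (\<Sum>k<N. if i = k then A $$ (k, j) else 0)"
    by (rule sum.cong) (simp_all add: ht_mult_one)
  finally have "(hm_one N \<odot>\<^bsub>t\<^esub> A) $$ (i, j) = \<dots>" .
  then show "(hm_one N \<odot>\<^bsub>t\<^esub> A) $$ (i, j) = A $$ (i, j)"
    using ij assms by simp
qed (use assms in simp_all)

lemma hm_mult_one_right: 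
  assumes "dim_col A = N" shows "A \<odot>\<^bsub>t\<^esub> hm_one N = A"
proof (rule eq_matI)
  fix i j assume ij: "i < dim_row A" "j < dim_col A"
  have "(A \<odot>\<^bsub>t\<^esub> hm_one N) $$ (i, j) = (\<Sum>k<N. ht_mult t (A $$ (i, k)) (if k = j then ht_one else 0))"
    using ij assms by (simp add: hm_mult_index hm_one_def)
  also have "\<dots> = (\<Sum>k<N. if k = j then A $$ (i, k) else 0)"
    by (rule sum.cong) (simp_all add: ht_mult_one)
  finally have "(A \<odot>\<^bsub>t\<^esub> hm_one N) $$ (i, j) = \<dots>" .
  then show "(A \<odot>\<^bsub>t\<^esub> hm_one N) $$ (i, j) = A $$ (i, j)"
    using ij assms by simp
qed (use assms in simp_all)

lemma hm_add_mult:
  "dim_row A = dim_row B \<Longrightarrow> dim_col A = dim_col B \<Longrightarrow>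
    (A + B) \<odot>\<^bsub>t\<^esub> C = A \<odot>\<^bsub>t\<^esub> C + B \<odot>\<^bsub>t\<^esub> C"
  by (rule eq_matI) (auto simp: hm_mult_index ht_mult_distrib sum.distrib)

lemma hm_mult_add:
  "dim_row A = dim_row B \<Longrightarrow> dim_col A = dim_col B \<Longrightarrow> dim_col C = dim_row B \<Longrightarrow>
    C \<odot>\<^bsub>t\<^esub> (A + B) = C \<odot>\<^bsub>t\<^esub> A + C \<odot>\<^bsub>t\<^esub> B"
  by (rule eq_matI) (auto simp: hm_mult_index ht_mult_distrib sum.distrib)

lemma hm_uminus_mult: "(- A) \<odot>\<^bsub>t\<^esub> B = - (A \<odot>\<^bsub>t\<^esub> B)"
  by (rule eq_matI) (auto simp: hm_mult_index sum_negf)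

lemma hm_mult_uminus: "dim_col A = dim_row B \<Longrightarrow> A \<odot>\<^bsub>t\<^esub> (- B) = - (A \<odot>\<^bsub>t\<^esub> B)"
  by (rule eq_matI) (auto simp: hm_mult_index sum_negf)

lemma hm_diff_conv_add_uminus:
  "dim_row A = dim_row B \<Longrightarrow> dim_col A = dim_col B \<Longrightarrow> (A :: ht mat) - B = A + (- B)"
  by (rule eq_matI) auto

lemma hm_diff_mult:
  "dim_row A = dim_row B \<Longrightarrow> dim_col A = dim_col B \<Longrightarrow>
    (A - B) \<odot>\<^bsub>t\<^esub> C = A \<odot>\<^bsub>t\<^esub> C - B \<odot>\<^bsub>t\<^esub> C"
  by (simp add: hm_diff_conv_add_uminus hm_add_mult hm_uminus_mult)

lemma hm_mult_diff:
  "dim_row A = dim_row B \<Longrightarrow> dim_col A = dim_col B \<Longrightarrow> dim_col C = dim_row B \<Longrightarrow>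
    C \<odot>\<^bsub>t\<^esub> (A - B) = C \<odot>\<^bsub>t\<^esub> A - C \<odot>\<^bsub>t\<^esub> B"
  by (simp add: hm_diff_conv_add_uminus hm_mult_add hm_mult_uminus)

lemma hm_scaleR_mult: "(c *\<^sub>H A) \<odot>\<^bsub>t\<^esub> B = c *\<^sub>H (A \<odot>\<^bsub>t\<^esub> B)"
  by (rule eq_matI) (auto simp: hm_mult_index hm_scaleR_index ht_mult_scaleR scaleR_sum_right)

lemma hm_mult_scaleR: "dim_col A = dim_row B \<Longrightarrow> A \<odot>\<^bsub>t\<^esub> (c *\<^sub>H B) = c *\<^sub>H (A \<odot>\<^bsub>t\<^esub> B)"
  by (rule eq_matI) (auto simp: hm_mult_index hm_scaleR_index ht_mult_scaleR scaleR_sum_right)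

lemma hm_mult_zero_left: "0\<^sub>m r m \<odot>\<^bsub>t\<^esub> A = 0\<^sub>m r (dim_col A)"
  by (rule eq_matI) (auto simp: hm_mult_index)

lemma hm_mult_zero_right: "dim_col A = m \<Longrightarrow> A \<odot>\<^bsub>t\<^esub> 0\<^sub>m m c = 0\<^sub>m (dim_row A) c"
  by (rule eq_matI) (auto simp: hm_mult_index)

lemma hm_adj_adj [simp]: "(A\<^sup>\<circledast>)\<^sup>\<circledast> = A"
  by (rule eq_matI) (auto simp: hm_adj_index)

lemma hm_adj_mult: "dim_col A = dim_row B \<Longrightarrow> (A \<odot>\<^bsub>t\<^esub> B)\<^sup>\<circledast> = B\<^sup>\<circledast> \<odot>\<^bsub>t\<^esub> A\<^sup>\<circledast>"
  by (rule eq_matI) (auto simp: hm_adj_index hm_mult_index linear_sum [OF linear_ht_conj] ht_conj_mult)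

lemma hm_adj_add:
  "dim_row A = dim_row B \<Longrightarrow> dim_col A = dim_col B \<Longrightarrow> (A + B)\<^sup>\<circledast> = A\<^sup>\<circledast> + B\<^sup>\<circledast>"
  by (rule eq_matI) (auto simp: hm_adj_index ht_conj_linear)

lemma hm_adj_diff:
  "dim_row A = dim_row B \<Longrightarrow> dim_col A = dim_col B \<Longrightarrow> (A - B)\<^sup>\<circledast> = A\<^sup>\<circledast> - B\<^sup>\<circledast>"
  by (rule eq_matI) (auto simp: hm_adj_index ht_conj_linear)

lemma hm_adj_uminus: "(- A)\<^sup>\<circledast> = - (A\<^sup>\<circledast>)"
  by (rule eq_matI) (auto simp: hm_adj_index ht_conj_linear)

lemma hm_adj_scaleR: "(c *\<^sub>H A)\<^sup>\<circledast> = c *\<^sub>H A\<^sup>\<circledast>"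
  by (rule eq_matI) (auto simp: hm_adj_index hm_scaleR_index ht_conj_linear)

lemma hm_adj_one [simp]: "(hm_one N)\<^sup>\<circledast> = hm_one N"
  by (rule eq_matI) (auto simp: hm_adj_index hm_one_def ht_conj_linear)

lemma pencil_adj: "A \<in> carrier_mat N N \<Longrightarrow> (pencil N A x)\<^sup>\<circledast> = pencil N (A\<^sup>\<circledast>) x"
  by (simp add: pencil_def hm_adj_diff hm_adj_scaleR)

lemma hm_diff_eq_zero:
  assumes "dim_row A = r" "dim_col A = c" "dim_row B = r" "dim_col B = c"
  shows "A - B = 0\<^sub>m r c \<longleftrightarrow> (A :: ht mat) = B"
  using assms by (auto simp: mat_eq_iff)

lemmas hm_distrib = hm_add_mult hm_mult_add hm_diff_mult hm_mult_diff hm_uminus_mult hm_mult_uminus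
  hm_scaleR_mult hm_mult_scaleR hm_mult_one_left hm_mult_one_right hm_mult_zero_left hm_mult_zero_right

lemmas hm_adj_distrib = hm_adj_mult hm_adj_add hm_adj_diff hm_adj_uminus hm_adj_scaleR

lemma hm_pow_Suc_left:
  "A \<in> carrier_mat N N \<Longrightarrow> hm_pow t A (Suc k) = A \<odot>\<^bsub>t\<^esub> hm_pow t A k"
proof (induction k)
  case 0
  then show ?case by (simp add: hm_distrib)
next
  case (Suc k)
  then show ?case by (auto simp: hm_mult_assoc)
qed

lemma hm_pow_add:
  "A \<in> carrier_mat N N \<Longrightarrow> hm_pow t A (j + k) = hm_pow t A j \<odot>\<^bsub>t\<^esub> hm_pow t A k"
proof (induction k)
  case 0
  then show ?case by (auto simp: hm_distrib)
next
  case (Suc k)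
  then show ?case by (auto simp: hm_mult_assoc)
qed

lemma hm_pow_adj: "A \<in> carrier_mat N N \<Longrightarrow> (hm_pow t A k)\<^sup>\<circledast> = hm_pow t (A\<^sup>\<circledast>) k"
proof (induction k)
  case (Suc k)
  then have "(hm_pow t A (Suc k))\<^sup>\<circledast> = A\<^sup>\<circledast> \<odot>\<^bsub>t\<^esub> hm_pow t (A\<^sup>\<circledast>) k"
    by (auto simp: hm_adj_mult)
  with Suc.prems show ?case
    by (simp only: hm_pow_Suc_left [OF hm_adj_carrier])
qed auto

lemma hm_pow_uminus:
  "A \<in> carrier_mat N N \<Longrightarrow> hm_pow t (- A) k = (-1) ^ k *\<^sub>H hm_pow t A k"
proof (induction k)
  case 0
  then show ?case by (auto simp: mat_eq_iff hm_scaleR_index)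
next
  case (Suc k)
  then show ?case
    by (auto simp: hm_distrib) (auto simp: mat_eq_iff hm_scaleR_index)
qed

text \<open>The dimensions are arguments because an empty family does not determine them.\<close>

definition hm_sum :: "nat \<Rightarrow> nat \<Rightarrow> nat \<Rightarrow> (nat \<Rightarrow> ht mat) \<Rightarrow> ht mat" where
  "hm_sum r c d F = mat r c (\<lambda>ij. \<Sum>k<d. F k $$ ij)"

lemma hm_sum_dim [simp]: "dim_row (hm_sum r c d F) = r" "dim_col (hm_sum r c d F) = c"
  by (simp_all add: hm_sum_def)

lemma hm_sum_carrier: "hm_sum r c d F \<in> carrier_mat r c"
  by (simp add: hm_sum_def)

lemma hm_sum_index:
  "i < r \<Longrightarrow> j < c \<Longrightarrow> hm_sum r c d F $$ (i, j) = (\<Sum>k<d. F k $$ (i, j))"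
  by (simp add: hm_sum_def)

lemma hm_sum_cong: "(\<And>k. k < d \<Longrightarrow> F k = G k) \<Longrightarrow> hm_sum r c d F = hm_sum r c d G"
  by (simp add: hm_sum_def)

lemma hm_sum_zero [simp]: "hm_sum r c d (\<lambda>_. 0\<^sub>m r c) = 0\<^sub>m r c"
  by (rule eq_matI) (simp_all add: hm_sum_index)

lemma hm_mult_sum:
  assumes "\<And>k. F k \<in> carrier_mat r c" "dim_col A = r"
  shows "A \<odot>\<^bsub>t\<^esub> hm_sum r c d F = hm_sum (dim_row A) c d (\<lambda>k. A \<odot>\<^bsub>t\<^esub> F k)"
proof (rule eq_matI)
  fix i j assume ij: "i < dim_row (hm_sum (dim_row A) c d (\<lambda>k. A \<odot>\<^bsub>t\<^esub> F k))"
    "j < dim_col (hm_sum (dim_row A) c d (\<lambda>k. A \<odot>\<^bsub>t\<^esub> F k))"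
  have F: "dim_row (F k) = r" "dim_col (F k) = c" for k using assms by auto
  show "(A \<odot>\<^bsub>t\<^esub> hm_sum r c d F) $$ (i, j) = hm_sum (dim_row A) c d (\<lambda>k. A \<odot>\<^bsub>t\<^esub> F k) $$ (i, j)"
    using ij assms(2)
    by (simp add: hm_mult_index hm_sum_index F ht_mult_sum_right) (rule sum.swap)
qed simp_all

lemma hm_sum_mult:
  assumes "\<And>k. F k \<in> carrier_mat r c"
  shows "hm_sum r c d F \<odot>\<^bsub>t\<^esub> A = hm_sum r (dim_col A) d (\<lambda>k. F k \<odot>\<^bsub>t\<^esub> A)"
proof (rule eq_matI)
  fix i j assume ij: "i < dim_row (hm_sum r (dim_col A) d (\<lambda>k. F k \<odot>\<^bsub>t\<^esub> A))"
    "j < dim_col (hm_sum r (dim_col A) d (\<lambda>k. F k \<odot>\<^bsub>t\<^esub> A))"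
  have F: "dim_row (F k) = r" "dim_col (F k) = c" for k using assms by auto
  show "(hm_sum r c d F \<odot>\<^bsub>t\<^esub> A) $$ (i, j) = hm_sum r (dim_col A) d (\<lambda>k. F k \<odot>\<^bsub>t\<^esub> A) $$ (i, j)"
    using ij
    by (simp add: hm_mult_index hm_sum_index F ht_mult_sum_left) (rule sum.swap)
qed simp_all

lemma hm_sum_adj:
  assumes "\<And>k. F k \<in> carrier_mat r c"
  shows "(hm_sum r c d F)\<^sup>\<circledast> = hm_sum c r d (\<lambda>k. (F k)\<^sup>\<circledast>)"
proof -
  have F: "dim_row (F k) = r" "dim_col (F k) = c" for k using assms by auto
  show ?thesis
    by (rule eq_matI)
      (simp_all add: hm_adj_index hm_sum_index F linear_sum [OF linear_ht_conj])
qed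

lemma hm_inverts_unique:
  assumes "hm_inverts t N A B" "hm_inverts t N A B'" shows "B = B'"
proof -
  have "B = B \<odot>\<^bsub>t\<^esub> (A \<odot>\<^bsub>t\<^esub> B')"
    using assms by (auto simp: hm_inverts_def hm_distrib)
  also have "\<dots> = (B \<odot>\<^bsub>t\<^esub> A) \<odot>\<^bsub>t\<^esub> B'"
    using assms by (intro hm_mult_assoc [symmetric]) (auto simp: hm_inverts_def)
  also have "\<dots> = B'"
    using assms by (auto simp: hm_inverts_def hm_distrib)
  finally show ?thesis .
qed

lemma hm_inv_eqI:
  assumes "hm_inverts t N A B" shows "hm_inv t A = B"
proof -
  have "dim_row A = N" using assms by (auto simp: hm_inverts_def)
  then show ?thesis
    unfolding hm_inv_def using assms hm_inverts_unique by blast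
qed

lemma hm_invertibleI: "hm_inverts t N A B \<Longrightarrow> hm_invertible t A"
  by (auto simp: hm_invertible_def hm_inverts_def)

lemma hm_inverts_inv: "hm_invertible t A \<Longrightarrow> hm_inverts t (dim_row A) A (hm_inv t A)"
  using hm_inv_eqI by (auto simp: hm_invertible_def)

lemma hm_inv:
  assumes "hm_invertible t A" "A \<in> carrier_mat N N"
  shows "hm_inv t A \<in> carrier_mat N N" "A \<odot>\<^bsub>t\<^esub> hm_inv t A = hm_one N"
    "hm_inv t A \<odot>\<^bsub>t\<^esub> A = hm_one N"
  using hm_inverts_inv [OF assms(1)] assms(2) by (auto simp: hm_inverts_def)

lemma hm_inverts_adj: "hm_inverts t N A B \<Longrightarrow> hm_inverts t N (A\<^sup>\<circledast>) (B\<^sup>\<circledast>)"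
  by (auto simp: hm_inverts_def hm_adj_mult [symmetric])

lemma hm_inv_adj:
  assumes "hm_invertible t A" shows "hm_invertible t (A\<^sup>\<circledast>)" "hm_inv t (A\<^sup>\<circledast>) = (hm_inv t A)\<^sup>\<circledast>"
proof -
  note i = hm_inverts_adj [OF hm_inverts_inv [OF assms]]
  show "hm_invertible t (A\<^sup>\<circledast>)" using i by (rule hm_invertibleI)
  show "hm_inv t (A\<^sup>\<circledast>) = (hm_inv t A)\<^sup>\<circledast>" using i by (rule hm_inv_eqI)
qed

section \<open>Consequences of finite dimension\<close>

text \<open>More functions than points: the matrix of values, padded with a zero row, is square and
  singular, and a kernel vector holds the coefficients.\<close>

lemma real_functions_dependent:
  fixes f :: "nat \<Rightarrow> 'a \<Rightarrow> real"
  assumes "finite I"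
  obtains c :: "nat \<Rightarrow> real" and k where "k \<le> card I" "c k \<noteq> 0"
    "\<And>i. i \<in> I \<Longrightarrow> (\<Sum>k\<le>card I. c k * f k i) = 0"
proof -
  define m where "m = card I"
  obtain e where e: "bij_betw e {..<m} I"
    using ex_bij_betw_nat_finite [OF assms] by (auto simp: m_def lessThan_atLeast0)
  define M where "M = mat (Suc m) (Suc m) (\<lambda>(r, k). if r < m then f k (e r) else 0)"
  have M: "M \<in> carrier_mat (Suc m) (Suc m)" by (simp add: M_def)
  have "M\<^sup>T *\<^sub>v unit_vec (Suc m) m = 0\<^sub>v (Suc m)"
    by (rule eq_vecI) (auto simp: M_def scalar_prod_def unit_vec_def)
  then have "det (M\<^sup>T) = 0"
    using M by (subst det_0_iff_vec_prod_zero_field [of _ "Suc m"])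
      (auto intro!: exI [of _ "unit_vec (Suc m) m"] simp: vec_eq_iff unit_vec_def)
  then have "det M = 0"
    using det_transpose [OF M] by simp
  then obtain v where v: "v \<in> carrier_vec (Suc m)" "v \<noteq> 0\<^sub>v (Suc m)" "M *\<^sub>v v = 0\<^sub>v (Suc m)"
    using det_0_iff_vec_prod_zero_field [OF M] by blast
  from v obtain k where k: "k \<le> m" "v $ k \<noteq> 0"
    by (auto simp: vec_eq_iff less_Suc_eq_le)
  have "(\<Sum>k\<le>m. v $ k * f k i) = 0" if "i \<in> I" for i
  proof -
    have "i \<in> e ` {..<m}"
      using e that by (simp add: bij_betw_imp_surj_on)
    then obtain r where r: "r < m" "i = e r"
      by auto
    have "(\<Sum>k\<le>m. v $ k * f k i) = (M *\<^sub>v v) $ r"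
      using r v(1) by (auto simp: M_def scalar_prod_def lessThan_Suc_atMost
          lessThan_atLeast0 [symmetric] mult.commute intro!: sum.cong)
    then show ?thesis using r v(3) by simp
  qed
  then show ?thesis using that [of k "\<lambda>k. v $ k"] k by (simp add: m_def)
qed

text \<open>The matrix entries have finitely many real coordinates, so finitely many powers are
  dependent over the reals. Trailing zero coefficients are dropped, because a nonzero leading one
  is what makes the denominator of the resolvent nonzero at the origin.\<close>

lemma hm_powers_dependent:
  assumes "A \<in> carrier_mat N N"
  obtains d and c :: "nat \<Rightarrow> real" where "c d \<noteq> 0"
    "hm_sum N N (Suc d) (\<lambda>k. c k *\<^sub>H hm_pow t A k) = 0\<^sub>m N N"
proof -
  define coord :: "nat \<Rightarrow> (nat \<times> nat) \<times> nat \<Rightarrow> real" where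
    "coord k = (\<lambda>(ij, l). [Re (fst (hm_pow t A k $$ ij)), Im (fst (hm_pow t A k $$ ij)),
       Re (snd (hm_pow t A k $$ ij)), Im (snd (hm_pow t A k $$ ij))] ! l)" for k
  define I where "I = ({..<N} \<times> {..<N}) \<times> {..<4::nat}"
  obtain c k where k: "k \<le> card I" "c k \<noteq> 0"
    and c: "\<And>i. i \<in> I \<Longrightarrow> (\<Sum>k\<le>card I. c k * coord k i) = 0"
    by (rule real_functions_dependent [of I coord]) (auto simp: I_def)
  define d where "d = (GREATEST k. k \<le> card I \<and> c k \<noteq> 0)"
  have d: "d \<le> card I" "c d \<noteq> 0"
    using GreatestI_nat [of "\<lambda>k. k \<le> card I \<and> c k \<noteq> 0" k "card I"] k by (auto simp: d_def)
  have above: "c k = 0" if "d < k" "k \<le> card I" for k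
    using Greatest_le_nat [of "\<lambda>k. k \<le> card I \<and> c k \<noteq> 0" k "card I"] that by (force simp: d_def)
  have c': "(\<Sum>k<Suc d. c k * coord k i) = 0" if "i \<in> I" for i
  proof -
    have "(\<Sum>k<Suc d. c k * coord k i) = (\<Sum>k\<le>card I. c k * coord k i)"
      using d above by (intro sum.mono_neutral_left) (auto simp: not_less)
    then show ?thesis using c that by simp
  qed
  have "(\<Sum>k<Suc d. c k *\<^sub>R hm_pow t A k $$ (i, j)) = 0" if "i < N" "j < N" for i j
  proof -
    have "l < 4 \<Longrightarrow> (\<Sum>k<Suc d. c k * coord k ((i, j), l)) = 0" for l
      using that by (intro c') (auto simp: I_def)
    from this [of 0] this [of 1] this [of 2] this [of 3] show ?thesis
      by (simp add: coord_def prod_eq_iff complex_eq_iff fst_sum snd_sum del: sum.lessThan_Suc)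
  qed
  then have "hm_sum N N (Suc d) (\<lambda>k. c k *\<^sub>H hm_pow t A k) = 0\<^sub>m N N"
    using assms by (auto simp: mat_eq_iff hm_sum_index hm_scaleR_index)
  then show ?thesis using d that by blast
qed

lemma hm_sum_Suc_shift:
  "F 0 \<in> carrier_mat r c \<Longrightarrow>
    hm_sum r c (Suc d) F = F 0 + hm_sum r c d (\<lambda>k. F (Suc k))"
  by (rule eq_matI) (auto simp: hm_sum_index sum.lessThan_Suc_shift simp del: sum.lessThan_Suc)

text \<open>In a polynomial relation for \<open>W\<close> a factor \<open>W\<close> can be cancelled, by injectivity, until
  the constant term is nonzero; then the relation \<open>c\<^sub>0 I + W Y = 0\<close>, with \<open>Y\<close> a polynomial in \<open>W\<close>,
  exhibits the inverse \<open>- Y / c\<^sub>0\<close>.\<close>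

lemma hm_polynomial_relation_imp_invertible:
  assumes W: "W \<in> carrier_mat N N"
    and cancel: "\<And>X. X \<in> carrier_mat N N \<Longrightarrow> W \<odot>\<^bsub>t\<^esub> X = 0\<^sub>m N N \<Longrightarrow> X = 0\<^sub>m N N"
    and "hm_sum N N d (\<lambda>k. c k *\<^sub>H hm_pow t W k) = 0\<^sub>m N N" "k < d" "c k \<noteq> 0"
  shows "hm_invertible t W"
  using assms(3-5)
proof (induction d arbitrary: c k)
  case 0
  then show ?case by simp
next
  case (Suc d)
  define Y where "Y = hm_sum N N d (\<lambda>k. c (Suc k) *\<^sub>H hm_pow t W k)"
  have Y: "Y \<in> carrier_mat N N" by (simp add: Y_def hm_sum_carrier)
  have car: "c *\<^sub>H hm_pow t W k \<in> carrier_mat N N" for c k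
    using W by (intro hm_scaleR_carrier hm_pow_carrier)
  have WY: "W \<odot>\<^bsub>t\<^esub> Y = hm_sum N N d (\<lambda>k. c (Suc k) *\<^sub>H hm_pow t W (Suc k))"
    using W car by (simp add: Y_def hm_mult_sum hm_mult_scaleR hm_pow_Suc_left del: hm_pow.simps)
  have YW: "Y \<odot>\<^bsub>t\<^esub> W = hm_sum N N d (\<lambda>k. c (Suc k) *\<^sub>H hm_pow t W (Suc k))"
    using W car by (simp add: Y_def hm_sum_mult hm_scaleR_mult)
  have "c 0 *\<^sub>H hm_pow t W 0 + W \<odot>\<^bsub>t\<^esub> Y = 0\<^sub>m N N"
    using Suc.prems(1) unfolding WY by (subst (asm) hm_sum_Suc_shift) (simp_all only: car)
  then have rel: "c 0 *\<^sub>H hm_one N + W \<odot>\<^bsub>t\<^esub> Y = 0\<^sub>m N N"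
    using W by simp
  show ?case
  proof (cases "c 0 = 0")
    case True
    then have "W \<odot>\<^bsub>t\<^esub> Y = 0\<^sub>m N N"
      using rel W Y by (auto simp: mat_eq_iff hm_scaleR_index)
    then have "Y = 0\<^sub>m N N" using cancel Y by blast
    moreover obtain l where "k = Suc l" using True Suc.prems(3) by (cases k) auto
    ultimately show ?thesis using Suc.IH [of "\<lambda>k. c (Suc k)" l] Suc.prems by (simp add: Y_def)
  next
    case False
    define Z where "Z = (- (1 / c 0)) *\<^sub>H Y"
    have "W \<odot>\<^bsub>t\<^esub> Z = (- (1 / c 0)) *\<^sub>H (W \<odot>\<^bsub>t\<^esub> Y)" "Z \<odot>\<^bsub>t\<^esub> W = (- (1 / c 0)) *\<^sub>H (W \<odot>\<^bsub>t\<^esub> Y)"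
      using W Y WY YW by (simp_all add: Z_def hm_mult_scaleR hm_scaleR_mult)
    moreover have "(- (1 / c 0)) *\<^sub>H (W \<odot>\<^bsub>t\<^esub> Y) = hm_one N"
    proof (rule eq_matI)
      fix i j assume ij: "i < dim_row (hm_one N)" "j < dim_col (hm_one N)"
      then have "(c 0 *\<^sub>H hm_one N + W \<odot>\<^bsub>t\<^esub> Y) $$ (i, j) = 0"
        using rel by simp
      then have "(W \<odot>\<^bsub>t\<^esub> Y) $$ (i, j) = - (c 0 *\<^sub>R hm_one N $$ (i, j))"
        using ij W Y by (simp add: hm_scaleR_index eq_neg_iff_add_eq_0 add.commute)
      then show "((- (1 / c 0)) *\<^sub>H (W \<odot>\<^bsub>t\<^esub> Y)) $$ (i, j) = hm_one N $$ (i, j)"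
        using ij W Y False by (simp add: hm_scaleR_index)
    qed (use W Y in simp_all)
    ultimately have "hm_inverts t N W Z"
      using W Y by (simp add: hm_inverts_def Z_def hm_scaleR_carrier)
    then show ?thesis by (rule hm_invertibleI)
  qed
qed

lemma hm_injective_imp_invertible:
  assumes "W \<in> carrier_mat N N"
    and "\<And>X. X \<in> carrier_mat N N \<Longrightarrow> W \<odot>\<^bsub>t\<^esub> X = 0\<^sub>m N N \<Longrightarrow> X = 0\<^sub>m N N"
  shows "hm_invertible t W"
proof -
  obtain d and c :: "nat \<Rightarrow> real" where "c d \<noteq> 0"
    "hm_sum N N (Suc d) (\<lambda>k. c k *\<^sub>H hm_pow t W k) = 0\<^sub>m N N"
    by (rule hm_powers_dependent [OF assms(1)])
  then show ?thesis
    using hm_polynomial_relation_imp_invertible [OF assms, where d = "Suc d" and c = c and k = d] by simp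
qed

text \<open>\<open>A B = I\<close> makes \<open>B\<close> injective, hence invertible, and then \<open>A\<close> is its inverse.\<close>

lemma hm_right_inverse_imp_inverts:
  assumes "A \<in> carrier_mat N N" "B \<in> carrier_mat N N" "A \<odot>\<^bsub>t\<^esub> B = hm_one N"
  shows "hm_inverts t N A B"
proof -
  have "hm_invertible t B"
  proof (rule hm_injective_imp_invertible [OF assms(2)])
    fix X assume X: "X \<in> carrier_mat N N" "B \<odot>\<^bsub>t\<^esub> X = 0\<^sub>m N N"
    have "X = (A \<odot>\<^bsub>t\<^esub> B) \<odot>\<^bsub>t\<^esub> X" using X assms by (simp add: hm_mult_one_left)
    also have "\<dots> = A \<odot>\<^bsub>t\<^esub> (B \<odot>\<^bsub>t\<^esub> X)" using assms(1,2) by (simp add: hm_mult_assoc)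
    also have "\<dots> = 0\<^sub>m N N" using X assms(1) by (simp add: hm_mult_zero_right)
    finally show "X = 0\<^sub>m N N" .
  qed
  note G = hm_inv [OF this assms(2)]
  have "A = (A \<odot>\<^bsub>t\<^esub> B) \<odot>\<^bsub>t\<^esub> hm_inv t B"
    using assms(1,2) G by (simp add: hm_mult_assoc hm_mult_one_right)
  then have "A = hm_inv t B" using assms G by (simp add: hm_mult_one_left)
  then show ?thesis using assms G by (simp add: hm_inverts_def)
qed

section \<open>Entrywise limits of matrix functions\<close>

text \<open>The topology on entries is used instead of one on matrices. Dimensions are only required
  to agree eventually, so that functions such as the inverse, which is unspecified at singular
  matrices, are covered.\<close>

definition hm_tendsto :: "('a \<Rightarrow> ht mat) \<Rightarrow> ht mat \<Rightarrow> 'a filter \<Rightarrow> bool" where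
  "hm_tendsto F M net \<longleftrightarrow>
     (\<forall>\<^sub>F x in net. dim_row (F x) = dim_row M \<and> dim_col (F x) = dim_col M) \<and>
     (\<forall>i<dim_row M. \<forall>j<dim_col M. ((\<lambda>x. F x $$ (i, j)) \<longlongrightarrow> M $$ (i, j)) net)"

lemma hm_tendsto_const: "hm_tendsto (\<lambda>_. M) M net"
  by (simp add: hm_tendsto_def)

lemma hm_tendsto_cong:
  assumes "hm_tendsto F M net" "\<forall>\<^sub>F x in net. F x = G x"
  shows "hm_tendsto G M net"
proof -
  have "((\<lambda>x. G x $$ (i, j)) \<longlongrightarrow> M $$ (i, j)) net" if "i < dim_row M" "j < dim_col M" for i j
  proof (rule Lim_transform_eventually)
    show "((\<lambda>x. F x $$ (i, j)) \<longlongrightarrow> M $$ (i, j)) net"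
      using assms(1) that by (simp add: hm_tendsto_def)
    show "\<forall>\<^sub>F x in net. F x $$ (i, j) = G x $$ (i, j)"
      using assms(2) by eventually_elim simp
  qed
  moreover have "\<forall>\<^sub>F x in net. dim_row (G x) = dim_row M \<and> dim_col (G x) = dim_col M"
    using assms unfolding hm_tendsto_def by (auto elim: eventually_elim2)
  ultimately show ?thesis by (auto simp: hm_tendsto_def)
qed

lemma hm_tendsto_mult:
  assumes "hm_tendsto F K net" "hm_tendsto G M net" "dim_col K = dim_row M"
  shows "hm_tendsto (\<lambda>x. F x \<odot>\<^bsub>t\<^esub> G x) (K \<odot>\<^bsub>t\<^esub> M) net"
proof -
  have dims: "\<forall>\<^sub>F x in net. (dim_row (F x) = dim_row K \<and> dim_col (F x) = dim_col K) \<and>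
      (dim_row (G x) = dim_row M \<and> dim_col (G x) = dim_col M)"
    using assms unfolding hm_tendsto_def by (intro eventually_conj [of "\<lambda>x. dim_row (F x) = _ \<and> dim_col (F x) = _"]) blast+
  have "((\<lambda>x. (F x \<odot>\<^bsub>t\<^esub> G x) $$ (i, j)) \<longlongrightarrow> (K \<odot>\<^bsub>t\<^esub> M) $$ (i, j)) net"
    if ij: "i < dim_row K" "j < dim_col M" for i j
  proof (rule Lim_transform_eventually)
    show "((\<lambda>x. \<Sum>k<dim_col K. ht_mult t (F x $$ (i, k)) (G x $$ (k, j)))
        \<longlongrightarrow> (K \<odot>\<^bsub>t\<^esub> M) $$ (i, j)) net"
      unfolding hm_mult_index [OF ij] using assms ij
      by (intro tendsto_sum bounded_bilinear.tendsto [OF bounded_bilinear_ht_mult])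
        (auto simp: hm_tendsto_def)
    show "\<forall>\<^sub>F x in net. (\<Sum>k<dim_col K. ht_mult t (F x $$ (i, k)) (G x $$ (k, j)))
        = (F x \<odot>\<^bsub>t\<^esub> G x) $$ (i, j)"
      using dims by eventually_elim (use ij in \<open>simp add: hm_mult_index\<close>)
  qed
  moreover have "\<forall>\<^sub>F x in net. dim_row (F x \<odot>\<^bsub>t\<^esub> G x) = dim_row (K \<odot>\<^bsub>t\<^esub> M) \<and>
      dim_col (F x \<odot>\<^bsub>t\<^esub> G x) = dim_col (K \<odot>\<^bsub>t\<^esub> M)"
    using dims by eventually_elim simp
  ultimately show ?thesis by (simp add: hm_tendsto_def)
qed

lemma hm_tendsto_add:
  assumes "hm_tendsto F K net" "hm_tendsto G M net" "dim_row K = dim_row M" "dim_col K = dim_col M"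
  shows "hm_tendsto (\<lambda>x. F x + G x) (K + M) net"
proof -
  have dims: "\<forall>\<^sub>F x in net. (dim_row (F x) = dim_row K \<and> dim_col (F x) = dim_col K) \<and>
      (dim_row (G x) = dim_row M \<and> dim_col (G x) = dim_col M)"
    using assms unfolding hm_tendsto_def by (intro eventually_conj [of "\<lambda>x. dim_row (F x) = _ \<and> dim_col (F x) = _"]) blast+
  have "((\<lambda>x. (F x + G x) $$ (i, j)) \<longlongrightarrow> (K + M) $$ (i, j)) net"
    if ij: "i < dim_row M" "j < dim_col M" for i j
  proof (rule Lim_transform_eventually)
    show "((\<lambda>x. F x $$ (i, j) + G x $$ (i, j)) \<longlongrightarrow> (K + M) $$ (i, j)) net"
      using assms ij by (auto simp: hm_tendsto_def intro: tendsto_add)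
    show "\<forall>\<^sub>F x in net. F x $$ (i, j) + G x $$ (i, j) = (F x + G x) $$ (i, j)"
      using dims by eventually_elim (use ij in simp)
  qed
  moreover have "\<forall>\<^sub>F x in net. dim_row (F x + G x) = dim_row (K + M) \<and>
      dim_col (F x + G x) = dim_col (K + M)"
    using dims by eventually_elim simp
  ultimately show ?thesis by (simp add: hm_tendsto_def)
qed

lemma hm_tendsto_scaleR:
  assumes "(f \<longlongrightarrow> c) net" "hm_tendsto F M net"
  shows "hm_tendsto (\<lambda>x. f x *\<^sub>H F x) (c *\<^sub>H M) net"
proof -
  have dims: "\<forall>\<^sub>F x in net. dim_row (F x) = dim_row M \<and> dim_col (F x) = dim_col M"
    using assms unfolding hm_tendsto_def by auto
  have "((\<lambda>x. (f x *\<^sub>H F x) $$ (i, j)) \<longlongrightarrow> (c *\<^sub>H M) $$ (i, j)) net"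
    if ij: "i < dim_row M" "j < dim_col M" for i j
  proof (rule Lim_transform_eventually)
    show "((\<lambda>x. f x *\<^sub>R F x $$ (i, j)) \<longlongrightarrow> (c *\<^sub>H M) $$ (i, j)) net"
      using assms ij by (auto simp: hm_tendsto_def hm_scaleR_index intro: tendsto_scaleR)
    show "\<forall>\<^sub>F x in net. f x *\<^sub>R F x $$ (i, j) = (f x *\<^sub>H F x) $$ (i, j)"
      using dims by eventually_elim (use ij in \<open>simp add: hm_scaleR_index\<close>)
  qed
  then show ?thesis using dims by (simp add: hm_tendsto_def)
qed

lemma hm_tendsto_adj:
  assumes "hm_tendsto F M net"
  shows "hm_tendsto (\<lambda>x. (F x)\<^sup>\<circledast>) (M\<^sup>\<circledast>) net"
proof -
  have dims: "\<forall>\<^sub>F x in net. dim_row (F x) = dim_row M \<and> dim_col (F x) = dim_col M"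
    using assms unfolding hm_tendsto_def by auto
  have "((\<lambda>x. (F x)\<^sup>\<circledast> $$ (i, j)) \<longlongrightarrow> M\<^sup>\<circledast> $$ (i, j)) net"
    if ij: "i < dim_col M" "j < dim_row M" for i j
  proof (rule Lim_transform_eventually)
    show "((\<lambda>x. ht_conj (F x $$ (j, i))) \<longlongrightarrow> M\<^sup>\<circledast> $$ (i, j)) net"
      using assms ij by (auto simp: hm_tendsto_def hm_adj_index ht_conj_def intro!: tendsto_intros)
    show "\<forall>\<^sub>F x in net. ht_conj (F x $$ (j, i)) = (F x)\<^sup>\<circledast> $$ (i, j)"
      using dims by eventually_elim (use ij in \<open>simp add: hm_adj_index\<close>)
  qed
  moreover have "\<forall>\<^sub>F x in net. dim_row ((F x)\<^sup>\<circledast>) = dim_col M \<and> dim_col ((F x)\<^sup>\<circledast>) = dim_row M"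
    using dims by eventually_elim simp
  ultimately show ?thesis by (simp add: hm_tendsto_def)
qed

lemma hm_tendsto_unique:
  assumes "hm_tendsto F K net" "hm_tendsto F M net" "net \<noteq> bot"
  shows "K = M"
proof -
  have "\<forall>\<^sub>F x in net. dim_row K = dim_row M \<and> dim_col K = dim_col M"
    using assms(1,2) unfolding hm_tendsto_def by (auto elim: eventually_elim2)
  then have "dim_row K = dim_row M" "dim_col K = dim_col M"
    using assms(3) by (auto simp: eventually_const)
  moreover from this have "K $$ (i, j) = M $$ (i, j)" if "i < dim_row M" "j < dim_col M" for i j
    using assms(1,2) that unfolding hm_tendsto_def
    by (intro tendsto_unique [OF assms(3), of "\<lambda>x. F x $$ (i, j)"]) auto
  ultimately show ?thesis by (intro eq_matI) auto
qed

section \<open>The resolvent of a matrix over the algebra\<close>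

lemma pencil_mult:
  "A \<in> carrier_mat N N \<Longrightarrow> X \<in> carrier_mat N m \<Longrightarrow> pencil N A x \<odot>\<^bsub>t\<^esub> X = X - x *\<^sub>H (A \<odot>\<^bsub>t\<^esub> X)"
  by (simp add: pencil_def hm_distrib)

lemma mult_pencil:
  "A \<in> carrier_mat N N \<Longrightarrow> X \<in> carrier_mat m N \<Longrightarrow> X \<odot>\<^bsub>t\<^esub> pencil N A x = X - x *\<^sub>H (X \<odot>\<^bsub>t\<^esub> A)"
  by (simp add: pencil_def hm_distrib)

lemma hm_sum_Suc:
  "F d \<in> carrier_mat r c \<Longrightarrow> hm_sum r c (Suc d) F = hm_sum r c d F + F d"
  by (rule eq_matI) (auto simp: hm_sum_index)

lemma hm_geometric_sum:
  assumes A: "A \<in> carrier_mat N N"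
  shows "pencil N A x \<odot>\<^bsub>t\<^esub> hm_sum N N k (\<lambda>j. x ^ j *\<^sub>H hm_pow t A j) = hm_one N - x ^ k *\<^sub>H hm_pow t A k"
    and "hm_sum N N k (\<lambda>j. x ^ j *\<^sub>H hm_pow t A j) \<odot>\<^bsub>t\<^esub> pencil N A x = hm_one N - x ^ k *\<^sub>H hm_pow t A k"
proof -
  have car: "x ^ j *\<^sub>H hm_pow t A j \<in> carrier_mat N N" for j
    using A by (intro hm_scaleR_carrier hm_pow_carrier)
  note sum = hm_sum_Suc [of "\<lambda>j. x ^ j *\<^sub>H hm_pow t A j", OF car]
  show "pencil N A x \<odot>\<^bsub>t\<^esub> hm_sum N N k (\<lambda>j. x ^ j *\<^sub>H hm_pow t A j) = hm_one N - x ^ k *\<^sub>H hm_pow t A k"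
  proof (induction k)
    case 0
    show ?case using A by (auto simp: mat_eq_iff hm_mult_index hm_sum_index hm_scaleR_index)
  next
    case (Suc k)
    have "pencil N A x \<odot>\<^bsub>t\<^esub> (x ^ k *\<^sub>H hm_pow t A k)
        = x ^ k *\<^sub>H hm_pow t A k - x *\<^sub>H (x ^ k *\<^sub>H hm_pow t A (Suc k))"
      using A by (simp add: pencil_mult [OF A car] hm_mult_scaleR hm_pow_Suc_left del: hm_pow.simps)
    then show ?case
      using A Suc unfolding sum
      by (simp add: hm_mult_add del: hm_pow.simps) (auto simp: mat_eq_iff hm_scaleR_index)
  qed
  show "hm_sum N N k (\<lambda>j. x ^ j *\<^sub>H hm_pow t A j) \<odot>\<^bsub>t\<^esub> pencil N A x = hm_one N - x ^ k *\<^sub>H hm_pow t A k"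
  proof (induction k)
    case 0
    show ?case using A by (auto simp: mat_eq_iff hm_mult_index hm_sum_index hm_scaleR_index)
  next
    case (Suc k)
    have "(x ^ k *\<^sub>H hm_pow t A k) \<odot>\<^bsub>t\<^esub> pencil N A x
        = x ^ k *\<^sub>H hm_pow t A k - x *\<^sub>H (x ^ k *\<^sub>H hm_pow t A (Suc k))"
      using A unfolding mult_pencil [OF A car] by (simp add: hm_scaleR_mult)
    then show ?case
      using A Suc unfolding sum
      by (simp add: hm_add_mult del: hm_pow.simps) (auto simp: mat_eq_iff hm_scaleR_index)
  qed
qed

lemma hm_tendsto_sum:
  assumes "\<And>k. hm_tendsto (F k) (M k) net" "\<And>k. M k \<in> carrier_mat r c"
    "\<And>k x. F k x \<in> carrier_mat r c"
  shows "hm_tendsto (\<lambda>x. hm_sum r c d (\<lambda>k. F k x)) (hm_sum r c d M) net"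
proof -
  have "dim_row (M k) = r" "dim_col (M k) = c" for k using assms(2) by auto
  then show ?thesis
    using assms(1) by (auto simp: hm_tendsto_def hm_sum_index intro!: tendsto_sum)
qed

text \<open>If \<open>\<Sum>\<^sub>k\<^sub>\<le>\<^sub>d c\<^sub>k A\<^sup>k = 0\<close>, then multiplying the geometric sums \<open>\<Sum>\<^sub>j\<^sub><\<^sub>k x\<^sup>j A\<^sup>j\<close> by \<open>c\<^sub>k x\<^sup>d\<^sup>-\<^sup>k\<close> and
  adding up gives a matrix polynomial \<open>T\<close> with \<open>(I - xA) T(x) = q(x) I\<close>, where \<open>q(x) = \<Sum>\<^sub>k\<^sub>\<le>\<^sub>d c\<^sub>k
  x\<^sup>d\<^sup>-\<^sup>k\<close>: the remaining terms add up to \<open>x\<^sup>d\<close> times the relation. Since \<open>T\<close> is a combination of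
  powers of \<open>A\<close>, it inherits every annihilation property that all the powers share.\<close>

lemma resolvent_polynomial:
  assumes A: "A \<in> carrier_mat N N"
  obtains q :: "real \<Rightarrow> real" and T :: "real \<Rightarrow> ht mat"
  where "finite {x. q x = 0}" "q 0 \<noteq> 0" "\<And>x. (q \<longlongrightarrow> q x) (at x)"
    "\<And>x. T x \<in> carrier_mat N N" "\<And>x. hm_tendsto T (T x) (at x)"
    "\<And>x. pencil N A x \<odot>\<^bsub>t\<^esub> T x = q x *\<^sub>H hm_one N" "\<And>x. T x \<odot>\<^bsub>t\<^esub> pencil N A x = q x *\<^sub>H hm_one N"
    "\<And>C h n m x. C \<in> carrier_mat n N \<Longrightarrow> h \<in> carrier_mat N m \<Longrightarrow>
       (\<And>k. C \<odot>\<^bsub>t\<^esub> hm_pow t A k \<odot>\<^bsub>t\<^esub> h = 0\<^sub>m n m) \<Longrightarrow> C \<odot>\<^bsub>t\<^esub> T x \<odot>\<^bsub>t\<^esub> h = 0\<^sub>m n m"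
proof -
  obtain d and c :: "nat \<Rightarrow> real" where cd: "c d \<noteq> 0"
    and rel: "hm_sum N N (Suc d) (\<lambda>k. c k *\<^sub>H hm_pow t A k) = 0\<^sub>m N N"
    by (rule hm_powers_dependent [OF A])
  have rel': "(\<Sum>k<Suc d. c k *\<^sub>R hm_pow t A k $$ (i, j)) = 0" if "i < N" "j < N" for i j
  proof -
    have "hm_sum N N (Suc d) (\<lambda>k. c k *\<^sub>H hm_pow t A k) $$ (i, j) = 0"
      using that by (simp add: rel)
    then show ?thesis
      using that A by (simp add: hm_sum_index hm_scaleR_index del: sum.lessThan_Suc)
  qed
  define q where "q x = (\<Sum>k<Suc d. c k * x ^ (d - k))" for x
  define g where "g k x = hm_sum N N k (\<lambda>j. x ^ j *\<^sub>H hm_pow t A j)" for k x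
  define T where "T x = hm_sum N N (Suc d) (\<lambda>k. (c k * x ^ (d - k)) *\<^sub>H g k x)" for x
  have pow: "hm_pow t A k \<in> carrier_mat N N" for k using A by (rule hm_pow_carrier)
  have g: "g k x \<in> carrier_mat N N" for k x by (simp add: g_def hm_sum_carrier)
  have g_dim: "dim_row (g k x) = N" "dim_col (g k x) = N" for k x by (simp_all add: g_def)
  have q_rev: "q x = (\<Sum>k\<le>d. c (d - k) * x ^ k)" for x
    unfolding q_def lessThan_Suc_atMost
    by (rule sum.reindex_bij_witness [of _ "\<lambda>k. d - k" "\<lambda>k. d - k"]) auto
  have eq: "hm_sum N N (Suc d) (\<lambda>k. (c k * x ^ (d - k)) *\<^sub>H (hm_one N - x ^ k *\<^sub>H hm_pow t A k))
      = q x *\<^sub>H hm_one N" for x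
  proof (rule eq_matI)
    fix i j assume "i < dim_row (q x *\<^sub>H hm_one N)" "j < dim_col (q x *\<^sub>H hm_one N)"
    then have ij: "i < N" "j < N" by simp_all
    let ?P = "\<lambda>k. hm_pow t A k $$ (i, j)"
    have "hm_sum N N (Suc d) (\<lambda>k. (c k * x ^ (d - k)) *\<^sub>H (hm_one N - x ^ k *\<^sub>H hm_pow t A k)) $$ (i, j)
        = (\<Sum>k<Suc d. (c k * x ^ (d - k)) *\<^sub>R (hm_one N $$ (i, j) - x ^ k *\<^sub>R ?P k))"
      using A ij by (simp add: hm_sum_index hm_scaleR_index del: sum.lessThan_Suc)
    also have "\<dots> = (\<Sum>k<Suc d. (c k * x ^ (d - k)) *\<^sub>R hm_one N $$ (i, j) - x ^ d *\<^sub>R (c k *\<^sub>R ?P k))"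
    proof (rule sum.cong)
      fix k assume "k \<in> {..<Suc d}"
      then have "x ^ d = x ^ (d - k) * x ^ k" by (simp flip: power_add)
      then show "(c k * x ^ (d - k)) *\<^sub>R (hm_one N $$ (i, j) - x ^ k *\<^sub>R ?P k)
          = (c k * x ^ (d - k)) *\<^sub>R hm_one N $$ (i, j) - x ^ d *\<^sub>R (c k *\<^sub>R ?P k)"
        by (simp add: scaleR_diff_right mult_ac)
    qed simp
    also have "\<dots> = q x *\<^sub>R hm_one N $$ (i, j)"
      unfolding sum_subtractf scaleR_sum_right [symmetric] rel' [OF ij]
      by (simp add: q_def scaleR_sum_left del: sum.lessThan_Suc)
    finally show "hm_sum N N (Suc d)
        (\<lambda>k. (c k * x ^ (d - k)) *\<^sub>H (hm_one N - x ^ k *\<^sub>H hm_pow t A k)) $$ (i, j)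
        = (q x *\<^sub>H hm_one N) $$ (i, j)"
      using ij by (simp add: hm_scaleR_index)
  qed simp_all
  show ?thesis
  proof (rule that)
    show "finite {x. q x = 0}"
      unfolding q_rev polyfun_finite_roots using cd by (auto intro: exI [of _ 0])
    show "q 0 \<noteq> 0"
      using cd by (simp add: q_rev power_0_left if_distrib cong: if_cong)
    show "(q \<longlongrightarrow> q x) (at x)" for x
      unfolding q_def by (intro tendsto_intros)
    show "T x \<in> carrier_mat N N" for x
      by (simp add: T_def hm_sum_carrier)
    show "hm_tendsto T (T x) (at x)" for x
      unfolding T_def g_def using pow
      by (intro hm_tendsto_sum hm_tendsto_scaleR hm_tendsto_const tendsto_intros
          hm_scaleR_carrier hm_sum_carrier)
    show "pencil N A x \<odot>\<^bsub>t\<^esub> T x = q x *\<^sub>H hm_one N" for x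
      using A hm_scaleR_carrier [OF g]
      by (simp add: g_dim T_def hm_mult_sum hm_mult_scaleR hm_geometric_sum(1) [OF A, where t = t, folded g_def]
          flip: eq)
    show "T x \<odot>\<^bsub>t\<^esub> pencil N A x = q x *\<^sub>H hm_one N" for x
      using A hm_scaleR_carrier [OF g]
      by (simp add: g_dim T_def hm_sum_mult hm_scaleR_mult hm_geometric_sum(2) [OF A, where t = t, folded g_def]
          flip: eq)
    show "C \<odot>\<^bsub>t\<^esub> T x \<odot>\<^bsub>t\<^esub> h = 0\<^sub>m n m" if "C \<in> carrier_mat n N" "h \<in> carrier_mat N m"
      "\<And>k. C \<odot>\<^bsub>t\<^esub> hm_pow t A k \<odot>\<^bsub>t\<^esub> h = 0\<^sub>m n m" for C h n m x
    proof -
      note car = hm_scaleR_carrier [OF g] hm_scaleR_carrier [OF pow]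
      have z: "c *\<^sub>H 0\<^sub>m n m = 0\<^sub>m n m" for c
        by (auto simp: mat_eq_iff hm_scaleR_index)
      have Cp: "c *\<^sub>H (C \<odot>\<^bsub>t\<^esub> hm_pow t A k) \<in> carrier_mat n N"
        and Cg: "c *\<^sub>H (C \<odot>\<^bsub>t\<^esub> g k x) \<in> carrier_mat n N" for c k
        using that(1) pow g by (auto intro!: hm_scaleR_carrier hm_mult_carrier)
      have "C \<odot>\<^bsub>t\<^esub> g k x \<odot>\<^bsub>t\<^esub> h = 0\<^sub>m n m" for k
        using that A car pow unfolding g_def
        by (simp add: hm_mult_sum hm_sum_mult [OF Cp] hm_scaleR_mult hm_mult_scaleR z)
      then show ?thesis
        using that A car unfolding T_def
        by (simp add: hm_mult_sum hm_sum_mult [OF Cg] hm_scaleR_mult hm_mult_scaleR z g_dim)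
    qed
  qed
qed

lemma eventually_at_not_in_finite:
  fixes x :: real
  assumes "finite S" shows "\<forall>\<^sub>F y in at x. y \<notin> S"
  unfolding eventually_at_topological
  using open_Compl [OF finite_imp_closed [of "S - {x}"]] assms
  by (intro exI [of _ "- (S - {x})"]) simp

lemma hm_inverts_resolvent:
  assumes "A \<in> carrier_mat N N" "T \<in> carrier_mat N N" "a \<noteq> 0"
    "A \<odot>\<^bsub>t\<^esub> T = a *\<^sub>H hm_one N" "T \<odot>\<^bsub>t\<^esub> A = a *\<^sub>H hm_one N"
  shows "hm_inverts t N A ((1 / a) *\<^sub>H T)"
proof -
  have "(1 / a) *\<^sub>H a *\<^sub>H hm_one N = hm_one N"
    using assms(3) by (auto simp: mat_eq_iff hm_scaleR_index)
  then show ?thesis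
    using assms by (simp add: hm_inverts_def hm_distrib hm_scaleR_carrier)
qed

lemma finite_not_invertible_pencil:
  assumes A: "A \<in> carrier_mat N N"
  shows "finite {x. \<not> hm_invertible t (pencil N A x)}"
proof -
  obtain q T where qT: "finite {x. q x = 0}" "\<And>x. T x \<in> carrier_mat N N"
    "\<And>x. pencil N A x \<odot>\<^bsub>t\<^esub> T x = q x *\<^sub>H hm_one N" "\<And>x. T x \<odot>\<^bsub>t\<^esub> pencil N A x = q x *\<^sub>H hm_one N"
    using resolvent_polynomial [OF A, of t] by metis
  have "hm_invertible t (pencil N A x)" if "q x \<noteq> 0" for x
    by (rule hm_invertibleI, rule hm_inverts_resolvent [OF pencil_carrier [OF A] qT(2) that qT(3,4)])
  then show ?thesis
    by (intro finite_subset [OF _ qT(1)]) auto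
qed

lemma eventually_invertible_pencil:
  "A \<in> carrier_mat N N \<Longrightarrow> \<forall>\<^sub>F y in at x. hm_invertible t (pencil N A y)"
  using eventually_at_not_in_finite [OF finite_not_invertible_pencil] by fastforce

lemma pencil_zero: "A \<in> carrier_mat N N \<Longrightarrow> pencil N A 0 = hm_one N"
  by (auto simp: mat_eq_iff pencil_def hm_scaleR_index)

lemma hm_inverts_one: "hm_inverts t N (hm_one N) (hm_one N)"
  by (simp add: hm_inverts_def hm_one_carrier hm_mult_one_left)

lemma resolvent_tendsto_one:
  assumes A: "A \<in> carrier_mat N N"
  shows "hm_tendsto (\<lambda>x. hm_inv t (pencil N A x)) (hm_one N) (at 0)"
proof -
  obtain q T where qT: "finite {x. q x = 0}" "q 0 \<noteq> 0" "\<And>x. (q \<longlongrightarrow> q x) (at x)"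
    "\<And>x. T x \<in> carrier_mat N N" "\<And>x. hm_tendsto T (T x) (at x)"
    "\<And>x. pencil N A x \<odot>\<^bsub>t\<^esub> T x = q x *\<^sub>H hm_one N" "\<And>x. T x \<odot>\<^bsub>t\<^esub> pencil N A x = q x *\<^sub>H hm_one N"
    using resolvent_polynomial [OF A, of t] by metis
  have inv: "hm_inv t (pencil N A x) = (1 / q x) *\<^sub>H T x" if "q x \<noteq> 0" for x
    by (rule hm_inv_eqI, rule hm_inverts_resolvent [OF pencil_carrier [OF A] qT(4) that qT(6,7)])
  have "(1 / q 0) *\<^sub>H T 0 = hm_one N"
    using inv [OF qT(2)] hm_inv_eqI [OF hm_inverts_one] pencil_zero [OF A] by metis
  moreover have "hm_tendsto (\<lambda>x. (1 / q x) *\<^sub>H T x) ((1 / q 0) *\<^sub>H T 0) (at 0)"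
    using qT(2,3,5) by (intro hm_tendsto_scaleR tendsto_intros) auto
  moreover have "\<forall>\<^sub>F x in at 0. (1 / q x) *\<^sub>H T x = hm_inv t (pencil N A x)"
    using eventually_at_not_in_finite [OF qT(1), of 0] by eventually_elim (simp add: inv)
  ultimately show ?thesis by (metis hm_tendsto_cong)
qed

lemma hm_inverts_mult:
  assumes "hm_inverts t N A A'" "hm_inverts t N B B'"
  shows "hm_inverts t N (A \<odot>\<^bsub>t\<^esub> B) (B' \<odot>\<^bsub>t\<^esub> A')"
proof -
  note car = assms [unfolded hm_inverts_def]
  have "A \<odot>\<^bsub>t\<^esub> B \<odot>\<^bsub>t\<^esub> (B' \<odot>\<^bsub>t\<^esub> A') = A \<odot>\<^bsub>t\<^esub> ((B \<odot>\<^bsub>t\<^esub> B') \<odot>\<^bsub>t\<^esub> A')"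
    using car by (subst (1 2) hm_mult_assoc) (auto simp: hm_mult_assoc simp del: carrier_matI)
  moreover have "B' \<odot>\<^bsub>t\<^esub> A' \<odot>\<^bsub>t\<^esub> (A \<odot>\<^bsub>t\<^esub> B) = B' \<odot>\<^bsub>t\<^esub> ((A' \<odot>\<^bsub>t\<^esub> A) \<odot>\<^bsub>t\<^esub> B)"
    using car by (subst (1 2) hm_mult_assoc) (auto simp: hm_mult_assoc simp del: carrier_matI)
  ultimately show ?thesis
    using car by (auto simp: hm_inverts_def hm_mult_one_left intro: hm_mult_carrier)
qed

text \<open>Continuity at the origin suffices: \<open>I - yA = (I - xA)(I - (y - x) A')\<close> with \<open>A' = (I -
  xA)\<^sup>-\<^sup>1 A\<close>.\<close>

lemma resolvent_tendsto:
  assumes A: "A \<in> carrier_mat N N" and inv: "hm_invertible t (pencil N A x)"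
  shows "hm_tendsto (\<lambda>y. hm_inv t (pencil N A y)) (hm_inv t (pencil N A x)) (at x)"
proof -
  define P where "P = pencil N A x"
  define G where "G = hm_inv t P"
  have P: "P \<in> carrier_mat N N" using A by (simp add: P_def pencil_carrier)
  have G: "G \<in> carrier_mat N N" "P \<odot>\<^bsub>t\<^esub> G = hm_one N" "G \<odot>\<^bsub>t\<^esub> P = hm_one N"
    unfolding G_def using hm_inv [OF _ P] inv by (simp_all add: P_def)
  define A' where "A' = G \<odot>\<^bsub>t\<^esub> A"
  have A': "A' \<in> carrier_mat N N" using A G by (simp add: A'_def hm_mult_carrier)
  have "P \<odot>\<^bsub>t\<^esub> A' = (P \<odot>\<^bsub>t\<^esub> G) \<odot>\<^bsub>t\<^esub> A"
    unfolding A'_def using P G(1) by (simp add: hm_mult_assoc)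
  then have PA': "P \<odot>\<^bsub>t\<^esub> A' = A" using G A by (simp add: hm_mult_one_left)
  have fac: "pencil N A y = P \<odot>\<^bsub>t\<^esub> pencil N A' (y - x)" for y
    using A' P A by (simp add: mult_pencil PA')
      (auto simp: P_def pencil_def mat_eq_iff hm_scaleR_index algebra_simps)
  have "hm_tendsto (\<lambda>y. hm_inv t (pencil N A' (y - x))) (hm_one N) (at x)"
    using resolvent_tendsto_one [OF A', of t] unfolding hm_tendsto_def
    by (simp add: LIM_offset_zero_iff [of x] eventually_at_to_0 [of _ x])
  then have "hm_tendsto (\<lambda>y. hm_inv t (pencil N A' (y - x)) \<odot>\<^bsub>t\<^esub> G) (hm_one N \<odot>\<^bsub>t\<^esub> G) (at x)"
    using G by (intro hm_tendsto_mult hm_tendsto_const) auto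
  moreover have "\<forall>\<^sub>F y in at x. hm_invertible t (pencil N A' (y - x))"
    using eventually_invertible_pencil [OF A', where x = 0]
    by (simp add: eventually_at_to_0 [of _ x])
  then have "\<forall>\<^sub>F y in at x. hm_inv t (pencil N A' (y - x)) \<odot>\<^bsub>t\<^esub> G = hm_inv t (pencil N A y)"
  proof eventually_elim
    case (elim y)
    have "hm_inverts t N (pencil N A' (y - x)) (hm_inv t (pencil N A' (y - x)))"
      using hm_inverts_inv [OF elim] A' by simp
    moreover have "hm_inverts t N P G" using P G by (simp add: hm_inverts_def)
    ultimately show ?case unfolding fac
      by (intro hm_inv_eqI [symmetric] hm_inverts_mult)
  qed
  ultimately have "hm_tendsto (\<lambda>y. hm_inv t (pencil N A y)) (hm_one N \<odot>\<^bsub>t\<^esub> G) (at x)"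
    by (rule hm_tendsto_cong)
  then show ?thesis using G by (simp add: G_def P_def hm_mult_one_left)
qed

section \<open>Observability and controllability as cancellation properties\<close>

text \<open>This converts the Markov parameters \<open>C A\<^sup>k h\<close>, on which the rest of the argument is
  based, into the resolvent condition by which observability is defined.\<close>

lemma resolvent_annihilates:
  assumes A: "A \<in> carrier_mat N N" and C: "C \<in> carrier_mat n N" and h: "h \<in> carrier_mat N m"
    and ann: "\<And>k. C \<odot>\<^bsub>t\<^esub> hm_pow t A k \<odot>\<^bsub>t\<^esub> h = 0\<^sub>m n m"
  shows "\<exists>\<epsilon>>0. \<forall>x\<in>{-\<epsilon><..<\<epsilon>}. hm_invertible t (pencil N A x) \<and>
    C \<odot>\<^bsub>t\<^esub> hm_inv t (pencil N A x) \<odot>\<^bsub>t\<^esub> h = 0\<^sub>m n m"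
proof -
  obtain q :: "real \<Rightarrow> real" and T where qT: "finite {x. q x = 0}" "q 0 \<noteq> 0" "\<And>x. T x \<in> carrier_mat N N"
    "\<And>x. pencil N A x \<odot>\<^bsub>t\<^esub> T x = q x *\<^sub>H hm_one N" "\<And>x. T x \<odot>\<^bsub>t\<^esub> pencil N A x = q x *\<^sub>H hm_one N"
    "\<And>x. C \<odot>\<^bsub>t\<^esub> T x \<odot>\<^bsub>t\<^esub> h = 0\<^sub>m n m"
    using resolvent_polynomial [OF A, of t] C h ann by metis
  have "\<forall>\<^sub>F x in nhds 0. q x \<noteq> 0"
    using eventually_at_not_in_finite [OF qT(1), of 0] qT(2) by (simp add: eventually_nhds_conv_at)
  then obtain \<epsilon> where \<epsilon>: "\<epsilon> > 0" "\<And>x. dist x 0 < \<epsilon> \<Longrightarrow> q x \<noteq> 0"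
    unfolding eventually_nhds_metric by auto
  show ?thesis
  proof (intro exI [of _ \<epsilon>] conjI ballI \<epsilon>(1))
    fix x assume "x \<in> {-\<epsilon><..<\<epsilon>}"
    then have "q x \<noteq> 0" using \<epsilon>(2) by (auto simp: dist_real_def)
    then have inv: "hm_inverts t N (pencil N A x) ((1 / q x) *\<^sub>H T x)"
      by (rule hm_inverts_resolvent [OF pencil_carrier [OF A] qT(3) _ qT(4,5)])
    show "hm_invertible t (pencil N A x)" using inv by (rule hm_invertibleI)
    have "C \<odot>\<^bsub>t\<^esub> ((1 / q x) *\<^sub>H T x) \<odot>\<^bsub>t\<^esub> h = (1 / q x) *\<^sub>H (C \<odot>\<^bsub>t\<^esub> T x \<odot>\<^bsub>t\<^esub> h)"
      using C carrier_matD [OF qT(3)] by (simp add: hm_scaleR_mult hm_mult_scaleR)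
    also have "\<dots> = 0\<^sub>m n m"
      unfolding qT(6) by (auto simp: mat_eq_iff hm_scaleR_index)
    finally show "C \<odot>\<^bsub>t\<^esub> hm_inv t (pencil N A x) \<odot>\<^bsub>t\<^esub> h = 0\<^sub>m n m"
      by (simp add: hm_inv_eqI [OF inv])
  qed
qed

text \<open>Observability concerns single columns; applied to each column it lets whole matrix
  factors be cancelled.\<close>

lemma observable_cancel:
  assumes obs: "observable t n N C A" and A: "A \<in> carrier_mat N N" and C: "C \<in> carrier_mat n N"
    and X: "X \<in> carrier_mat N m" and ann: "\<And>k. C \<odot>\<^bsub>t\<^esub> hm_pow t A k \<odot>\<^bsub>t\<^esub> X = 0\<^sub>m n m"
  shows "X = 0\<^sub>m N m"
proof (rule eq_matI)
  fix i j assume ij: "i < dim_row (0\<^sub>m N m)" "j < dim_col (0\<^sub>m N m)"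
  define h where "h = mat N 1 (\<lambda>(i, _). X $$ (i, j))"
  have h: "h \<in> carrier_mat N 1" by (simp add: h_def)
  have "C \<odot>\<^bsub>t\<^esub> hm_pow t A k \<odot>\<^bsub>t\<^esub> h = 0\<^sub>m n 1" for k
  proof (rule eq_matI)
    fix i l assume il: "i < dim_row (0\<^sub>m n 1)" "l < dim_col (0\<^sub>m n 1)"
    have "(P \<odot>\<^bsub>t\<^esub> h) $$ (i, l) = (P \<odot>\<^bsub>t\<^esub> X) $$ (i, j)" if "P \<in> carrier_mat n N" for P
      using that X ij il by (simp add: h_def hm_mult_index)
    from this [OF hm_mult_carrier [OF C hm_pow_carrier [OF A]]]
    have "(C \<odot>\<^bsub>t\<^esub> hm_pow t A k \<odot>\<^bsub>t\<^esub> h) $$ (i, l) = (C \<odot>\<^bsub>t\<^esub> hm_pow t A k \<odot>\<^bsub>t\<^esub> X) $$ (i, j)" .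
    then show "(C \<odot>\<^bsub>t\<^esub> hm_pow t A k \<odot>\<^bsub>t\<^esub> h) $$ (i, l) = 0\<^sub>m n 1 $$ (i, l)"
      using il ij by (simp add: ann)
  qed (use C h in simp_all)
  then have "h = 0\<^sub>m N 1"
    using obs resolvent_annihilates [OF A C h] h unfolding observable_def by blast
  then have "h $$ (i, 0) = 0" using ij by simp
  then show "X $$ (i, j) = 0\<^sub>m N m $$ (i, j)" using ij by (simp add: h_def)
qed (use X in simp_all)

lemma controllable_cancel:
  assumes ctr: "controllable t n N A B" and A: "A \<in> carrier_mat N N" and B: "B \<in> carrier_mat N n"
    and X: "X \<in> carrier_mat m N" and ann: "\<And>k. X \<odot>\<^bsub>t\<^esub> hm_pow t A k \<odot>\<^bsub>t\<^esub> B = 0\<^sub>m m n"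
  shows "X = 0\<^sub>m m N"
proof (rule eq_matI)
  fix i j assume ij: "i < dim_row (0\<^sub>m m N)" "j < dim_col (0\<^sub>m m N)"
  define h where "h = mat 1 N (\<lambda>(_, j). X $$ (i, j))"
  have h: "h \<in> carrier_mat 1 N" by (simp add: h_def)
  have "h \<odot>\<^bsub>t\<^esub> hm_pow t A k \<odot>\<^bsub>t\<^esub> B = 0\<^sub>m 1 n" for k
  proof (rule eq_matI)
    fix l j assume lj: "l < dim_row (0\<^sub>m 1 n)" "j < dim_col (0\<^sub>m 1 n)"
    have "(h \<odot>\<^bsub>t\<^esub> P) $$ (l, j) = (X \<odot>\<^bsub>t\<^esub> P) $$ (i, j)" if "P \<in> carrier_mat N n" for P
      using that X ij lj by (simp add: h_def hm_mult_index)
    from this [OF hm_mult_carrier [OF hm_pow_carrier [OF A] B]]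
    have "(h \<odot>\<^bsub>t\<^esub> (hm_pow t A k \<odot>\<^bsub>t\<^esub> B)) $$ (l, j) = (X \<odot>\<^bsub>t\<^esub> (hm_pow t A k \<odot>\<^bsub>t\<^esub> B)) $$ (i, j)" .
    moreover have "X \<odot>\<^bsub>t\<^esub> (hm_pow t A k \<odot>\<^bsub>t\<^esub> B) = 0\<^sub>m m n"
      using ann [of k] A X by (simp add: hm_mult_assoc)
    ultimately show "(h \<odot>\<^bsub>t\<^esub> hm_pow t A k \<odot>\<^bsub>t\<^esub> B) $$ (l, j) = 0\<^sub>m 1 n $$ (l, j)"
      using lj ij h A by (simp add: hm_mult_assoc)
  qed (use B h in simp_all)
  then have "h = 0\<^sub>m 1 N"
    using ctr h unfolding controllable_def by blast
  then have "h $$ (0, j) = 0" using ij by simp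
  then show "X $$ (i, j) = 0\<^sub>m m N $$ (i, j)" using ij by (simp add: h_def)
qed (use X in simp_all)

section \<open>A positive involution and controllability Gramians\<close>

text \<open>For \<open>t < 0\<close> this is the quaternionic conjugation \<open>ht_conj\<close>. For \<open>t > 0\<close> the form \<open>q \<mapsto> q
  q\<^sup>\<circledast>\<close> is indefinite; changing the sign of the second component makes the complex part of \<open>q q\<^sup>*\<close>
  have the positive definite real part \<open>\<bar>a\<bar>\<^sup>2 + \<bar>t\<bar> \<bar>b\<bar>\<^sup>2\<close>.\<close>

definition ht_star :: "real \<Rightarrow> ht \<Rightarrow> ht" where
  "ht_star t q = (cnj (fst q), of_real (sgn t) * snd q)"

definition hm_star :: "real \<Rightarrow> ht mat \<Rightarrow> ht mat" where
  "hm_star t A = mat (dim_col A) (dim_row A) (\<lambda>(j, k). ht_star t (A $$ (k, j)))"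

lemma hm_star_dim [simp]: "dim_row (hm_star t A) = dim_col A" "dim_col (hm_star t A) = dim_row A"
  by (simp_all add: hm_star_def)

lemma hm_star_index:
  "i < dim_col A \<Longrightarrow> j < dim_row A \<Longrightarrow> hm_star t A $$ (i, j) = ht_star t (A $$ (j, i))"
  by (simp add: hm_star_def)

lemma hm_star_carrier: "A \<in> carrier_mat r c \<Longrightarrow> hm_star t A \<in> carrier_mat c r"
  by (simp add: hm_star_def)

lemma ht_star_mult:
  assumes "t \<noteq> 0"
  shows "ht_star t (ht_mult t p q) = ht_mult t (ht_star t q) (ht_star t p)"
  using assms by (simp add: ht_star_def ht_mult_def sgn_if algebra_simps)

lemma ht_star_star: "t \<noteq> 0 \<Longrightarrow> ht_star t (ht_star t q) = q"
  by (simp add: ht_star_def sgn_if)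

lemma hm_star_star: "t \<noteq> 0 \<Longrightarrow> hm_star t (hm_star t A) = A"
  by (rule eq_matI) (simp_all add: hm_star_index ht_star_star)

lemma linear_ht_star: "linear (ht_star t)"
  by (auto intro!: linearI simp: ht_star_def algebra_simps)

lemma hm_star_mult:
  "t \<noteq> 0 \<Longrightarrow> dim_col A = dim_row B \<Longrightarrow> hm_star t (A \<odot>\<^bsub>t\<^esub> B) = hm_star t B \<odot>\<^bsub>t\<^esub> hm_star t A"
  by (rule eq_matI)
    (auto simp: hm_star_index hm_mult_index linear_sum [OF linear_ht_star] ht_star_mult)

lemma Re_fst_ht_mult_star:
  "Re (fst (ht_mult t q (ht_star t q))) = (cmod (fst q))\<^sup>2 + \<bar>t\<bar> * (cmod (snd q))\<^sup>2"
  unfolding cmod_power2 by (simp add: ht_mult_def ht_star_def sgn_if power2_eq_square algebra_simps)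

lemma Re_fst_ht_mult_star_nonneg: "0 \<le> Re (fst (ht_mult t q (ht_star t q)))"
  by (simp add: Re_fst_ht_mult_star)

lemma Re_fst_ht_mult_star_eq_0:
  assumes "t \<noteq> 0" "Re (fst (ht_mult t q (ht_star t q))) = 0" shows "q = 0"
proof -
  have "(cmod (fst q))\<^sup>2 + \<bar>t\<bar> * (cmod (snd q))\<^sup>2 = 0"
    using assms(2) by (simp only: Re_fst_ht_mult_star)
  moreover have "0 \<le> (cmod (fst q))\<^sup>2" "0 \<le> \<bar>t\<bar> * (cmod (snd q))\<^sup>2" by simp_all
  ultimately have "(cmod (fst q))\<^sup>2 = 0" "\<bar>t\<bar> * (cmod (snd q))\<^sup>2 = 0" by linarith+
  then show ?thesis using assms(1) by (simp add: prod_eq_iff)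
qed

text \<open>The real parts of the diagonal entries are sums of nonnegative terms, one for each entry
  of each \<open>Z k\<close>.\<close>

lemma sum_mult_star_eq_zero:
  assumes t: "t \<noteq> 0" and Z: "\<And>k. Z k \<in> carrier_mat r c"
    and zero: "hm_sum r r d (\<lambda>k. Z k \<odot>\<^bsub>t\<^esub> hm_star t (Z k)) = 0\<^sub>m r r" and k: "k < d"
  shows "Z k = 0\<^sub>m r c"
proof (rule eq_matI)
  fix i j assume "i < dim_row (0\<^sub>m r c)" "j < dim_col (0\<^sub>m r c)"
  then have ij: "i < r" "j < c" by simp_all
  have Zd: "dim_row (Z k) = r" "dim_col (Z k) = c" for k using Z by auto
  let ?s = "\<lambda>k j. Re (fst (ht_mult t (Z k $$ (i, j)) (ht_star t (Z k $$ (i, j)))))"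
  have "hm_sum r r d (\<lambda>k. Z k \<odot>\<^bsub>t\<^esub> hm_star t (Z k)) $$ (i, i) = 0"
    using ij by (simp add: zero)
  then have "(\<Sum>k<d. \<Sum>j<c. ?s k j) = 0"
    using ij by (simp add: hm_sum_index hm_mult_index hm_star_index Zd prod_eq_iff
        complex_eq_iff fst_sum)
  then have "(\<Sum>j<c. ?s k j) = 0"
    using k by (subst (asm) sum_nonneg_eq_0_iff)
      (auto intro!: sum_nonneg Re_fst_ht_mult_star_nonneg)
  then have "?s k j = 0"
    using ij by (subst (asm) sum_nonneg_eq_0_iff) (auto intro!: Re_fst_ht_mult_star_nonneg)
  then show "Z k $$ (i, j) = 0\<^sub>m r c $$ (i, j)"
    using Re_fst_ht_mult_star_eq_0 [OF t] ij by simp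
qed (use Z [of k] in auto)

text \<open>Through a polynomial relation for \<open>A\<close>, powers from the degree \<open>d\<close> on are combinations of
  lower ones. The bound must not depend on \<open>X\<close>, since the Gramian is formed before \<open>X\<close> is known.\<close>

lemma annihilates_finitely_many_powers:
  assumes A: "A \<in> carrier_mat N N"
  obtains d where "\<And>X B m n k. X \<in> carrier_mat m N \<Longrightarrow> B \<in> carrier_mat N n \<Longrightarrow>
    (\<And>j. j < d \<Longrightarrow> X \<odot>\<^bsub>t\<^esub> hm_pow t A j \<odot>\<^bsub>t\<^esub> B = 0\<^sub>m m n) \<Longrightarrow>
    X \<odot>\<^bsub>t\<^esub> hm_pow t A k \<odot>\<^bsub>t\<^esub> B = 0\<^sub>m m n"
proof -
  obtain d and c :: "nat \<Rightarrow> real" where cd: "c d \<noteq> 0"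
    and rel: "hm_sum N N (Suc d) (\<lambda>k. c k *\<^sub>H hm_pow t A k) = 0\<^sub>m N N"
    by (rule hm_powers_dependent [OF A])
  have pow: "hm_pow t A k \<in> carrier_mat N N" for k using A by (rule hm_pow_carrier)
  have "X \<odot>\<^bsub>t\<^esub> hm_pow t A k \<odot>\<^bsub>t\<^esub> B = 0\<^sub>m m n"
    if X: "X \<in> carrier_mat m N" and B: "B \<in> carrier_mat N n"
      and ann: "\<And>j. j < d \<Longrightarrow> X \<odot>\<^bsub>t\<^esub> hm_pow t A j \<odot>\<^bsub>t\<^esub> B = 0\<^sub>m m n" for X B m n k
  proof (induction k rule: less_induct)
    case (less k)
    show ?case
    proof (cases "k < d")
      case True
      then show ?thesis by (rule ann)
    next
      case False
      then have k: "k = (k - d) + d" by simp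
      define V where "V = X \<odot>\<^bsub>t\<^esub> hm_pow t A (k - d)"
      have V: "V \<in> carrier_mat m N" unfolding V_def using X pow by (rule hm_mult_carrier)
      have VA: "V \<odot>\<^bsub>t\<^esub> hm_pow t A j \<odot>\<^bsub>t\<^esub> B = X \<odot>\<^bsub>t\<^esub> hm_pow t A (k - d + j) \<odot>\<^bsub>t\<^esub> B" for j
        using X A by (simp add: V_def hm_pow_add [OF A] hm_mult_assoc)
      have car: "c j *\<^sub>H hm_pow t A j \<in> carrier_mat N N"
        "c j *\<^sub>H (V \<odot>\<^bsub>t\<^esub> hm_pow t A j) \<in> carrier_mat m N"
        "c j *\<^sub>H (V \<odot>\<^bsub>t\<^esub> hm_pow t A j \<odot>\<^bsub>t\<^esub> B) \<in> carrier_mat m n" for j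
        using V B pow by (auto intro!: hm_scaleR_carrier hm_mult_carrier)
      have "V \<odot>\<^bsub>t\<^esub> hm_sum N N (Suc d) (\<lambda>j. c j *\<^sub>H hm_pow t A j) \<odot>\<^bsub>t\<^esub> B
          = hm_sum m n (Suc d) (\<lambda>j. c j *\<^sub>H (V \<odot>\<^bsub>t\<^esub> hm_pow t A j \<odot>\<^bsub>t\<^esub> B))"
        using V A B car by (simp add: hm_mult_sum hm_sum_mult [OF car(2)] hm_mult_scaleR hm_scaleR_mult)
      also have "\<dots> = hm_sum m n d (\<lambda>j. c j *\<^sub>H (V \<odot>\<^bsub>t\<^esub> hm_pow t A j \<odot>\<^bsub>t\<^esub> B))
          + c d *\<^sub>H (V \<odot>\<^bsub>t\<^esub> hm_pow t A d \<odot>\<^bsub>t\<^esub> B)"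
        by (rule hm_sum_Suc) (rule car)
      also have "hm_sum m n d (\<lambda>j. c j *\<^sub>H (V \<odot>\<^bsub>t\<^esub> hm_pow t A j \<odot>\<^bsub>t\<^esub> B)) = hm_sum m n d (\<lambda>_. 0\<^sub>m m n)"
      proof (rule hm_sum_cong)
        fix j assume "j < d"
        then have "V \<odot>\<^bsub>t\<^esub> hm_pow t A j \<odot>\<^bsub>t\<^esub> B = 0\<^sub>m m n"
          unfolding VA using False by (intro less.IH) simp
        then show "c j *\<^sub>H (V \<odot>\<^bsub>t\<^esub> hm_pow t A j \<odot>\<^bsub>t\<^esub> B) = 0\<^sub>m m n"
          by (auto simp: mat_eq_iff hm_scaleR_index)
      qed
      finally have "c d *\<^sub>H (V \<odot>\<^bsub>t\<^esub> hm_pow t A d \<odot>\<^bsub>t\<^esub> B) = 0\<^sub>m m n"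
        using V B car(3) [of d] by (simp add: rel hm_mult_zero_right hm_mult_zero_left)
      then have "V \<odot>\<^bsub>t\<^esub> hm_pow t A d \<odot>\<^bsub>t\<^esub> B = 0\<^sub>m m n"
        using V B cd by (auto simp: mat_eq_iff hm_scaleR_index)
      then show ?thesis unfolding VA using False by simp
    qed
  qed
  then show ?thesis by (rule that)
qed

text \<open>The Gramian \<open>W = \<Sum>\<^sub>k Y\<^sub>k Y\<^sub>k\<^sup>*\<close> with \<open>Y\<^sub>k = A\<^sup>k B\<close> and the positive involution is injective:
  \<open>W X = 0\<close> gives \<open>\<Sum>\<^sub>k (X\<^sup>* Y\<^sub>k) (X\<^sup>* Y\<^sub>k)\<^sup>* = 0\<close>, so every \<open>X\<^sup>* Y\<^sub>k\<close> vanishes and controllability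
  applies. Hence \<open>W\<close> is invertible and \<open>M\<^sub>k = Y\<^sub>k\<^sup>* W\<^sup>-\<^sup>1\<close>.\<close>

lemma controllable_right_inverse:
  assumes t: "t \<noteq> 0" and ctr: "controllable t n N A B"
    and A: "A \<in> carrier_mat N N" and B: "B \<in> carrier_mat N n"
  obtains d M where "\<And>k. M k \<in> carrier_mat n N"
    "hm_sum N N d (\<lambda>k. hm_pow t A k \<odot>\<^bsub>t\<^esub> B \<odot>\<^bsub>t\<^esub> M k) = hm_one N"
proof -
  obtain d where d: "\<And>X B m n k. X \<in> carrier_mat m N \<Longrightarrow> B \<in> carrier_mat N n \<Longrightarrow>
      (\<And>j. j < d \<Longrightarrow> X \<odot>\<^bsub>t\<^esub> hm_pow t A j \<odot>\<^bsub>t\<^esub> B = 0\<^sub>m m n) \<Longrightarrow>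
      X \<odot>\<^bsub>t\<^esub> hm_pow t A k \<odot>\<^bsub>t\<^esub> B = 0\<^sub>m m n"
    using annihilates_finitely_many_powers [OF A, of t] by metis
  define Y where "Y k = hm_pow t A k \<odot>\<^bsub>t\<^esub> B" for k
  have Y: "Y k \<in> carrier_mat N n" for k
    unfolding Y_def using hm_pow_carrier [OF A] B by (rule hm_mult_carrier)
  have Yd: "dim_row (Y k) = N" "dim_col (Y k) = n" for k using Y [of k] by auto
  have YY: "Y k \<odot>\<^bsub>t\<^esub> hm_star t (Y k) \<in> carrier_mat N N" for k
    by (intro hm_mult_carrier [OF Y hm_star_carrier [OF Y]])
  define W where "W = hm_sum N N d (\<lambda>k. Y k \<odot>\<^bsub>t\<^esub> hm_star t (Y k))"
  have W: "W \<in> carrier_mat N N" by (simp add: W_def hm_sum_carrier)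
  have "hm_invertible t W"
  proof (rule hm_injective_imp_invertible [OF W])
    fix X assume X: "X \<in> carrier_mat N N" and WX: "W \<odot>\<^bsub>t\<^esub> X = 0\<^sub>m N N"
    let ?X = "hm_star t X"
    have Xs: "?X \<in> carrier_mat N N" using X by (rule hm_star_carrier)
    have XY: "?X \<odot>\<^bsub>t\<^esub> Y k \<in> carrier_mat N n" for k using Xs Y by (rule hm_mult_carrier)
    have XYY: "?X \<odot>\<^bsub>t\<^esub> (Y k \<odot>\<^bsub>t\<^esub> hm_star t (Y k)) \<in> carrier_mat N N" for k
      using Xs YY by (rule hm_mult_carrier)
    have "hm_sum N N d (\<lambda>k. (?X \<odot>\<^bsub>t\<^esub> Y k) \<odot>\<^bsub>t\<^esub> hm_star t (?X \<odot>\<^bsub>t\<^esub> Y k)) = ?X \<odot>\<^bsub>t\<^esub> W \<odot>\<^bsub>t\<^esub> X"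
      using t X YY unfolding W_def
      by (simp add: hm_mult_sum hm_sum_mult [OF XYY] hm_star_mult hm_star_star hm_mult_assoc Yd)
    also have "\<dots> = 0\<^sub>m N N" using X W WX by (simp add: hm_mult_assoc hm_mult_zero_right)
    finally have "?X \<odot>\<^bsub>t\<^esub> Y k = 0\<^sub>m N n" if "k < d" for k
      using sum_mult_star_eq_zero [OF t, of "\<lambda>k. ?X \<odot>\<^bsub>t\<^esub> Y k", OF XY] that by blast
    then have "?X \<odot>\<^bsub>t\<^esub> hm_pow t A k \<odot>\<^bsub>t\<^esub> B = 0\<^sub>m N n" if "k < d" for k
      using that X A by (simp add: Y_def hm_mult_assoc)
    then have "?X \<odot>\<^bsub>t\<^esub> hm_pow t A k \<odot>\<^bsub>t\<^esub> B = 0\<^sub>m N n" for k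
      using d [OF Xs B] by blast
    then have "?X = 0\<^sub>m N N" by (rule controllable_cancel [OF ctr A B Xs])
    then have "hm_star t ?X = hm_star t (0\<^sub>m N N)" by simp
    then show "X = 0\<^sub>m N N"
      using t X by (auto simp: hm_star_star mat_eq_iff hm_star_index linear_0 [OF linear_ht_star])
  qed
  note G = hm_inv [OF this W]
  let ?M = "\<lambda>k. hm_star t (Y k) \<odot>\<^bsub>t\<^esub> hm_inv t W"
  have "hm_sum N N d (\<lambda>k. Y k \<odot>\<^bsub>t\<^esub> ?M k) = W \<odot>\<^bsub>t\<^esub> hm_inv t W"
    unfolding W_def [THEN arg_cong [of _ _ "\<lambda>W'. W' \<odot>\<^bsub>t\<^esub> hm_inv t W"]]
    using G(1) YY by (simp add: hm_sum_mult hm_mult_assoc Yd)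
  moreover have "?M k \<in> carrier_mat n N" for k
    using hm_star_carrier [OF Y] G(1) by (rule hm_mult_carrier)
  ultimately show ?thesis using that [of ?M d] G(2) by (simp add: Y_def)
qed

section \<open>Markov parameters from resolvents\<close>

text \<open>The identity \<open>r(x) = I + x A r(x)\<close>, which peels off one Markov parameter.\<close>

lemma resolvent_expand:
  assumes A: "A \<in> carrier_mat N N" and inv: "hm_invertible t (pencil N A x)"
    and Z: "Z \<in> carrier_mat n N" and Y: "Y \<in> carrier_mat N m"
  shows "Z \<odot>\<^bsub>t\<^esub> hm_inv t (pencil N A x) \<odot>\<^bsub>t\<^esub> Y
    = Z \<odot>\<^bsub>t\<^esub> Y + x *\<^sub>H ((Z \<odot>\<^bsub>t\<^esub> A) \<odot>\<^bsub>t\<^esub> hm_inv t (pencil N A x) \<odot>\<^bsub>t\<^esub> Y)"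
proof -
  let ?r = "hm_inv t (pencil N A x)"
  note r = hm_inv [OF inv pencil_carrier [OF A]]
  have "Z \<odot>\<^bsub>t\<^esub> (pencil N A x \<odot>\<^bsub>t\<^esub> ?r) \<odot>\<^bsub>t\<^esub> Y = Z \<odot>\<^bsub>t\<^esub> Y" using r Z by (simp add: hm_mult_one_right)
  moreover have "Z \<odot>\<^bsub>t\<^esub> (pencil N A x \<odot>\<^bsub>t\<^esub> ?r) \<odot>\<^bsub>t\<^esub> Y
      = Z \<odot>\<^bsub>t\<^esub> ?r \<odot>\<^bsub>t\<^esub> Y - x *\<^sub>H ((Z \<odot>\<^bsub>t\<^esub> A) \<odot>\<^bsub>t\<^esub> ?r \<odot>\<^bsub>t\<^esub> Y)"
    using A Z r(1) unfolding pencil_mult [OF A r(1)]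
    by (simp add: hm_distrib hm_mult_assoc)
  ultimately have "Z \<odot>\<^bsub>t\<^esub> ?r \<odot>\<^bsub>t\<^esub> Y - x *\<^sub>H ((Z \<odot>\<^bsub>t\<^esub> A) \<odot>\<^bsub>t\<^esub> ?r \<odot>\<^bsub>t\<^esub> Y) = Z \<odot>\<^bsub>t\<^esub> Y" by simp
  then show ?thesis using A Z Y by (auto simp: mat_eq_iff hm_scaleR_index algebra_simps)
qed

text \<open>The limit at the origin yields the first parameter; subtracting it and dividing by \<open>x\<close>
  leaves an equality of the same kind with \<open>X A\<close> and \<open>X' A'\<close> in place of \<open>X\<close> and \<open>X'\<close>.
  Coefficients are thus compared without power series.\<close>

lemma markov_parameters_eq:
  assumes A: "A \<in> carrier_mat N N" "A' \<in> carrier_mat N' N'"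
    and X: "X \<in> carrier_mat n N" "X' \<in> carrier_mat n N'"
    and Y: "Y \<in> carrier_mat N m" "Y' \<in> carrier_mat N' m"
    and ev: "\<forall>\<^sub>F x in at 0. X \<odot>\<^bsub>t\<^esub> hm_inv t (pencil N A x) \<odot>\<^bsub>t\<^esub> Y
      = X' \<odot>\<^bsub>t\<^esub> hm_inv t (pencil N' A' x) \<odot>\<^bsub>t\<^esub> Y'"
  shows "X \<odot>\<^bsub>t\<^esub> hm_pow t A k \<odot>\<^bsub>t\<^esub> Y = X' \<odot>\<^bsub>t\<^esub> hm_pow t A' k \<odot>\<^bsub>t\<^esub> Y'"
proof -
  let ?P = "\<lambda>k. \<forall>\<^sub>F x in at 0. (X \<odot>\<^bsub>t\<^esub> hm_pow t A k) \<odot>\<^bsub>t\<^esub> hm_inv t (pencil N A x) \<odot>\<^bsub>t\<^esub> Y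
      = (X' \<odot>\<^bsub>t\<^esub> hm_pow t A' k) \<odot>\<^bsub>t\<^esub> hm_inv t (pencil N' A' x) \<odot>\<^bsub>t\<^esub> Y'"
  have Z: "X \<odot>\<^bsub>t\<^esub> hm_pow t A k \<in> carrier_mat n N" "X' \<odot>\<^bsub>t\<^esub> hm_pow t A' k \<in> carrier_mat n N'" for k
    using X hm_pow_carrier [OF A(1)] hm_pow_carrier [OF A(2)] by (auto intro: hm_mult_carrier)
  have lim: "hm_tendsto (\<lambda>x. Z \<odot>\<^bsub>t\<^esub> hm_inv t (pencil N A x) \<odot>\<^bsub>t\<^esub> Y) (Z \<odot>\<^bsub>t\<^esub> Y) (at 0)"
    if "A \<in> carrier_mat N N" "Z \<in> carrier_mat n N" "Y \<in> carrier_mat N m" for A N Z Y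
  proof -
    have "hm_tendsto (\<lambda>x. Z \<odot>\<^bsub>t\<^esub> hm_inv t (pencil N A x) \<odot>\<^bsub>t\<^esub> Y) (Z \<odot>\<^bsub>t\<^esub> hm_one N \<odot>\<^bsub>t\<^esub> Y) (at 0)"
      using that by (intro hm_tendsto_mult hm_tendsto_const resolvent_tendsto_one) auto
    then show ?thesis using that by (simp add: hm_mult_one_right)
  qed
  have eq: "X \<odot>\<^bsub>t\<^esub> hm_pow t A k \<odot>\<^bsub>t\<^esub> Y = X' \<odot>\<^bsub>t\<^esub> hm_pow t A' k \<odot>\<^bsub>t\<^esub> Y'" if "?P k" for k
    by (rule hm_tendsto_unique [OF hm_tendsto_cong [OF lim [OF A(1) Z(1) Y(1)] that]
          lim [OF A(2) Z(2) Y(2)]]) simp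
  have "?P k" for k
  proof (induction k)
    case 0
    then show ?case using ev A X by (simp add: hm_mult_one_right)
  next
    case (Suc k)
    have "\<forall>\<^sub>F x in at 0. x \<noteq> (0 :: real)" by (simp add: eventually_at_filter)
    with Suc eventually_invertible_pencil [OF A(1), of t 0] eventually_invertible_pencil [OF A(2), of t 0]
    show ?case
    proof eventually_elim
      case (elim x)
      let ?r = "hm_inv t (pencil N A x)" and ?r' = "hm_inv t (pencil N' A' x)"
      let ?U = "(X \<odot>\<^bsub>t\<^esub> hm_pow t A k \<odot>\<^bsub>t\<^esub> A) \<odot>\<^bsub>t\<^esub> ?r \<odot>\<^bsub>t\<^esub> Y"
        and ?U' = "(X' \<odot>\<^bsub>t\<^esub> hm_pow t A' k \<odot>\<^bsub>t\<^esub> A') \<odot>\<^bsub>t\<^esub> ?r' \<odot>\<^bsub>t\<^esub> Y'"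
      have "X \<odot>\<^bsub>t\<^esub> hm_pow t A k \<odot>\<^bsub>t\<^esub> Y + x *\<^sub>H ?U = X' \<odot>\<^bsub>t\<^esub> hm_pow t A' k \<odot>\<^bsub>t\<^esub> Y' + x *\<^sub>H ?U'"
        using elim(1) resolvent_expand [OF A(1) elim(2) Z(1) Y(1)]
          resolvent_expand [OF A(2) elim(3) Z(2) Y(2)] by simp
      then have "x *\<^sub>H ?U = x *\<^sub>H ?U'"
        using X Y unfolding eq [OF Suc] by (auto simp: mat_eq_iff)
      then have "?U = ?U'"
        using elim(4) X Y by (auto simp: mat_eq_iff hm_scaleR_index)
      then show ?case using X A by (simp add: hm_mult_assoc)
    qed
  qed
  then show ?thesis by (rule eq)
qed

section \<open>Intertwining two realizations\<close>

text \<open>The Lyapunov equation moves \<open>A\<close> past \<open>X\<close>, at the price of \<open>- A\<^sup>\<circledast>\<close>, so \<open>X A\<^sup>k B = \<plusminus> (A\<^sup>\<circledast>)\<^sup>k X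
  B = 0\<close> for all \<open>k\<close>.\<close>

lemma lyapunov_zero:
  assumes ctr: "controllable t n N A B" and A: "A \<in> carrier_mat N N" and B: "B \<in> carrier_mat N n"
    and X: "X \<in> carrier_mat N N" and XB: "X \<odot>\<^bsub>t\<^esub> B = 0\<^sub>m N n"
    and lyap: "A\<^sup>\<circledast> \<odot>\<^bsub>t\<^esub> X + X \<odot>\<^bsub>t\<^esub> A = 0\<^sub>m N N"
  shows "X = 0\<^sub>m N N"
proof (rule controllable_cancel [OF ctr A B X])
  have XA: "X \<odot>\<^bsub>t\<^esub> A = - (A\<^sup>\<circledast> \<odot>\<^bsub>t\<^esub> X)"
    using lyap A X by (auto simp: mat_eq_iff add_eq_0_iff)
  show "X \<odot>\<^bsub>t\<^esub> hm_pow t A k \<odot>\<^bsub>t\<^esub> B = 0\<^sub>m N n" for k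
  proof (induction k)
    case 0
    then show ?case using A X XB by (simp add: hm_mult_one_right)
  next
    case (Suc k)
    have "X \<odot>\<^bsub>t\<^esub> hm_pow t A (Suc k) \<odot>\<^bsub>t\<^esub> B = (X \<odot>\<^bsub>t\<^esub> A) \<odot>\<^bsub>t\<^esub> (hm_pow t A k \<odot>\<^bsub>t\<^esub> B)"
      unfolding hm_pow_Suc_left [OF A] using A X by (simp add: hm_mult_assoc)
    also have "\<dots> = - (A\<^sup>\<circledast> \<odot>\<^bsub>t\<^esub> (X \<odot>\<^bsub>t\<^esub> hm_pow t A k \<odot>\<^bsub>t\<^esub> B))"
      unfolding XA using A X by (simp add: hm_uminus_mult hm_mult_assoc)
    also have "\<dots> = 0\<^sub>m N n"
      unfolding Suc using A by (auto simp: hm_mult_zero_right mat_eq_iff)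
    finally show ?case .
  qed
qed

text \<open>The state space similarity argument. With a left inverse \<open>\<Sum>\<^sub>k K\<^sub>k C\<^sub>2 A\<^sub>2\<^sup>k = I\<close> of the
  second observability matrix, \<open>S\<close> must be \<open>\<Sum>\<^sub>k K\<^sub>k C\<^sub>1 A\<^sub>1\<^sup>k\<close>. Equality of Markov parameters gives \<open>S
  A\<^sub>1\<^sup>j B\<^sub>1 = A\<^sub>2\<^sup>j B\<^sub>2\<close> for all \<open>j\<close>, and the other relations follow from this by cancelling the factors
  \<open>A\<^sub>1\<^sup>j B\<^sub>1\<close>.\<close>

lemma intertwiner:
  assumes A1: "A1 \<in> carrier_mat N N" and B1: "B1 \<in> carrier_mat N n" and C1: "C1 \<in> carrier_mat n N"
    and A2: "A2 \<in> carrier_mat N N" and B2: "B2 \<in> carrier_mat N n" and C2: "C2 \<in> carrier_mat n N"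
    and markov: "\<And>k. C1 \<odot>\<^bsub>t\<^esub> hm_pow t A1 k \<odot>\<^bsub>t\<^esub> B1 = C2 \<odot>\<^bsub>t\<^esub> hm_pow t A2 k \<odot>\<^bsub>t\<^esub> B2"
    and ctr: "\<And>m X. X \<in> carrier_mat m N \<Longrightarrow> (\<And>k. X \<odot>\<^bsub>t\<^esub> hm_pow t A1 k \<odot>\<^bsub>t\<^esub> B1 = 0\<^sub>m m n) \<Longrightarrow> X = 0\<^sub>m m N"
    and K: "\<And>k. K k \<in> carrier_mat N n"
    and left_inv: "hm_sum N N d (\<lambda>k. K k \<odot>\<^bsub>t\<^esub> C2 \<odot>\<^bsub>t\<^esub> hm_pow t A2 k) = hm_one N"
  obtains S where "S \<in> carrier_mat N N" "S \<odot>\<^bsub>t\<^esub> B1 = B2" "C2 \<odot>\<^bsub>t\<^esub> S = C1" "S \<odot>\<^bsub>t\<^esub> A1 = A2 \<odot>\<^bsub>t\<^esub> S"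
proof -
  note pow1 = hm_pow_carrier [OF A1] and pow2 = hm_pow_carrier [OF A2]
  have Kd: "dim_row (K k) = N" "dim_col (K k) = n" for k using K by auto
  define S where "S = hm_sum N N d (\<lambda>k. K k \<odot>\<^bsub>t\<^esub> C1 \<odot>\<^bsub>t\<^esub> hm_pow t A1 k)"
  have S: "S \<in> carrier_mat N N" by (simp add: S_def hm_sum_carrier)
  have car1: "K k \<odot>\<^bsub>t\<^esub> C1 \<odot>\<^bsub>t\<^esub> hm_pow t A1 k \<in> carrier_mat N N" for k
    using K C1 pow1 by (intro hm_mult_carrier)
  have car2: "K k \<odot>\<^bsub>t\<^esub> C2 \<odot>\<^bsub>t\<^esub> hm_pow t A2 k \<in> carrier_mat N N" for k
    using K C2 pow2 by (intro hm_mult_carrier)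
  have SAB: "S \<odot>\<^bsub>t\<^esub> (hm_pow t A1 j \<odot>\<^bsub>t\<^esub> B1) = hm_pow t A2 j \<odot>\<^bsub>t\<^esub> B2" for j
  proof -
    have "S \<odot>\<^bsub>t\<^esub> (hm_pow t A1 j \<odot>\<^bsub>t\<^esub> B1)
        = hm_sum N n d (\<lambda>k. K k \<odot>\<^bsub>t\<^esub> (C1 \<odot>\<^bsub>t\<^esub> hm_pow t A1 (k + j) \<odot>\<^bsub>t\<^esub> B1))"
      unfolding S_def hm_sum_mult [OF car1]
      using A1 B1 C1 by (simp add: hm_mult_assoc Kd hm_pow_add [OF A1])
    also have "\<dots> = hm_sum N n d (\<lambda>k. (K k \<odot>\<^bsub>t\<^esub> C2 \<odot>\<^bsub>t\<^esub> hm_pow t A2 k) \<odot>\<^bsub>t\<^esub> (hm_pow t A2 j \<odot>\<^bsub>t\<^esub> B2))"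
      unfolding markov using A2 C2 by (simp add: hm_mult_assoc Kd hm_pow_add [OF A2])
    also have "\<dots> = hm_one N \<odot>\<^bsub>t\<^esub> (hm_pow t A2 j \<odot>\<^bsub>t\<^esub> B2)"
      using B2 by (simp add: hm_sum_mult [OF car2] flip: left_inv)
    finally show ?thesis using A2 by (simp add: hm_mult_one_left)
  qed
  have cancel: "U = V" if "U \<in> carrier_mat m N" "V \<in> carrier_mat m N"
    "\<And>k. U \<odot>\<^bsub>t\<^esub> (hm_pow t A1 k \<odot>\<^bsub>t\<^esub> B1) = V \<odot>\<^bsub>t\<^esub> (hm_pow t A1 k \<odot>\<^bsub>t\<^esub> B1)" for U V m
  proof -
    have "(U - V) \<odot>\<^bsub>t\<^esub> hm_pow t A1 k \<odot>\<^bsub>t\<^esub> B1 = 0\<^sub>m m n" for k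
      using that A1 B1 by (simp add: hm_mult_assoc hm_diff_mult hm_diff_eq_zero)
    then have "U - V = 0\<^sub>m m N"
      using that(1,2) by (intro ctr) auto
    then show ?thesis using that(1,2) by (simp add: hm_diff_eq_zero)
  qed
  have "S \<odot>\<^bsub>t\<^esub> B1 = B2"
    using SAB [of 0] A1 B1 A2 B2 by (simp add: hm_mult_one_left)
  moreover have "C2 \<odot>\<^bsub>t\<^esub> S = C1"
  proof (rule cancel)
    fix k
    have "C2 \<odot>\<^bsub>t\<^esub> S \<odot>\<^bsub>t\<^esub> (hm_pow t A1 k \<odot>\<^bsub>t\<^esub> B1) = C2 \<odot>\<^bsub>t\<^esub> (S \<odot>\<^bsub>t\<^esub> (hm_pow t A1 k \<odot>\<^bsub>t\<^esub> B1))"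
      using C2 S by (simp add: hm_mult_assoc)
    then show "C2 \<odot>\<^bsub>t\<^esub> S \<odot>\<^bsub>t\<^esub> (hm_pow t A1 k \<odot>\<^bsub>t\<^esub> B1) = C1 \<odot>\<^bsub>t\<^esub> (hm_pow t A1 k \<odot>\<^bsub>t\<^esub> B1)"
      unfolding SAB using markov [of k] C1 C2 A1 A2 by (simp add: hm_mult_assoc)
  qed (use C1 C2 S hm_mult_carrier in blast)+
  moreover have "S \<odot>\<^bsub>t\<^esub> A1 = A2 \<odot>\<^bsub>t\<^esub> S"
  proof (rule cancel)
    fix k
    have "S \<odot>\<^bsub>t\<^esub> A1 \<odot>\<^bsub>t\<^esub> (hm_pow t A1 k \<odot>\<^bsub>t\<^esub> B1) = S \<odot>\<^bsub>t\<^esub> (hm_pow t A1 (Suc k) \<odot>\<^bsub>t\<^esub> B1)"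
      unfolding hm_pow_Suc_left [OF A1] using A1 S by (simp add: hm_mult_assoc)
    also have "\<dots> = A2 \<odot>\<^bsub>t\<^esub> (hm_pow t A2 k \<odot>\<^bsub>t\<^esub> B2)"
      unfolding SAB hm_pow_Suc_left [OF A2] using A2 by (simp add: hm_mult_assoc)
    also have "\<dots> = A2 \<odot>\<^bsub>t\<^esub> S \<odot>\<^bsub>t\<^esub> (hm_pow t A1 k \<odot>\<^bsub>t\<^esub> B1)"
      unfolding SAB [symmetric] using A2 S by (simp add: hm_mult_assoc)
    finally show "S \<odot>\<^bsub>t\<^esub> A1 \<odot>\<^bsub>t\<^esub> (hm_pow t A1 k \<odot>\<^bsub>t\<^esub> B1) = A2 \<odot>\<^bsub>t\<^esub> S \<odot>\<^bsub>t\<^esub> (hm_pow t A1 k \<odot>\<^bsub>t\<^esub> B1)" .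
  qed (use A1 A2 S hm_mult_carrier in blast)+
  ultimately show ?thesis using S that by blast
qed

text \<open>Multiply \<open>(I - x(A - F)) r\<^sub>1 = I\<close> by \<open>r\<close> from the left.\<close>

lemma resolvent_perturbation:
  assumes A: "A \<in> carrier_mat N N" and F: "F \<in> carrier_mat N N"
    and r: "hm_inverts t N (pencil N A x) r" and r1: "hm_inverts t N (pencil N (A - F) x) r1"
  shows "r1 = r - x *\<^sub>H (r \<odot>\<^bsub>t\<^esub> F \<odot>\<^bsub>t\<^esub> r1)"
proof -
  have rc: "r \<in> carrier_mat N N" "r1 \<in> carrier_mat N N" using r r1 by (auto simp: hm_inverts_def)
  have "pencil N A x \<odot>\<^bsub>t\<^esub> r1 = pencil N (A - F) x \<odot>\<^bsub>t\<^esub> r1 - x *\<^sub>H (F \<odot>\<^bsub>t\<^esub> r1)"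
    unfolding pencil_mult [OF A rc(2)] pencil_mult [OF minus_carrier_mat [OF F] rc(2)]
    using A F rc by (simp add: hm_distrib) (auto simp: mat_eq_iff hm_scaleR_index algebra_simps)
  also have "\<dots> = hm_one N - x *\<^sub>H (F \<odot>\<^bsub>t\<^esub> r1)" using r1 by (simp add: hm_inverts_def)
  finally have "r \<odot>\<^bsub>t\<^esub> (pencil N A x \<odot>\<^bsub>t\<^esub> r1) = r - x *\<^sub>H (r \<odot>\<^bsub>t\<^esub> F \<odot>\<^bsub>t\<^esub> r1)"
    using rc F by (simp add: hm_distrib hm_mult_assoc)
  moreover have "r \<odot>\<^bsub>t\<^esub> (pencil N A x \<odot>\<^bsub>t\<^esub> r1) = r1"
    using r rc A by (simp add: hm_inverts_def hm_mult_one_left flip: hm_mult_assoc)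
  ultimately show ?thesis by simp
qed

text \<open>The product expands to \<open>I\<close> plus \<open>x\<close> times a difference of two expressions for \<open>C r B E\<close>,
  one of them obtained from the resolvent identity for the perturbation \<open>F = B E C\<close>.\<close>

lemma inverse_realization:
  assumes D: "D \<in> carrier_mat n n" and C: "C \<in> carrier_mat n N"
    and A: "A \<in> carrier_mat N N" and B: "B \<in> carrier_mat N n" and E: "hm_inverts t n D E"
    and r: "hm_inverts t N (pencil N A x) r"
    and r1: "hm_inverts t N (pencil N (A - B \<odot>\<^bsub>t\<^esub> E \<odot>\<^bsub>t\<^esub> C) x) r1"
  shows "(D + x *\<^sub>H (C \<odot>\<^bsub>t\<^esub> r \<odot>\<^bsub>t\<^esub> B)) \<odot>\<^bsub>t\<^esub> (E - x *\<^sub>H ((E \<odot>\<^bsub>t\<^esub> C) \<odot>\<^bsub>t\<^esub> r1 \<odot>\<^bsub>t\<^esub> (B \<odot>\<^bsub>t\<^esub> E))) = hm_one n"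
proof -
  have Ec: "E \<in> carrier_mat n n" "D \<odot>\<^bsub>t\<^esub> E = hm_one n" using E by (auto simp: hm_inverts_def)
  have rc: "r \<in> carrier_mat N N" "r1 \<in> carrier_mat N N" using r r1 by (auto simp: hm_inverts_def)
  note car = D C A B Ec(1) rc
  have DE: "D \<odot>\<^bsub>t\<^esub> (E \<odot>\<^bsub>t\<^esub> Z) = Z" if "dim_row Z = n" for Z
    using that Ec D by (simp add: hm_mult_one_left flip: hm_mult_assoc)
  have "r1 = r - x *\<^sub>H (r \<odot>\<^bsub>t\<^esub> (B \<odot>\<^bsub>t\<^esub> E \<odot>\<^bsub>t\<^esub> C) \<odot>\<^bsub>t\<^esub> r1)"
    using car by (intro resolvent_perturbation [OF A _ r r1]) (auto intro!: hm_mult_carrier)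
  then have "C \<odot>\<^bsub>t\<^esub> (r1 \<odot>\<^bsub>t\<^esub> (B \<odot>\<^bsub>t\<^esub> E))
      = C \<odot>\<^bsub>t\<^esub> ((r - x *\<^sub>H (r \<odot>\<^bsub>t\<^esub> (B \<odot>\<^bsub>t\<^esub> E \<odot>\<^bsub>t\<^esub> C) \<odot>\<^bsub>t\<^esub> r1)) \<odot>\<^bsub>t\<^esub> (B \<odot>\<^bsub>t\<^esub> E))"
    by simp
  also have "\<dots> = C \<odot>\<^bsub>t\<^esub> (r \<odot>\<^bsub>t\<^esub> (B \<odot>\<^bsub>t\<^esub> E))
      - x *\<^sub>H (C \<odot>\<^bsub>t\<^esub> (r \<odot>\<^bsub>t\<^esub> (B \<odot>\<^bsub>t\<^esub> (E \<odot>\<^bsub>t\<^esub> (C \<odot>\<^bsub>t\<^esub> (r1 \<odot>\<^bsub>t\<^esub> (B \<odot>\<^bsub>t\<^esub> E)))))))"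
    using car by (simp add: hm_distrib hm_mult_assoc)
  finally have rel: "C \<odot>\<^bsub>t\<^esub> (r \<odot>\<^bsub>t\<^esub> (B \<odot>\<^bsub>t\<^esub> E)) = C \<odot>\<^bsub>t\<^esub> (r1 \<odot>\<^bsub>t\<^esub> (B \<odot>\<^bsub>t\<^esub> E))
      + x *\<^sub>H (C \<odot>\<^bsub>t\<^esub> (r \<odot>\<^bsub>t\<^esub> (B \<odot>\<^bsub>t\<^esub> (E \<odot>\<^bsub>t\<^esub> (C \<odot>\<^bsub>t\<^esub> (r1 \<odot>\<^bsub>t\<^esub> (B \<odot>\<^bsub>t\<^esub> E)))))))"
    using car by (auto simp: mat_eq_iff)
  have "(D + x *\<^sub>H (C \<odot>\<^bsub>t\<^esub> r \<odot>\<^bsub>t\<^esub> B)) \<odot>\<^bsub>t\<^esub> (E - x *\<^sub>H ((E \<odot>\<^bsub>t\<^esub> C) \<odot>\<^bsub>t\<^esub> r1 \<odot>\<^bsub>t\<^esub> (B \<odot>\<^bsub>t\<^esub> E)))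
      = (hm_one n + x *\<^sub>H (C \<odot>\<^bsub>t\<^esub> (r \<odot>\<^bsub>t\<^esub> (B \<odot>\<^bsub>t\<^esub> E))))
        - x *\<^sub>H (C \<odot>\<^bsub>t\<^esub> (r1 \<odot>\<^bsub>t\<^esub> (B \<odot>\<^bsub>t\<^esub> E))
          + x *\<^sub>H (C \<odot>\<^bsub>t\<^esub> (r \<odot>\<^bsub>t\<^esub> (B \<odot>\<^bsub>t\<^esub> (E \<odot>\<^bsub>t\<^esub> (C \<odot>\<^bsub>t\<^esub> (r1 \<odot>\<^bsub>t\<^esub> (B \<odot>\<^bsub>t\<^esub> E))))))))"
    using car Ec by (simp add: hm_distrib hm_mult_assoc DE)
  also have "\<dots> = hm_one n"
    unfolding rel [symmetric] using car by (auto simp: mat_eq_iff)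
  finally show ?thesis .
qed

text \<open>State feedback preserves controllability: once \<open>X (A - B E C)\<^sup>k B\<close> vanishes, the feedback
  term contributes nothing to the next power, so \<open>X (A - B E C)\<^sup>k = X A\<^sup>k\<close> inductively.\<close>

lemma feedback_controllable_cancel:
  assumes ctr: "controllable t n N A B" and A: "A \<in> carrier_mat N N" and B: "B \<in> carrier_mat N n"
    and C: "C \<in> carrier_mat n N" and E: "hm_inverts t n E D" and X: "X \<in> carrier_mat m N"
    and ann: "\<And>k. X \<odot>\<^bsub>t\<^esub> hm_pow t (A - B \<odot>\<^bsub>t\<^esub> E \<odot>\<^bsub>t\<^esub> C) k \<odot>\<^bsub>t\<^esub> (B \<odot>\<^bsub>t\<^esub> E) = 0\<^sub>m m n"
  shows "X = 0\<^sub>m m N"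
proof (rule controllable_cancel [OF ctr A B X])
  let ?A = "A - B \<odot>\<^bsub>t\<^esub> E \<odot>\<^bsub>t\<^esub> C"
  have Ec: "E \<in> carrier_mat n n" "D \<in> carrier_mat n n" "E \<odot>\<^bsub>t\<^esub> D = hm_one n"
    using E by (auto simp: hm_inverts_def)
  have A': "?A \<in> carrier_mat N N" using A B C Ec by (intro minus_carrier_mat hm_mult_carrier)
  have XB: "X \<odot>\<^bsub>t\<^esub> (hm_pow t ?A k \<odot>\<^bsub>t\<^esub> B) = 0\<^sub>m m n" for k
  proof -
    have "X \<odot>\<^bsub>t\<^esub> hm_pow t ?A k \<odot>\<^bsub>t\<^esub> (B \<odot>\<^bsub>t\<^esub> E) \<odot>\<^bsub>t\<^esub> D = 0\<^sub>m m n"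
      unfolding ann using Ec by (simp add: hm_mult_zero_left)
    then show ?thesis
      using X A B C Ec by (simp add: hm_mult_assoc hm_mult_one_right)
  qed
  have "X \<odot>\<^bsub>t\<^esub> hm_pow t A k = X \<odot>\<^bsub>t\<^esub> hm_pow t ?A k" for k
  proof (induction k)
    case 0
    show ?case using A B C by simp
  next
    case (Suc k)
    have "X \<odot>\<^bsub>t\<^esub> hm_pow t ?A (Suc k)
        = X \<odot>\<^bsub>t\<^esub> hm_pow t ?A k \<odot>\<^bsub>t\<^esub> A - X \<odot>\<^bsub>t\<^esub> (hm_pow t ?A k \<odot>\<^bsub>t\<^esub> B) \<odot>\<^bsub>t\<^esub> (E \<odot>\<^bsub>t\<^esub> C)"
      using X A B C Ec by (simp add: hm_mult_assoc hm_distrib)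
    then show ?case
      using X A C Ec by (simp add: XB hm_mult_zero_left hm_mult_assoc Suc [symmetric])
        (auto simp: mat_eq_iff)
  qed
  then show "X \<odot>\<^bsub>t\<^esub> hm_pow t A k \<odot>\<^bsub>t\<^esub> B = 0\<^sub>m m n" for k
    using XB [of k] X A B C by (simp add: hm_mult_assoc)
qed

text \<open>The dual argument: \<open>C\<close> annihilates every \<open>(A - B E C)\<^sup>k X\<close>, so that \<open>(A - B E C)\<^sup>k X = A\<^sup>k
  X\<close> inductively.\<close>

lemma feedback_observable_cancel:
  assumes obs: "observable t n N C A" and A: "A \<in> carrier_mat N N" and B: "B \<in> carrier_mat N n"
    and C: "C \<in> carrier_mat n N" and E: "hm_inverts t n D E" and X: "X \<in> carrier_mat N m"
    and ann: "\<And>k. (E \<odot>\<^bsub>t\<^esub> C) \<odot>\<^bsub>t\<^esub> hm_pow t (A - B \<odot>\<^bsub>t\<^esub> E \<odot>\<^bsub>t\<^esub> C) k \<odot>\<^bsub>t\<^esub> X = 0\<^sub>m n m"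
  shows "X = 0\<^sub>m N m"
proof (rule observable_cancel [OF obs A C X])
  let ?A = "A - B \<odot>\<^bsub>t\<^esub> E \<odot>\<^bsub>t\<^esub> C"
  have Ec: "E \<in> carrier_mat n n" "D \<in> carrier_mat n n" "D \<odot>\<^bsub>t\<^esub> E = hm_one n"
    using E by (auto simp: hm_inverts_def)
  have A': "?A \<in> carrier_mat N N" using A B C Ec by (intro minus_carrier_mat hm_mult_carrier)
  have CX: "C \<odot>\<^bsub>t\<^esub> (hm_pow t ?A k \<odot>\<^bsub>t\<^esub> X) = 0\<^sub>m n m" for k
  proof -
    have "D \<odot>\<^bsub>t\<^esub> ((E \<odot>\<^bsub>t\<^esub> C) \<odot>\<^bsub>t\<^esub> hm_pow t ?A k \<odot>\<^bsub>t\<^esub> X) = 0\<^sub>m n m"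
      unfolding ann using Ec by (simp add: hm_mult_zero_right)
    moreover have "D \<odot>\<^bsub>t\<^esub> ((E \<odot>\<^bsub>t\<^esub> C) \<odot>\<^bsub>t\<^esub> hm_pow t ?A k \<odot>\<^bsub>t\<^esub> X)
        = (D \<odot>\<^bsub>t\<^esub> E) \<odot>\<^bsub>t\<^esub> (C \<odot>\<^bsub>t\<^esub> (hm_pow t ?A k \<odot>\<^bsub>t\<^esub> X))"
      using A B C Ec(1,2) by (simp add: hm_mult_assoc)
    ultimately show ?thesis
      using C Ec by (simp add: hm_mult_one_left)
  qed
  have "hm_pow t A k \<odot>\<^bsub>t\<^esub> X = hm_pow t ?A k \<odot>\<^bsub>t\<^esub> X" for k
  proof (induction k)
    case 0
    show ?case using A B C by simp
  next
    case (Suc k)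
    have "hm_pow t ?A (Suc k) \<odot>\<^bsub>t\<^esub> X
        = A \<odot>\<^bsub>t\<^esub> (hm_pow t ?A k \<odot>\<^bsub>t\<^esub> X) - B \<odot>\<^bsub>t\<^esub> (E \<odot>\<^bsub>t\<^esub> (C \<odot>\<^bsub>t\<^esub> (hm_pow t ?A k \<odot>\<^bsub>t\<^esub> X)))"
      unfolding hm_pow_Suc_left [OF A'] using X A B C Ec
      by (simp add: hm_mult_assoc hm_distrib)
    moreover have "hm_pow t A (Suc k) \<odot>\<^bsub>t\<^esub> X = A \<odot>\<^bsub>t\<^esub> (hm_pow t A k \<odot>\<^bsub>t\<^esub> X)"
      unfolding hm_pow_Suc_left [OF A] using A by (simp add: hm_mult_assoc)
    ultimately show ?case
      using X A B Ec(1) unfolding CX Suc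
      by (simp del: hm_pow.simps add: hm_mult_zero_right) (auto simp: mat_eq_iff)
  qed
  then show "C \<odot>\<^bsub>t\<^esub> hm_pow t A k \<odot>\<^bsub>t\<^esub> X = 0\<^sub>m n m" for k
    using CX [of k] C A by (simp add: hm_mult_assoc)
qed

section \<open>Necessity: the Hermitian matrix of a J-unitary function\<close>

lemma signature_matrixD:
  assumes "signature_matrix t n J"
  shows "J \<in> carrier_mat n n" "J\<^sup>\<circledast> = J" "J \<odot>\<^bsub>t\<^esub> J = hm_one n"
  using assms hm_inv(2) [of t J n] unfolding signature_matrix_def by metis+

lemma mult_signature_cancel:
  "J \<in> carrier_mat n n \<Longrightarrow> J \<odot>\<^bsub>t\<^esub> J = hm_one n \<Longrightarrow> dim_row X = n \<Longrightarrow> J \<odot>\<^bsub>t\<^esub> (J \<odot>\<^bsub>t\<^esub> X) = X"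
  by (simp add: hm_mult_one_left flip: hm_mult_assoc)

text \<open>A right inverse of \<open>P\<close> is visible because \<open>J\<close> is its own inverse; that it is also a left
  inverse uses finite dimension.\<close>

lemma signature_unitary_inverse:
  assumes J: "J \<in> carrier_mat n n" "J \<odot>\<^bsub>t\<^esub> J = hm_one n"
    and P: "P \<in> carrier_mat n n" and Q: "Q \<in> carrier_mat n n" and PQ: "P \<odot>\<^bsub>t\<^esub> J \<odot>\<^bsub>t\<^esub> Q\<^sup>\<circledast> = J"
  shows "hm_inverts t n P (J \<odot>\<^bsub>t\<^esub> Q\<^sup>\<circledast> \<odot>\<^bsub>t\<^esub> J)"
proof (rule hm_right_inverse_imp_inverts)
  have "P \<odot>\<^bsub>t\<^esub> (J \<odot>\<^bsub>t\<^esub> Q\<^sup>\<circledast> \<odot>\<^bsub>t\<^esub> J) = (P \<odot>\<^bsub>t\<^esub> J \<odot>\<^bsub>t\<^esub> Q\<^sup>\<circledast>) \<odot>\<^bsub>t\<^esub> J"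
    using J(1) P Q by (simp add: hm_mult_assoc)
  then show "P \<odot>\<^bsub>t\<^esub> (J \<odot>\<^bsub>t\<^esub> Q\<^sup>\<circledast> \<odot>\<^bsub>t\<^esub> J) = hm_one n" by (simp add: PQ J)
qed (use J P Q in \<open>auto intro!: hm_mult_carrier hm_adj_carrier\<close>)

lemma is_realizationD:
  assumes "is_realization t n N R D C A B"
  shows "D \<in> carrier_mat n n" "C \<in> carrier_mat n N" "A \<in> carrier_mat N N" "B \<in> carrier_mat N n"
    "R 0 = Some D" "hm_invertible t (pencil N A x) \<Longrightarrow> R x = Some (realization_value t N D C A B x)"
  using assms by (auto simp: is_realization_def)

lemma realization_value_carrier:
  "D \<in> carrier_mat n n \<Longrightarrow> C \<in> carrier_mat n N \<Longrightarrow> B \<in> carrier_mat N n \<Longrightarrow>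
    realization_value t N D C A B x \<in> carrier_mat n n"
  by (auto simp: realization_value_def)

lemma pencil_uminus: "A \<in> carrier_mat N N \<Longrightarrow> pencil N (- A) x = pencil N A (- x)"
  by (auto simp: pencil_def mat_eq_iff hm_scaleR_index)

lemma pencil_uminus_adj:
  "A \<in> carrier_mat N N \<Longrightarrow> pencil N (- A\<^sup>\<circledast>) x = (pencil N A (- x))\<^sup>\<circledast>"
  by (simp add: pencil_adj pencil_uminus hm_adj_carrier)

lemma J_unitary_imp_D:
  assumes "is_realization t n N R D C A B" "J_unitary t J R"
  shows "D \<odot>\<^bsub>t\<^esub> J \<odot>\<^bsub>t\<^esub> D\<^sup>\<circledast> = J"
  using assms is_realizationD(5) [OF assms(1)] unfolding J_unitary_def by (metis minus_zero)

text \<open>Both sides are, up to a common sign, the coefficients of the inverse of \<open>R\<close>: on the left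
  by inverting the realization, on the right by unitarity, since \<open>J R(-x)\<^sup>\<circledast> J = E - x J B\<^sup>\<circledast> (I + x
  A\<^sup>\<circledast>)\<^sup>-\<^sup>1 C\<^sup>\<circledast> J\<close>.\<close>

lemma J_unitary_markov:
  assumes real: "is_realization t n N R D C A B" and sig: "signature_matrix t n J"
    and unitary: "J_unitary t J R" and E_def: "E = J \<odot>\<^bsub>t\<^esub> D\<^sup>\<circledast> \<odot>\<^bsub>t\<^esub> J"
  shows "(E \<odot>\<^bsub>t\<^esub> C) \<odot>\<^bsub>t\<^esub> hm_pow t (A - B \<odot>\<^bsub>t\<^esub> E \<odot>\<^bsub>t\<^esub> C) k \<odot>\<^bsub>t\<^esub> (B \<odot>\<^bsub>t\<^esub> E)
    = (J \<odot>\<^bsub>t\<^esub> B\<^sup>\<circledast>) \<odot>\<^bsub>t\<^esub> hm_pow t (- A\<^sup>\<circledast>) k \<odot>\<^bsub>t\<^esub> (C\<^sup>\<circledast> \<odot>\<^bsub>t\<^esub> J)"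
proof -
  note car = is_realizationD(1-4) [OF real]
  note J = signature_matrixD [OF sig]
  have E: "hm_inverts t n D E"
    unfolding E_def by (rule signature_unitary_inverse [OF J(1,3) car(1,1) J_unitary_imp_D [OF real unitary]])
  then have Ec: "E \<in> carrier_mat n n" by (simp add: hm_inverts_def)
  let ?A1 = "A - B \<odot>\<^bsub>t\<^esub> E \<odot>\<^bsub>t\<^esub> C"
  have A1: "?A1 \<in> carrier_mat N N" using car Ec by (intro minus_carrier_mat hm_mult_carrier)
  have A2: "- A\<^sup>\<circledast> \<in> carrier_mat N N" using car by (simp add: hm_adj_carrier)
  show ?thesis
  proof (rule markov_parameters_eq [OF A1 A2])
    have x0: "\<forall>\<^sub>F x in at 0. x \<noteq> (0 :: real)" by (simp add: eventually_at_filter)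
    show "\<forall>\<^sub>F x in at 0. (E \<odot>\<^bsub>t\<^esub> C) \<odot>\<^bsub>t\<^esub> hm_inv t (pencil N ?A1 x) \<odot>\<^bsub>t\<^esub> (B \<odot>\<^bsub>t\<^esub> E)
      = (J \<odot>\<^bsub>t\<^esub> B\<^sup>\<circledast>) \<odot>\<^bsub>t\<^esub> hm_inv t (pencil N (- A\<^sup>\<circledast>) x) \<odot>\<^bsub>t\<^esub> (C\<^sup>\<circledast> \<odot>\<^bsub>t\<^esub> J)"
      using eventually_invertible_pencil [OF car(3), of t 0] eventually_invertible_pencil [OF A1, of t 0]
        eventually_invertible_pencil [OF A2, of t 0] x0
    proof eventually_elim
      case (elim x)
      let ?V1 = "(E \<odot>\<^bsub>t\<^esub> C) \<odot>\<^bsub>t\<^esub> hm_inv t (pencil N ?A1 x) \<odot>\<^bsub>t\<^esub> (B \<odot>\<^bsub>t\<^esub> E)"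
        and ?V2 = "(J \<odot>\<^bsub>t\<^esub> B\<^sup>\<circledast>) \<odot>\<^bsub>t\<^esub> hm_inv t (pencil N (- A\<^sup>\<circledast>) x) \<odot>\<^bsub>t\<^esub> (C\<^sup>\<circledast> \<odot>\<^bsub>t\<^esub> J)"
      let ?P = "realization_value t N D C A B x" and ?Q = "realization_value t N D C A B (- x)"
      have minus: "pencil N A (- x) = (pencil N (- A\<^sup>\<circledast>) x)\<^sup>\<circledast>"
        using car by (simp add: pencil_uminus_adj)
      have inv: "hm_invertible t (pencil N A (- x))"
        unfolding minus by (rule hm_inv_adj [OF elim(3)])
      have r2: "hm_inv t (pencil N A (- x)) = (hm_inv t (pencil N (- A\<^sup>\<circledast>) x))\<^sup>\<circledast>"
        unfolding minus by (rule hm_inv_adj [OF elim(3)])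
      have PQc: "?P \<in> carrier_mat n n" "?Q \<in> carrier_mat n n"
        using car by (auto intro: realization_value_carrier)
      have "?P \<odot>\<^bsub>t\<^esub> J \<odot>\<^bsub>t\<^esub> ?Q\<^sup>\<circledast> = J"
        using unitary is_realizationD(6) [OF real elim(1)] is_realizationD(6) [OF real inv]
        by (auto simp: J_unitary_def)
      then have U: "hm_inverts t n ?P (J \<odot>\<^bsub>t\<^esub> ?Q\<^sup>\<circledast> \<odot>\<^bsub>t\<^esub> J)"
        by (rule signature_unitary_inverse [OF J(1,3) PQc])
      note r1 = hm_inverts_inv [OF elim(1)] hm_inverts_inv [OF elim(2)] hm_inverts_inv [OF elim(3)]
      note rc = hm_inv(1) [OF elim(1) pencil_carrier [OF car(3)]]
        hm_inv(1) [OF elim(2) pencil_carrier [OF A1]] hm_inv(1) [OF elim(3) pencil_carrier [OF A2]]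
      have "?P \<odot>\<^bsub>t\<^esub> (E - x *\<^sub>H ?V1) = hm_one n"
        unfolding realization_value_def
        by (rule inverse_realization [OF car E]) (use r1 car A1 in simp_all)
      then have "hm_inverts t n ?P (E - x *\<^sub>H ?V1)"
        using PQc Ec car rc by (intro hm_right_inverse_imp_inverts) auto
      from hm_inverts_unique [OF this U]
      (* Two expressions for the inverse of R at x. *)
      have "E - x *\<^sub>H ?V1 = J \<odot>\<^bsub>t\<^esub> ?Q\<^sup>\<circledast> \<odot>\<^bsub>t\<^esub> J" .
      also have "\<dots> = E - x *\<^sub>H ?V2"
        using car J(1) rc unfolding realization_value_def r2 E_def
        by (simp add: hm_adj_distrib hm_distrib hm_mult_assoc) (auto simp: mat_eq_iff hm_scaleR_index)
      finally have "x *\<^sub>H ?V1 = x *\<^sub>H ?V2"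
        using Ec car J(1) rc by (auto simp: mat_eq_iff)
      then show "?V1 = ?V2"
        using elim(4) Ec car J(1) rc by (auto simp: mat_eq_iff hm_scaleR_index)
    qed
  qed (use car Ec J(1) in \<open>auto intro!: hm_mult_carrier hm_adj_carrier\<close>)
qed

text \<open>The adjoint of a right inverse of the controllability matrix of \<open>(A, B)\<close> is a left
  inverse of an observability matrix; the signs and the factor \<open>J\<close> absorbed in \<open>K\<close> adapt it to the
  pair \<open>(J B\<^sup>\<circledast>, - A\<^sup>\<circledast>)\<close>.\<close>

lemma adjoint_left_inverse:
  assumes t: "t \<noteq> 0" and ctr: "controllable t n N A B"
    and A: "A \<in> carrier_mat N N" and B: "B \<in> carrier_mat N n"
    and J: "J \<in> carrier_mat n n" "J \<odot>\<^bsub>t\<^esub> J = hm_one n"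
  obtains d K where "\<And>k. K k \<in> carrier_mat N n"
    "hm_sum N N d (\<lambda>k. K k \<odot>\<^bsub>t\<^esub> (J \<odot>\<^bsub>t\<^esub> B\<^sup>\<circledast>) \<odot>\<^bsub>t\<^esub> hm_pow t (- A\<^sup>\<circledast>) k) = hm_one N"
proof -
  obtain d M where M: "\<And>k. M k \<in> carrier_mat n N"
    and sum: "hm_sum N N d (\<lambda>k. hm_pow t A k \<odot>\<^bsub>t\<^esub> B \<odot>\<^bsub>t\<^esub> M k) = hm_one N"
    using controllable_right_inverse [OF t ctr A B] by metis
  have Md: "dim_row (M k) = n" "dim_col (M k) = N" for k using M by auto
  define K where "K k = (-1) ^ k *\<^sub>H ((M k)\<^sup>\<circledast> \<odot>\<^bsub>t\<^esub> J)" for k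
  have car: "hm_pow t A k \<odot>\<^bsub>t\<^esub> B \<odot>\<^bsub>t\<^esub> M k \<in> carrier_mat N N" for k
    using hm_pow_carrier [OF A] B M by (intro hm_mult_carrier)
  have sign: "(-1) ^ k *\<^sub>H (-1) ^ k *\<^sub>H X = X" for k and X :: "ht mat"
    by (auto simp: mat_eq_iff hm_scaleR_index simp flip: power_mult_distrib)
  have "hm_sum N N d (\<lambda>k. K k \<odot>\<^bsub>t\<^esub> (J \<odot>\<^bsub>t\<^esub> B\<^sup>\<circledast>) \<odot>\<^bsub>t\<^esub> hm_pow t (- A\<^sup>\<circledast>) k)
      = (hm_sum N N d (\<lambda>k. hm_pow t A k \<odot>\<^bsub>t\<^esub> B \<odot>\<^bsub>t\<^esub> M k))\<^sup>\<circledast>"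
    unfolding hm_sum_adj [OF car] K_def hm_pow_uminus [OF hm_adj_carrier [OF A]]
    using A B J(1)
    by (intro hm_sum_cong)
      (simp add: hm_distrib hm_mult_assoc hm_adj_mult Md sign mult_signature_cancel [OF J] hm_pow_adj)
  then have "hm_sum N N d (\<lambda>k. K k \<odot>\<^bsub>t\<^esub> (J \<odot>\<^bsub>t\<^esub> B\<^sup>\<circledast>) \<odot>\<^bsub>t\<^esub> hm_pow t (- A\<^sup>\<circledast>) k) = hm_one N"
    by (simp add: sum)
  moreover have "K k \<in> carrier_mat N n" for k
    unfolding K_def using M J(1) by (intro hm_scaleR_carrier hm_mult_carrier hm_adj_carrier)
  ultimately show ?thesis using that by blast
qed

text \<open>The similarity \<open>S\<close> satisfies \<open>S B E = C\<^sup>\<circledast> J\<close>, \<open>J B\<^sup>\<circledast> S = E C\<close> and \<open>S (A - B E C) = - A\<^sup>\<circledast>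
  S\<close>. Inserting the first relation into the third gives \<open>A\<^sup>\<circledast> S + S A = C\<^sup>\<circledast> J C\<close>, an equation that
  \<open>S\<^sup>\<circledast>\<close> satisfies as well; the first relation and the adjoint of the second give \<open>S B = C\<^sup>\<circledast> J D = S\<^sup>\<circledast>
  B\<close>, so \<open>S\<close> is Hermitian by \<open>lyapunov_zero\<close>. Invertibility comes from observability: a matrix
  killed by \<open>S\<close> is killed by \<open>E C (A - B E C)\<^sup>k\<close> for all \<open>k\<close>. Then \<open>H = - S\<close>.\<close>

lemma associated_hermitian_exists:
  assumes t: "t \<noteq> 0" and sig: "signature_matrix t n J"
    and min: "minimal_realization t n N R D C A B" and unitary: "J_unitary t J R"
  shows "\<exists>H. associated_hermitian t N J D C A B H"
proof -
  have real: "is_realization t n N R D C A B" and obs: "observable t n N C A"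
    and ctr: "controllable t n N A B"
    using min by (auto simp: minimal_realization_def)
  note car = is_realizationD(1-4) [OF real]
  note J = signature_matrixD [OF sig]
  note JJ = mult_signature_cancel [OF J(1,3)]
  define E where "E = J \<odot>\<^bsub>t\<^esub> D\<^sup>\<circledast> \<odot>\<^bsub>t\<^esub> J"
  have E: "hm_inverts t n D E"
    unfolding E_def by (rule signature_unitary_inverse [OF J(1,3) car(1,1) J_unitary_imp_D [OF real unitary]])
  then have E': "hm_inverts t n E D" by (auto simp: hm_inverts_def)
  have Ec: "E \<in> carrier_mat n n" "E \<odot>\<^bsub>t\<^esub> D = hm_one n" using E by (auto simp: hm_inverts_def)
  define A1 where "A1 = A - B \<odot>\<^bsub>t\<^esub> E \<odot>\<^bsub>t\<^esub> C"
  have A1: "A1 \<in> carrier_mat N N"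
    unfolding A1_def using car Ec by (intro minus_carrier_mat hm_mult_carrier)
  have A2: "- A\<^sup>\<circledast> \<in> carrier_mat N N" using car by (simp add: hm_adj_carrier)
  have c1: "E \<odot>\<^bsub>t\<^esub> C \<in> carrier_mat n N" "B \<odot>\<^bsub>t\<^esub> E \<in> carrier_mat N n"
    and c2: "J \<odot>\<^bsub>t\<^esub> B\<^sup>\<circledast> \<in> carrier_mat n N" "C\<^sup>\<circledast> \<odot>\<^bsub>t\<^esub> J \<in> carrier_mat N n"
    using car Ec J(1) by (auto intro!: hm_mult_carrier hm_adj_carrier)
  obtain d K where K: "\<And>k. K k \<in> carrier_mat N n"
    "hm_sum N N d (\<lambda>k. K k \<odot>\<^bsub>t\<^esub> (J \<odot>\<^bsub>t\<^esub> B\<^sup>\<circledast>) \<odot>\<^bsub>t\<^esub> hm_pow t (- A\<^sup>\<circledast>) k) = hm_one N"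
    using adjoint_left_inverse [OF t ctr car(3,4) J(1,3)] by metis
  obtain S where S: "S \<in> carrier_mat N N" "S \<odot>\<^bsub>t\<^esub> (B \<odot>\<^bsub>t\<^esub> E) = C\<^sup>\<circledast> \<odot>\<^bsub>t\<^esub> J"
    "(J \<odot>\<^bsub>t\<^esub> B\<^sup>\<circledast>) \<odot>\<^bsub>t\<^esub> S = E \<odot>\<^bsub>t\<^esub> C" "S \<odot>\<^bsub>t\<^esub> A1 = (- A\<^sup>\<circledast>) \<odot>\<^bsub>t\<^esub> S"
  proof (rule intertwiner [OF A1 c1(2,1) A2 c2(2,1) _ _ K])
    show "(E \<odot>\<^bsub>t\<^esub> C) \<odot>\<^bsub>t\<^esub> hm_pow t A1 k \<odot>\<^bsub>t\<^esub> (B \<odot>\<^bsub>t\<^esub> E)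
        = (J \<odot>\<^bsub>t\<^esub> B\<^sup>\<circledast>) \<odot>\<^bsub>t\<^esub> hm_pow t (- A\<^sup>\<circledast>) k \<odot>\<^bsub>t\<^esub> (C\<^sup>\<circledast> \<odot>\<^bsub>t\<^esub> J)" for k
      unfolding A1_def by (rule J_unitary_markov [OF real sig unitary E_def])
    show "X = 0\<^sub>m m N" if "X \<in> carrier_mat m N"
      "\<And>k. X \<odot>\<^bsub>t\<^esub> hm_pow t A1 k \<odot>\<^bsub>t\<^esub> (B \<odot>\<^bsub>t\<^esub> E) = 0\<^sub>m m n" for m X
      using feedback_controllable_cancel [OF ctr car(3,4,2) E' that(1)] that(2)
      by (simp add: A1_def)
  qed
  have Ss: "S\<^sup>\<circledast> \<in> carrier_mat N N" using S by (simp add: hm_adj_carrier)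
  have "S \<odot>\<^bsub>t\<^esub> (B \<odot>\<^bsub>t\<^esub> E) \<odot>\<^bsub>t\<^esub> D = S \<odot>\<^bsub>t\<^esub> B"
    using S(1) car Ec by (simp add: hm_mult_assoc hm_mult_one_right)
  then have SB: "S \<odot>\<^bsub>t\<^esub> B = C\<^sup>\<circledast> \<odot>\<^bsub>t\<^esub> (J \<odot>\<^bsub>t\<^esub> D)"
    unfolding S(2) using car J by (simp add: hm_mult_assoc)
  have "J \<odot>\<^bsub>t\<^esub> (J \<odot>\<^bsub>t\<^esub> (B\<^sup>\<circledast> \<odot>\<^bsub>t\<^esub> S)) = J \<odot>\<^bsub>t\<^esub> (E \<odot>\<^bsub>t\<^esub> C)"
    unfolding S(3) [symmetric] using car J(1) by (simp add: hm_mult_assoc)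
  then have "B\<^sup>\<circledast> \<odot>\<^bsub>t\<^esub> S = D\<^sup>\<circledast> \<odot>\<^bsub>t\<^esub> (J \<odot>\<^bsub>t\<^esub> C)"
    using car J(1) S(1) unfolding E_def by (simp add: hm_mult_assoc JJ)
  then have "(B\<^sup>\<circledast> \<odot>\<^bsub>t\<^esub> S)\<^sup>\<circledast> = (D\<^sup>\<circledast> \<odot>\<^bsub>t\<^esub> (J \<odot>\<^bsub>t\<^esub> C))\<^sup>\<circledast>" by simp
  then have SsB: "S\<^sup>\<circledast> \<odot>\<^bsub>t\<^esub> B = C\<^sup>\<circledast> \<odot>\<^bsub>t\<^esub> (J \<odot>\<^bsub>t\<^esub> D)"
    using car J(1,2) S(1) by (simp add: hm_adj_mult hm_mult_assoc)
  have "S \<odot>\<^bsub>t\<^esub> A1 = S \<odot>\<^bsub>t\<^esub> A - S \<odot>\<^bsub>t\<^esub> (B \<odot>\<^bsub>t\<^esub> E) \<odot>\<^bsub>t\<^esub> C"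
    unfolding A1_def using S(1) car Ec(1) by (simp add: hm_distrib hm_mult_assoc)
  also have "\<dots> = S \<odot>\<^bsub>t\<^esub> A - C\<^sup>\<circledast> \<odot>\<^bsub>t\<^esub> (J \<odot>\<^bsub>t\<^esub> C)"
    unfolding S(2) using car J(1) by (simp add: hm_mult_assoc)
  finally have "S \<odot>\<^bsub>t\<^esub> A - C\<^sup>\<circledast> \<odot>\<^bsub>t\<^esub> (J \<odot>\<^bsub>t\<^esub> C) = - (A\<^sup>\<circledast> \<odot>\<^bsub>t\<^esub> S)"
    using S(4) by (simp add: hm_uminus_mult)
  then have lyap: "A\<^sup>\<circledast> \<odot>\<^bsub>t\<^esub> S + S \<odot>\<^bsub>t\<^esub> A = C\<^sup>\<circledast> \<odot>\<^bsub>t\<^esub> (J \<odot>\<^bsub>t\<^esub> C)"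
    using car S(1) J(1) by (auto simp: mat_eq_iff diff_eq_eq algebra_simps)
  then have "(A\<^sup>\<circledast> \<odot>\<^bsub>t\<^esub> S + S \<odot>\<^bsub>t\<^esub> A)\<^sup>\<circledast> = (C\<^sup>\<circledast> \<odot>\<^bsub>t\<^esub> (J \<odot>\<^bsub>t\<^esub> C))\<^sup>\<circledast>" by simp
  then have lyap_adj: "S\<^sup>\<circledast> \<odot>\<^bsub>t\<^esub> A + A\<^sup>\<circledast> \<odot>\<^bsub>t\<^esub> S\<^sup>\<circledast> = C\<^sup>\<circledast> \<odot>\<^bsub>t\<^esub> (J \<odot>\<^bsub>t\<^esub> C)"
    using car S(1) J(1,2) by (simp add: hm_adj_distrib hm_mult_assoc)
  have "S - S\<^sup>\<circledast> = 0\<^sub>m N N"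
  proof (rule lyapunov_zero [OF ctr car(3,4)])
    show "S - S\<^sup>\<circledast> \<in> carrier_mat N N" using Ss by (rule minus_carrier_mat)
    show "(S - S\<^sup>\<circledast>) \<odot>\<^bsub>t\<^esub> B = 0\<^sub>m N n"
      using S(1) car by (simp add: hm_diff_mult SB SsB) (auto simp: mat_eq_iff)
    have "A\<^sup>\<circledast> \<odot>\<^bsub>t\<^esub> (S - S\<^sup>\<circledast>) + (S - S\<^sup>\<circledast>) \<odot>\<^bsub>t\<^esub> A
        = (A\<^sup>\<circledast> \<odot>\<^bsub>t\<^esub> S + S \<odot>\<^bsub>t\<^esub> A) - (S\<^sup>\<circledast> \<odot>\<^bsub>t\<^esub> A + A\<^sup>\<circledast> \<odot>\<^bsub>t\<^esub> S\<^sup>\<circledast>)"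
      using S(1) car by (simp add: hm_distrib) (auto simp: mat_eq_iff)
    also have "\<dots> = 0\<^sub>m N N"
      unfolding lyap lyap_adj using car by (auto simp: mat_eq_iff)
    finally show "A\<^sup>\<circledast> \<odot>\<^bsub>t\<^esub> (S - S\<^sup>\<circledast>) + (S - S\<^sup>\<circledast>) \<odot>\<^bsub>t\<^esub> A = 0\<^sub>m N N" .
  qed
  then have herm: "S\<^sup>\<circledast> = S" using S(1) by (simp add: hm_diff_eq_zero)
  have invS: "hm_invertible t S"
  proof (rule hm_injective_imp_invertible [OF S(1)])
    fix X assume X: "X \<in> carrier_mat N N" and SX: "S \<odot>\<^bsub>t\<^esub> X = 0\<^sub>m N N"
    have "S \<odot>\<^bsub>t\<^esub> (hm_pow t A1 k \<odot>\<^bsub>t\<^esub> X) = 0\<^sub>m N N" for k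
    proof (induction k)
      case 0
      then show ?case using SX X A1 by (simp add: hm_mult_one_left)
    next
      case (Suc k)
      have "S \<odot>\<^bsub>t\<^esub> (hm_pow t A1 (Suc k) \<odot>\<^bsub>t\<^esub> X) = (S \<odot>\<^bsub>t\<^esub> A1) \<odot>\<^bsub>t\<^esub> (hm_pow t A1 k \<odot>\<^bsub>t\<^esub> X)"
        unfolding hm_pow_Suc_left [OF A1] using S(1) A1 by (simp add: hm_mult_assoc)
      also have "\<dots> = 0\<^sub>m N N"
        unfolding S(4) using S(1) A2 Suc car(3) by (simp add: hm_mult_assoc hm_mult_zero_right)
      finally show ?case .
    qed
    moreover have "(E \<odot>\<^bsub>t\<^esub> C) \<odot>\<^bsub>t\<^esub> hm_pow t A1 k \<odot>\<^bsub>t\<^esub> X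
        = (J \<odot>\<^bsub>t\<^esub> B\<^sup>\<circledast>) \<odot>\<^bsub>t\<^esub> (S \<odot>\<^bsub>t\<^esub> (hm_pow t A1 k \<odot>\<^bsub>t\<^esub> X))" for k
      unfolding S(3) [symmetric] using S(1) A1 car by (simp add: hm_mult_assoc)
    ultimately have "(E \<odot>\<^bsub>t\<^esub> C) \<odot>\<^bsub>t\<^esub> hm_pow t A1 k \<odot>\<^bsub>t\<^esub> X = 0\<^sub>m n N" for k
      using car J(1) by (simp add: hm_mult_zero_right)
    then show "X = 0\<^sub>m N N"
      unfolding A1_def by (rule feedback_observable_cancel [OF obs car(3,4,2) E X])
  qed
  note G = hm_inv [OF invS S(1)]
  have negG: "hm_inverts t N (- S) (- hm_inv t S)"
  proof -
    have "- (- hm_one N :: ht mat) = hm_one N" by (auto simp: mat_eq_iff)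
    then show ?thesis using S(1) G by (simp add: hm_inverts_def hm_uminus_mult hm_mult_uminus)
  qed
  show ?thesis
  proof (rule exI [of _ "- S"], unfold associated_hermitian_def hm_inv_eqI [OF negG], intro conjI)
    show "- S \<in> carrier_mat N N" using S(1) by simp
    show "hm_invertible t (- S)" using negG by (rule hm_invertibleI)
    show "- S = (- S)\<^sup>\<circledast>" using herm by (simp add: hm_adj_uminus)
    have "A\<^sup>\<circledast> \<odot>\<^bsub>t\<^esub> (- S) + (- S) \<odot>\<^bsub>t\<^esub> A = - (A\<^sup>\<circledast> \<odot>\<^bsub>t\<^esub> S + S \<odot>\<^bsub>t\<^esub> A)"
      using S(1) car by (simp add: hm_distrib) (auto simp: mat_eq_iff)
    then show "A\<^sup>\<circledast> \<odot>\<^bsub>t\<^esub> (- S) + (- S) \<odot>\<^bsub>t\<^esub> A = - (C\<^sup>\<circledast> \<odot>\<^bsub>t\<^esub> J \<odot>\<^bsub>t\<^esub> C)"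
      unfolding lyap using car J(1) by (simp add: hm_mult_assoc)
    have "B = hm_inv t S \<odot>\<^bsub>t\<^esub> (S \<odot>\<^bsub>t\<^esub> B)"
      using G S(1) car by (simp add: hm_mult_one_left flip: hm_mult_assoc)
    then have "B = hm_inv t S \<odot>\<^bsub>t\<^esub> (C\<^sup>\<circledast> \<odot>\<^bsub>t\<^esub> (J \<odot>\<^bsub>t\<^esub> D))" unfolding SB .
    then show "B = - ((- hm_inv t S) \<odot>\<^bsub>t\<^esub> C\<^sup>\<circledast> \<odot>\<^bsub>t\<^esub> J \<odot>\<^bsub>t\<^esub> D)"
      using G(1) car J(1) by (simp add: hm_mult_assoc hm_uminus_mult)
  qed
qed

lemma associated_hermitian_mult_B:
  assumes H: "associated_hermitian t N J D C A B H" and J: "J \<in> carrier_mat n n"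
    and D: "D \<in> carrier_mat n n" and C: "C \<in> carrier_mat n N"
  shows "H \<odot>\<^bsub>t\<^esub> B = - (C\<^sup>\<circledast> \<odot>\<^bsub>t\<^esub> (J \<odot>\<^bsub>t\<^esub> D))"
proof -
  have Hc: "H \<in> carrier_mat N N" "hm_invertible t H"
    and B: "B = - (hm_inv t H \<odot>\<^bsub>t\<^esub> C\<^sup>\<circledast> \<odot>\<^bsub>t\<^esub> J \<odot>\<^bsub>t\<^esub> D)"
    using H by (auto simp: associated_hermitian_def)
  note G = hm_inv [OF Hc(2,1)]
  have "H \<odot>\<^bsub>t\<^esub> B = - ((H \<odot>\<^bsub>t\<^esub> hm_inv t H) \<odot>\<^bsub>t\<^esub> (C\<^sup>\<circledast> \<odot>\<^bsub>t\<^esub> (J \<odot>\<^bsub>t\<^esub> D)))"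
    by (subst B) (use Hc(1) G(1) J C in \<open>simp add: hm_mult_assoc hm_mult_uminus\<close>)
  then show ?thesis using G C by (simp add: hm_mult_one_left)
qed

lemma associated_hermitian_unique:
  assumes sig: "signature_matrix t n J" and real: "is_realization t n N R D C A B"
    and ctr: "controllable t n N A B"
    and H: "associated_hermitian t N J D C A B H" and H': "associated_hermitian t N J D C A B H'"
  shows "H = H'"
proof -
  note car = is_realizationD(1-4) [OF real] and J = signature_matrixD(1) [OF sig]
  have Hc: "H \<in> carrier_mat N N" "H' \<in> carrier_mat N N"
    and lyap: "A\<^sup>\<circledast> \<odot>\<^bsub>t\<^esub> H + H \<odot>\<^bsub>t\<^esub> A = A\<^sup>\<circledast> \<odot>\<^bsub>t\<^esub> H' + H' \<odot>\<^bsub>t\<^esub> A"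
    using H H' by (auto simp: associated_hermitian_def)
  have "H - H' = 0\<^sub>m N N"
  proof (rule lyapunov_zero [OF ctr car(3,4)])
    show "H - H' \<in> carrier_mat N N" using Hc by auto
    show "(H - H') \<odot>\<^bsub>t\<^esub> B = 0\<^sub>m N n"
      using Hc car associated_hermitian_mult_B [OF H J car(1,2)]
        associated_hermitian_mult_B [OF H' J car(1,2)]
      by (simp add: hm_diff_mult hm_diff_eq_zero)
    have "A\<^sup>\<circledast> \<odot>\<^bsub>t\<^esub> (H - H') + (H - H') \<odot>\<^bsub>t\<^esub> A
        = (A\<^sup>\<circledast> \<odot>\<^bsub>t\<^esub> H + H \<odot>\<^bsub>t\<^esub> A) - (A\<^sup>\<circledast> \<odot>\<^bsub>t\<^esub> H' + H' \<odot>\<^bsub>t\<^esub> A)"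
      using Hc car by (simp add: hm_distrib) (auto simp: mat_eq_iff)
    then show "A\<^sup>\<circledast> \<odot>\<^bsub>t\<^esub> (H - H') + (H - H') \<odot>\<^bsub>t\<^esub> A = 0\<^sub>m N N"
      unfolding lyap using Hc car by (auto simp: mat_eq_iff)
  qed
  then show ?thesis using Hc by (simp add: hm_diff_eq_zero)
qed

section \<open>The kernel formula\<close>

text \<open>In terms of \<open>G = H\<^sup>-\<^sup>1\<close> the equations for \<open>H\<close> become the controllability form of the
  Lyapunov equation, in which \<open>J\<close> is multiplied by \<open>B\<close> rather than by \<open>C\<close>; these are the products
  that occur when \<open>R(x) J R(y)\<^sup>\<circledast>\<close> is expanded.\<close>

lemma associated_hermitian_inverse:
  assumes sig: "signature_matrix t n J" and DJD: "D \<odot>\<^bsub>t\<^esub> J \<odot>\<^bsub>t\<^esub> D\<^sup>\<circledast> = J"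
    and car: "D \<in> carrier_mat n n" "C \<in> carrier_mat n N" "A \<in> carrier_mat N N"
    and H: "associated_hermitian t N J D C A B H"
  defines "G \<equiv> hm_inv t H"
  shows "G \<in> carrier_mat N N" "B \<odot>\<^bsub>t\<^esub> (J \<odot>\<^bsub>t\<^esub> D\<^sup>\<circledast>) = - (G \<odot>\<^bsub>t\<^esub> C\<^sup>\<circledast>)"
    "D \<odot>\<^bsub>t\<^esub> (J \<odot>\<^bsub>t\<^esub> B\<^sup>\<circledast>) = - (C \<odot>\<^bsub>t\<^esub> G)"
    "B \<odot>\<^bsub>t\<^esub> (J \<odot>\<^bsub>t\<^esub> B\<^sup>\<circledast>) = - (A \<odot>\<^bsub>t\<^esub> G + G \<odot>\<^bsub>t\<^esub> A\<^sup>\<circledast>)"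
proof -
  note J = signature_matrixD [OF sig]
  note JJ = mult_signature_cancel [OF J(1,3)]
  have Hc: "H \<in> carrier_mat N N" "hm_invertible t H" "H\<^sup>\<circledast> = H"
    and lyap: "A\<^sup>\<circledast> \<odot>\<^bsub>t\<^esub> H + H \<odot>\<^bsub>t\<^esub> A = - (C\<^sup>\<circledast> \<odot>\<^bsub>t\<^esub> J \<odot>\<^bsub>t\<^esub> C)"
    and B: "B = - (G \<odot>\<^bsub>t\<^esub> C\<^sup>\<circledast> \<odot>\<^bsub>t\<^esub> J \<odot>\<^bsub>t\<^esub> D)"
    using H unfolding associated_hermitian_def G_def by metis+
  note G = hm_inv [OF Hc(2,1), folded G_def]
  have Gs: "G\<^sup>\<circledast> = G" using hm_inv_adj(2) [OF Hc(2)] by (simp add: Hc(3) G_def)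
  show "G \<in> carrier_mat N N" by (rule G)
  have DJD': "D \<odot>\<^bsub>t\<^esub> (J \<odot>\<^bsub>t\<^esub> D\<^sup>\<circledast>) = J" using DJD car J(1) by (simp add: hm_mult_assoc)
  have Bc: "B \<in> carrier_mat N n" by (subst B, rule carrier_matI) (use G(1) car in simp_all)
  show BJD: "B \<odot>\<^bsub>t\<^esub> (J \<odot>\<^bsub>t\<^esub> D\<^sup>\<circledast>) = - (G \<odot>\<^bsub>t\<^esub> C\<^sup>\<circledast>)"
    by (subst B) (use G(1) car J in \<open>simp add: hm_mult_assoc hm_uminus_mult DJD' hm_mult_one_right\<close>)
  then have "(B \<odot>\<^bsub>t\<^esub> (J \<odot>\<^bsub>t\<^esub> D\<^sup>\<circledast>))\<^sup>\<circledast> = (- (G \<odot>\<^bsub>t\<^esub> C\<^sup>\<circledast>))\<^sup>\<circledast>" by simp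
  then show "D \<odot>\<^bsub>t\<^esub> (J \<odot>\<^bsub>t\<^esub> B\<^sup>\<circledast>) = - (C \<odot>\<^bsub>t\<^esub> G)"
    using G(1) car J(1,2) Bc by (simp add: hm_adj_distrib hm_mult_assoc Gs)
  have Bs: "B\<^sup>\<circledast> = - (D\<^sup>\<circledast> \<odot>\<^bsub>t\<^esub> (J \<odot>\<^bsub>t\<^esub> (C \<odot>\<^bsub>t\<^esub> G)))"
    by (subst B) (use G(1) car J(1,2) in \<open>simp add: hm_adj_distrib hm_mult_assoc Gs\<close>)
  have "B \<odot>\<^bsub>t\<^esub> (J \<odot>\<^bsub>t\<^esub> B\<^sup>\<circledast>) = - ((B \<odot>\<^bsub>t\<^esub> (J \<odot>\<^bsub>t\<^esub> D\<^sup>\<circledast>)) \<odot>\<^bsub>t\<^esub> (J \<odot>\<^bsub>t\<^esub> (C \<odot>\<^bsub>t\<^esub> G)))"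
    unfolding Bs using G(1) car J(1) Bc by (simp add: hm_mult_assoc hm_mult_uminus)
  also have "\<dots> = - (G \<odot>\<^bsub>t\<^esub> (- (C\<^sup>\<circledast> \<odot>\<^bsub>t\<^esub> J \<odot>\<^bsub>t\<^esub> C)) \<odot>\<^bsub>t\<^esub> G)"
    unfolding BJD using G(1) car J(1) by (simp add: hm_mult_assoc hm_uminus_mult hm_mult_uminus)
  also have "\<dots> = - (G \<odot>\<^bsub>t\<^esub> (A\<^sup>\<circledast> \<odot>\<^bsub>t\<^esub> (H \<odot>\<^bsub>t\<^esub> G)) + (G \<odot>\<^bsub>t\<^esub> H) \<odot>\<^bsub>t\<^esub> (A \<odot>\<^bsub>t\<^esub> G))"
    unfolding lyap [symmetric] using G(1) car Hc(1) by (simp add: hm_mult_assoc hm_add_mult hm_mult_add)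
  also have "\<dots> = - (A \<odot>\<^bsub>t\<^esub> G + G \<odot>\<^bsub>t\<^esub> A\<^sup>\<circledast>)"
    unfolding G(2,3) using G(1) car
    by (simp add: hm_mult_one_left hm_mult_one_right) (auto simp: mat_eq_iff)
  finally show "B \<odot>\<^bsub>t\<^esub> (J \<odot>\<^bsub>t\<^esub> B\<^sup>\<circledast>) = - (A \<odot>\<^bsub>t\<^esub> G + G \<odot>\<^bsub>t\<^esub> A\<^sup>\<circledast>)" .
qed

text \<open>With \<open>U = C r(x)\<close> and \<open>V = (I - y A\<^sup>\<circledast>)\<^sup>-\<^sup>1 C\<^sup>\<circledast>\<close> one has \<open>C = U - x U A\<close> and \<open>C\<^sup>\<circledast> = V - y A\<^sup>\<circledast>
  V\<close>. Each of the mixed terms of \<open>R(x) J R(y)\<^sup>\<circledast>\<close> is then a combination of \<open>U G V\<close>, \<open>U A G V\<close> and \<open>U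
  G A\<^sup>\<circledast> V\<close>, and in the sum only \<open>- (x + y) U G V\<close> survives beside \<open>D J D\<^sup>\<circledast> = J\<close>.\<close>

lemma kernel_formula:
  assumes sig: "signature_matrix t n J" and DJD: "D \<odot>\<^bsub>t\<^esub> J \<odot>\<^bsub>t\<^esub> D\<^sup>\<circledast> = J"
    and car: "D \<in> carrier_mat n n" "C \<in> carrier_mat n N" "A \<in> carrier_mat N N" "B \<in> carrier_mat N n"
    and H: "associated_hermitian t N J D C A B H"
    and x: "hm_invertible t (pencil N A x)" and y: "hm_invertible t (pencil N (A\<^sup>\<circledast>) y)"
  shows "J - realization_value t N D C A B x \<odot>\<^bsub>t\<^esub> J \<odot>\<^bsub>t\<^esub> (realization_value t N D C A B y)\<^sup>\<circledast>
    = (x + y) *\<^sub>H (C \<odot>\<^bsub>t\<^esub> hm_inv t (pencil N A x) \<odot>\<^bsub>t\<^esub> hm_inv t H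
        \<odot>\<^bsub>t\<^esub> hm_inv t (pencil N (A\<^sup>\<circledast>) y) \<odot>\<^bsub>t\<^esub> C\<^sup>\<circledast>)"
proof -
  note J = signature_matrixD [OF sig]
  define G where "G = hm_inv t H"
  note G = associated_hermitian_inverse [OF sig DJD car(1-3) H, folded G_def]
  have As: "A\<^sup>\<circledast> \<in> carrier_mat N N" using car by (simp add: hm_adj_carrier)
  define r where "r = hm_inv t (pencil N A x)"
  define \<rho> where "\<rho> = hm_inv t (pencil N (A\<^sup>\<circledast>) y)"
  note r = hm_inv [OF x pencil_carrier [OF car(3)], folded r_def]
  note \<rho> = hm_inv [OF y pencil_carrier [OF As], folded \<rho>_def]
  have py: "pencil N A y = (pencil N (A\<^sup>\<circledast>) y)\<^sup>\<circledast>" using As by (simp add: pencil_adj)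
  have ry: "hm_inv t (pencil N A y) = \<rho>\<^sup>\<circledast>"
    unfolding py \<rho>_def by (rule hm_inv_adj(2) [OF y])
  define U where "U = C \<odot>\<^bsub>t\<^esub> r"
  define V where "V = \<rho> \<odot>\<^bsub>t\<^esub> C\<^sup>\<circledast>"
  have U: "U \<in> carrier_mat n N" and V: "V \<in> carrier_mat N n"
    using car r(1) \<rho>(1) by (auto simp: U_def V_def intro!: hm_mult_carrier hm_adj_carrier)
  have "U \<odot>\<^bsub>t\<^esub> pencil N A x = C" using r car by (simp add: U_def hm_mult_assoc hm_mult_one_right)
  then have CU: "C = U - x *\<^sub>H (U \<odot>\<^bsub>t\<^esub> A)" by (simp add: mult_pencil [OF car(3) U])
  have "pencil N (A\<^sup>\<circledast>) y \<odot>\<^bsub>t\<^esub> V = C\<^sup>\<circledast>"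
    using \<rho> car by (simp add: V_def hm_mult_one_left flip: hm_mult_assoc)
  then have CV: "C\<^sup>\<circledast> = V - y *\<^sub>H (A\<^sup>\<circledast> \<odot>\<^bsub>t\<^esub> V)" by (simp add: pencil_mult [OF As V])
  have DJD': "D \<odot>\<^bsub>t\<^esub> (J \<odot>\<^bsub>t\<^esub> D\<^sup>\<circledast>) = J" using DJD car J(1) by (simp add: hm_mult_assoc)
  have Rx: "realization_value t N D C A B x = D + x *\<^sub>H (U \<odot>\<^bsub>t\<^esub> B)"
    by (simp add: realization_value_def U_def r_def)
  have Ry: "(realization_value t N D C A B y)\<^sup>\<circledast> = D\<^sup>\<circledast> + y *\<^sub>H (B\<^sup>\<circledast> \<odot>\<^bsub>t\<^esub> V)"
    unfolding realization_value_def ry V_def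
    using car \<rho>(1) by (simp add: hm_adj_distrib)
  have DJBV: "D \<odot>\<^bsub>t\<^esub> (J \<odot>\<^bsub>t\<^esub> (B\<^sup>\<circledast> \<odot>\<^bsub>t\<^esub> V)) = - (U \<odot>\<^bsub>t\<^esub> (G \<odot>\<^bsub>t\<^esub> V) - x *\<^sub>H (U \<odot>\<^bsub>t\<^esub> (A \<odot>\<^bsub>t\<^esub> (G \<odot>\<^bsub>t\<^esub> V))))"
  proof -
    have "D \<odot>\<^bsub>t\<^esub> (J \<odot>\<^bsub>t\<^esub> (B\<^sup>\<circledast> \<odot>\<^bsub>t\<^esub> V)) = D \<odot>\<^bsub>t\<^esub> (J \<odot>\<^bsub>t\<^esub> B\<^sup>\<circledast>) \<odot>\<^bsub>t\<^esub> V"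
      using car J(1) by (simp add: hm_mult_assoc)
    also have "\<dots> = - ((U - x *\<^sub>H (U \<odot>\<^bsub>t\<^esub> A)) \<odot>\<^bsub>t\<^esub> G \<odot>\<^bsub>t\<^esub> V)"
      unfolding G(3) CU [symmetric] by (simp add: hm_uminus_mult)
    finally show ?thesis using U car G(1) by (simp add: hm_distrib hm_mult_assoc)
  qed
  have UBJD: "U \<odot>\<^bsub>t\<^esub> (B \<odot>\<^bsub>t\<^esub> (J \<odot>\<^bsub>t\<^esub> D\<^sup>\<circledast>)) = - (U \<odot>\<^bsub>t\<^esub> (G \<odot>\<^bsub>t\<^esub> V) - y *\<^sub>H (U \<odot>\<^bsub>t\<^esub> (G \<odot>\<^bsub>t\<^esub> (A\<^sup>\<circledast> \<odot>\<^bsub>t\<^esub> V))))"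
    unfolding G(2) CV using U V car G(1) by (simp add: hm_distrib)
  have UBJBV: "U \<odot>\<^bsub>t\<^esub> (B \<odot>\<^bsub>t\<^esub> (J \<odot>\<^bsub>t\<^esub> (B\<^sup>\<circledast> \<odot>\<^bsub>t\<^esub> V)))
      = - (U \<odot>\<^bsub>t\<^esub> (A \<odot>\<^bsub>t\<^esub> (G \<odot>\<^bsub>t\<^esub> V)) + U \<odot>\<^bsub>t\<^esub> (G \<odot>\<^bsub>t\<^esub> (A\<^sup>\<circledast> \<odot>\<^bsub>t\<^esub> V)))"
  proof -
    have "U \<odot>\<^bsub>t\<^esub> (B \<odot>\<^bsub>t\<^esub> (J \<odot>\<^bsub>t\<^esub> (B\<^sup>\<circledast> \<odot>\<^bsub>t\<^esub> V))) = U \<odot>\<^bsub>t\<^esub> (B \<odot>\<^bsub>t\<^esub> (J \<odot>\<^bsub>t\<^esub> B\<^sup>\<circledast>)) \<odot>\<^bsub>t\<^esub> V"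
      using car J(1) U by (simp add: hm_mult_assoc)
    then show ?thesis
      unfolding G(4) using U V car G(1) by (simp add: hm_distrib hm_mult_assoc)
  qed
  have "realization_value t N D C A B x \<odot>\<^bsub>t\<^esub> J \<odot>\<^bsub>t\<^esub> (realization_value t N D C A B y)\<^sup>\<circledast>
      = J - (x + y) *\<^sub>H (U \<odot>\<^bsub>t\<^esub> (G \<odot>\<^bsub>t\<^esub> V))"
    unfolding Rx Ry using car J(1) U V G(1)
    by (simp add: hm_distrib hm_mult_assoc DJD' DJBV UBJD UBJBV)
      (auto simp: mat_eq_iff hm_scaleR_index algebra_simps)
  moreover have "U \<odot>\<^bsub>t\<^esub> (G \<odot>\<^bsub>t\<^esub> V) = C \<odot>\<^bsub>t\<^esub> r \<odot>\<^bsub>t\<^esub> G \<odot>\<^bsub>t\<^esub> \<rho> \<odot>\<^bsub>t\<^esub> C\<^sup>\<circledast>"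
    unfolding U_def V_def using car r(1) \<rho>(1) G(1) by (simp add: hm_mult_assoc)
  ultimately show ?thesis
    unfolding r_def [symmetric] \<rho>_def [symmetric] G_def [symmetric]
    using car J(1) by (auto simp: mat_eq_iff)
qed

section \<open>Sufficiency: passing to the limit at removable singularities\<close>

text \<open>Wherever \<open>R\<close> is defined its value is the limit of the realization formula: by continuity
  of the resolvent, or, at a removable singularity, by the definition of a realization. Since
  singular points are isolated, the limit may be taken along all points.\<close>

lemma realization_tendsto:
  assumes real: "is_realization t n N R D C A B" and P: "R x = Some P"
  shows "hm_tendsto (realization_value t N D C A B) P (at x)"
proof (cases "hm_invertible t (pencil N A x)")
  case True
  note car = is_realizationD(1-4) [OF real]
  note r = hm_inv(1) [OF True pencil_carrier [OF car(3)]]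
  have "hm_tendsto (realization_value t N D C A B) (realization_value t N D C A B x) (at x)"
    unfolding realization_value_def using car r True
    by (intro hm_tendsto_add hm_tendsto_scaleR hm_tendsto_mult hm_tendsto_const
        resolvent_tendsto tendsto_intros) auto
  then show ?thesis using P is_realizationD(6) [OF real True] by simp
next
  case False
  note car = is_realizationD(1-4) [OF real]
  let ?V = "{y. hm_invertible t (pencil N A y)}"
  have Pc: "P \<in> carrier_mat n n"
    and lim: "\<And>i j. i < n \<Longrightarrow> j < n \<Longrightarrow>
      ((\<lambda>y. realization_value t N D C A B y $$ (i, j)) \<longlongrightarrow> P $$ (i, j)) (at x within ?V)"
    using real P False by (auto simp: is_realization_def)
  have "at x within ?V = at x"
  proof (rule antisym)
    show "at x within ?V \<le> at x" by (rule at_le) simp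
    have "\<forall>\<^sub>F y in at x. y \<in> ?V" using eventually_invertible_pencil [OF car(3)] by simp
    then show "at x \<le> at x within ?V"
      by (auto simp: le_filter_def eventually_at_filter elim: eventually_elim2)
  qed
  moreover have "realization_value t N D C A B y \<in> carrier_mat n n" for y
    using car by (auto intro: realization_value_carrier)
  ultimately show ?thesis
    using Pc lim carrier_matD [OF \<open>\<And>y. realization_value t N D C A B y \<in> carrier_mat n n\<close>]
    by (simp add: hm_tendsto_def)
qed

text \<open>The kernel formula with \<open>y = - x\<close> gives the equation at all but finitely many points;
  the remaining ones are reached by a limit.\<close>

lemma J_unitary_sufficient:
  assumes real: "is_realization t n N R D C A B" and sig: "signature_matrix t n J"
    and DJD: "D \<odot>\<^bsub>t\<^esub> J \<odot>\<^bsub>t\<^esub> D\<^sup>\<circledast> = J" and H: "associated_hermitian t N J D C A B H"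
  shows "J_unitary t J R"
  unfolding J_unitary_def
proof (intro allI impI)
  fix x P Q assume P: "R x = Some P" and Q: "R (- x) = Some Q"
  note car = is_realizationD(1-4) [OF real] and J = signature_matrixD [OF sig]
  let ?R = "realization_value t N D C A B"
  have Rc: "?R y \<in> carrier_mat n n" for y using car by (auto intro: realization_value_carrier)
  have Plim: "hm_tendsto ?R P (at x)" by (rule realization_tendsto [OF real P])
  have "hm_tendsto ?R Q (at (- x))" by (rule realization_tendsto [OF real Q])
  then have Qlim: "hm_tendsto (\<lambda>y. ?R (- y)) Q (at x)"
    by (simp add: hm_tendsto_def filterlim_filtermap eventually_filtermap
        flip: filtermap_at_minus [of x])
  have Pd: "dim_row P = n" "dim_col P = n" and Qd: "dim_row Q = n" "dim_col Q = n"
    using Plim Qlim carrier_matD [OF Rc] by (simp_all add: hm_tendsto_def)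
  have "hm_tendsto (\<lambda>y. ?R y \<odot>\<^bsub>t\<^esub> J \<odot>\<^bsub>t\<^esub> (?R (- y))\<^sup>\<circledast>) (P \<odot>\<^bsub>t\<^esub> J \<odot>\<^bsub>t\<^esub> Q\<^sup>\<circledast>) (at x)"
    using Plim Qlim J(1) Pd Qd by (intro hm_tendsto_mult hm_tendsto_adj hm_tendsto_const) auto
  moreover have "\<forall>\<^sub>F y in at x. ?R y \<odot>\<^bsub>t\<^esub> J \<odot>\<^bsub>t\<^esub> (?R (- y))\<^sup>\<circledast> = J"
    using eventually_invertible_pencil [OF car(3), of t x]
      eventually_invertible_pencil [OF hm_adj_carrier [OF uminus_carrier_mat [OF car(3)]], of t x]
  proof eventually_elim
    case (elim y)
    have "hm_invertible t (pencil N (A\<^sup>\<circledast>) (- y))"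
      using elim(2) pencil_uminus [OF hm_adj_carrier [OF car(3)]] by (simp add: hm_adj_uminus)
    from kernel_formula [OF sig DJD car H elim(1) this]
    have "J - ?R y \<odot>\<^bsub>t\<^esub> J \<odot>\<^bsub>t\<^esub> (?R (- y))\<^sup>\<circledast> = 0\<^sub>m n n"
      using car by (auto simp: mat_eq_iff hm_scaleR_index)
    then show ?case
      using J(1) Rc [of y] Rc [of "- y"] by (simp add: hm_diff_eq_zero)
  qed
  ultimately have "hm_tendsto (\<lambda>y. J) (P \<odot>\<^bsub>t\<^esub> J \<odot>\<^bsub>t\<^esub> Q\<^sup>\<circledast>) (at x)"
    by (rule hm_tendsto_cong)
  then show "P \<odot>\<^bsub>t\<^esub> J \<odot>\<^bsub>t\<^esub> Q\<^sup>\<circledast> = J"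
    using hm_tendsto_const by (rule hm_tendsto_unique) simp
qed

theorem theorem4p1:
  fixes t :: real and n N :: nat
    and J D C A B :: "ht mat" and R :: "real \<rightharpoonup> ht mat"
  assumes "t \<noteq> 0"
    and "signature_matrix t n J"
    and "rational_at_origin t n R"
    and "minimal_realization t n N R D C A B"
  shows "(J_unitary t J R \<longleftrightarrow>
           D \<odot>\<^bsub>t\<^esub> J \<odot>\<^bsub>t\<^esub> D\<^sup>\<circledast> = J \<and> (\<exists>H. associated_hermitian t N J D C A B H)) \<and>
         (J_unitary t J R \<longrightarrow>
           (\<exists>!H. associated_hermitian t N J D C A B H) \<and>
           (\<forall>H x y P Q.
              associated_hermitian t N J D C A B H \<longrightarrow>
              R x = Some P \<longrightarrow> R y = Some Q \<longrightarrow> x + y \<noteq> 0 \<longrightarrow>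
              hm_invertible t (pencil N A x) \<longrightarrow> hm_invertible t (pencil N (A\<^sup>\<circledast>) y) \<longrightarrow>
              (1 / (x + y)) *\<^sub>H (J - P \<odot>\<^bsub>t\<^esub> J \<odot>\<^bsub>t\<^esub> Q\<^sup>\<circledast>) =
                C \<odot>\<^bsub>t\<^esub> hm_inv t (pencil N A x) \<odot>\<^bsub>t\<^esub> hm_inv t H
                  \<odot>\<^bsub>t\<^esub> hm_inv t (pencil N (A\<^sup>\<circledast>) y) \<odot>\<^bsub>t\<^esub> C\<^sup>\<circledast>))"
proof -
  have real: "is_realization t n N R D C A B" and ctr: "controllable t n N A B"
    using assms(4) by (auto simp: minimal_realization_def)
  note car = is_realizationD(1-4) [OF real]
  have kernel: "(1 / (x + y)) *\<^sub>H (J - P \<odot>\<^bsub>t\<^esub> J \<odot>\<^bsub>t\<^esub> Q\<^sup>\<circledast>) =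
      C \<odot>\<^bsub>t\<^esub> hm_inv t (pencil N A x) \<odot>\<^bsub>t\<^esub> hm_inv t H
        \<odot>\<^bsub>t\<^esub> hm_inv t (pencil N (A\<^sup>\<circledast>) y) \<odot>\<^bsub>t\<^esub> C\<^sup>\<circledast>"
    if unitary: "J_unitary t J R" and H: "associated_hermitian t N J D C A B H"
      and PQ: "R x = Some P" "R y = Some Q" and xy: "x + y \<noteq> 0"
      and x: "hm_invertible t (pencil N A x)" and y: "hm_invertible t (pencil N (A\<^sup>\<circledast>) y)" for H x y P Q
  proof -
    have "hm_invertible t (pencil N A y)"
      using hm_inv_adj(1) [OF y] car by (simp add: pencil_adj hm_adj_carrier)
    then have "P = realization_value t N D C A B x" "Q = realization_value t N D C A B y"
      using PQ is_realizationD(6) [OF real] x by auto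
    moreover have "(1 / (x + y)) *\<^sub>H (x + y) *\<^sub>H K = K" for K
      using xy by (auto simp: mat_eq_iff hm_scaleR_index)
    ultimately show ?thesis
      using kernel_formula [OF assms(2) J_unitary_imp_D [OF real unitary] car H x y] by simp
  qed
  have "D \<odot>\<^bsub>t\<^esub> J \<odot>\<^bsub>t\<^esub> D\<^sup>\<circledast> = J" "\<exists>!H. associated_hermitian t N J D C A B H" if "J_unitary t J R"
    using J_unitary_imp_D [OF real that] associated_hermitian_exists [OF assms(1,2,4) that]
      associated_hermitian_unique [OF assms(2) real ctr] by blast+
  moreover have "J_unitary t J R"
    if "D \<odot>\<^bsub>t\<^esub> J \<odot>\<^bsub>t\<^esub> D\<^sup>\<circledast> = J" "associated_hermitian t N J D C A B H" for H
    using J_unitary_sufficient [OF real assms(2) that] .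
  ultimately show ?thesis using kernel by blast
qed

end
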